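(* Let $\mathfrak{g}=\mathfrak{sl}_2(\mathbb{C})$ and $\mathfrak{L}^3=\mathfrak{g}\ltimes L(3)$, where $L(3)$ is an abelian ideal. For $\chi\in\mathbb{C}$, the unique simple quotient $V(0,\chi)$ of the $\mathfrak{L}^3$-module $Q(0,\chi)$ is a $\mathfrak{g}$-Harish-Chandra module. It is infinite-dimensional if $\chi\neq 0$.
   Context: Everything is over $\mathbb{C}$. $\mathfrak{g}=\mathfrak{sl}_2$ has standard basis $f,h,e$; $L(n)$ is the simple $\mathfrak{g}$-module of dimension $n+1$. Write $\mathfrak{r}=L(3)$ with basis of weight vectors $v_3,v_1,v_{-1},v_{-3}$, $[h,v_i]=iv_i$, $[e,v_1]=3v_3$, $[e,v_{-1}]=2v_1$, $[e,v_{-3}]=v_{-1}$. The algebra of invariants $\operatorname{Sym}(\mathfrak{r})^{\mathfrak{g}}$ is the polynomial algebra generated by the cubic discriminant \[ C=v_{-1}^2v_1^2-27v_{-3}^2v_3^2-4v_{-1}^3v_3-4v_{-3}v_1^3+18v_{-3}v_{-1}v_1v_3,\] which is central in $U(\mathfrak{L}^3)$. Let $Q(0):=U(\mathfrak{L}^3)\otimes_{U(\mathfrak{g})}L(0)$ ($\cong\operatorname{Sym}(\mathfrak{r})$) and $Q(0,\chi):=Q(0)/(C-\chi)Q(0)$; it has a unique simple quotient, denoted $V(0,\chi)$. An $\mathfrak{L}^3$-module is a $\mathfrak{g}$-Harish-Chandra module if its restriction to $\mathfrak{g}$ is a direct sum of simple finite-dimensional $\mathfrak{g}$-modules, each isomorphism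 class occurring with finite multiplicity. *)

theory Defs
  imports "HOL-Analysis.Determinants" "HOL-Algebra.QuotRing" "HOL-Algebra.Module"
begin

section \<open>Complex vector spaces, Lie algebras and their modules\<close>

definition complex_ring :: "complex ring" where
  "complex_ring = \<lparr>carrier = UNIV, mult = (*), one = 1, zero = 0, add = (+)\<rparr>"

lemma complex_ring_simps [simp]:
  "carrier complex_ring = UNIV" "mult complex_ring = (*)" "one complex_ring = 1"
  "zero complex_ring = 0" "add complex_ring = (+)"
  by (simp_all add: complex_ring_def)

text \<open>
  Complex vector spaces are modules over \<^const>\<open>complex_ring\<close>. The record of modules extends the
  record of rings; for vector spaces without a product the fields \<open>mult\<close> and \<open>one\<close> carry no
  information and are left \<^const>\<open>undefined\<close>.
\<close>

record 'l lie_algebra = "(complex, 'l) module" +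
  bracket :: "'l \<Rightarrow> 'l \<Rightarrow> 'l"

text \<open>
  The operators \<open>act x\<close> of a vector space, for \<open>x\<close> in a Lie algebra or in an associative algebra.
\<close>

record ('l, 'b) rep = "(complex, 'b) module" +
  act :: "'l \<Rightarrow> 'b \<Rightarrow> 'b"

locale lie_algebra = Module.module complex_ring L for L :: "('l, 'm) lie_algebra_scheme" (structure) +
  assumes bracket_closed: "\<lbrakk>x \<in> carrier L; y \<in> carrier L\<rbrakk> \<Longrightarrow> bracket L x y \<in> carrier L"
    and bracket_add_left: "\<lbrakk>x \<in> carrier L; y \<in> carrier L; z \<in> carrier L\<rbrakk> \<Longrightarrow>
      bracket L (x \<oplus> y) z = bracket L x z \<oplus> bracket L y z"
    and bracket_smult_left: "\<lbrakk>x \<in> carrier L; y \<in> carrier L\<rbrakk> \<Longrightarrow>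
      bracket L (c \<odot> x) y = c \<odot> bracket L x y"
    and bracket_add_right: "\<lbrakk>x \<in> carrier L; y \<in> carrier L; z \<in> carrier L\<rbrakk> \<Longrightarrow>
      bracket L x (y \<oplus> z) = bracket L x y \<oplus> bracket L x z"
    and bracket_smult_right: "\<lbrakk>x \<in> carrier L; y \<in> carrier L\<rbrakk> \<Longrightarrow>
      bracket L x (c \<odot> y) = c \<odot> bracket L x y"
    and bracket_self: "x \<in> carrier L \<Longrightarrow> bracket L x x = \<zero>"
    and jacobi: "\<lbrakk>x \<in> carrier L; y \<in> carrier L; z \<in> carrier L\<rbrakk> \<Longrightarrow>
      bracket L x (bracket L y z) \<oplus> bracket L y (bracket L z x) \<oplus> bracket L z (bracket L x y) = \<zero>"

locale lie_module = L: lie_algebra L + M: Module.module complex_ring M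
  for L :: "('l, 'm) lie_algebra_scheme" and M :: "('l, 'b, 'n) rep_scheme" +
  assumes act_closed: "\<lbrakk>x \<in> carrier L; u \<in> carrier M\<rbrakk> \<Longrightarrow> act M x u \<in> carrier M"
    and act_add_left: "\<lbrakk>x \<in> carrier L; y \<in> carrier L; u \<in> carrier M\<rbrakk> \<Longrightarrow>
      act M (x \<oplus>\<^bsub>L\<^esub> y) u = act M x u \<oplus>\<^bsub>M\<^esub> act M y u"
    and act_smult_left: "\<lbrakk>x \<in> carrier L; u \<in> carrier M\<rbrakk> \<Longrightarrow>
      act M (c \<odot>\<^bsub>L\<^esub> x) u = c \<odot>\<^bsub>M\<^esub> act M x u"
    and act_add_right: "\<lbrakk>x \<in> carrier L; u \<in> carrier M; v \<in> carrier M\<rbrakk> \<Longrightarrow>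
      act M x (u \<oplus>\<^bsub>M\<^esub> v) = act M x u \<oplus>\<^bsub>M\<^esub> act M x v"
    and act_smult_right: "\<lbrakk>x \<in> carrier L; u \<in> carrier M\<rbrakk> \<Longrightarrow>
      act M x (c \<odot>\<^bsub>M\<^esub> u) = c \<odot>\<^bsub>M\<^esub> act M x u"
    and act_bracket: "\<lbrakk>x \<in> carrier L; y \<in> carrier L; u \<in> carrier M\<rbrakk> \<Longrightarrow>
      act M (bracket L x y) u = act M x (act M y u) \<ominus>\<^bsub>M\<^esub> act M y (act M x u)"

definition lie_submodule :: "('l, 'm) lie_algebra_scheme \<Rightarrow> ('l, 'b, 'n) rep_scheme \<Rightarrow> 'b set \<Rightarrow> bool" where
  "lie_submodule L M N \<longleftrightarrow>
     submodule N complex_ring M \<and> (\<forall>x\<in>carrier L. \<forall>u\<in>N. act M x u \<in> N)"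

definition simple_lie_module :: "('l, 'm) lie_algebra_scheme \<Rightarrow> ('l, 'b, 'n) rep_scheme \<Rightarrow> bool" where
  "simple_lie_module L M \<longleftrightarrow> lie_module L M \<and> carrier M \<noteq> {\<zero>\<^bsub>M\<^esub>} \<and>
     (\<forall>N. lie_submodule L M N \<longrightarrow> N = {\<zero>\<^bsub>M\<^esub>} \<or> N = carrier M)"

definition lie_module_iso ::
    "('l, 'm) lie_algebra_scheme \<Rightarrow> ('l, 'b, 'n) rep_scheme \<Rightarrow> ('l, 'c, 'k) rep_scheme \<Rightarrow> bool" where
  "lie_module_iso L M N \<longleftrightarrow> (\<exists>\<phi>. bij_betw \<phi> (carrier M) (carrier N) \<and>
     (\<forall>u\<in>carrier M. \<forall>v\<in>carrier M. \<phi> (u \<oplus>\<^bsub>M\<^esub> v) = \<phi> u \<oplus>\<^bsub>N\<^esub> \<phi> v) \<and>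
     (\<forall>c. \<forall>u\<in>carrier M. \<phi> (c \<odot>\<^bsub>M\<^esub> u) = c \<odot>\<^bsub>N\<^esub> \<phi> u) \<and>
     (\<forall>x\<in>carrier L. \<forall>u\<in>carrier M. \<phi> (act M x u) = act N x (\<phi> u)))"

definition finite_dimensional :: "(complex, 'b, 'n) module_scheme \<Rightarrow> bool" where
  "finite_dimensional M \<longleftrightarrow> (\<exists>B. finite B \<and> B \<subseteq> carrier M \<and>
     (\<forall>u\<in>carrier M. \<exists>c. u = (\<Oplus>\<^bsub>M\<^esub>b\<in>B. c b \<odot>\<^bsub>M\<^esub> b)))"

text \<open>
  The internal direct sum of a set of subspaces: every vector has exactly one expression as a sum
  of components, finitely many of which are nonzero.
\<close>

definition is_direct_sum :: "(complex, 'b, 'n) module_scheme \<Rightarrow> 'b set set \<Rightarrow> bool" where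
  "is_direct_sum M S \<longleftrightarrow> (\<forall>W\<in>S. submodule W complex_ring M) \<and>
     (\<forall>u\<in>carrier M. \<exists>!c. c \<in> (\<Pi>\<^sub>E W\<in>S. W) \<and> finite {W\<in>S. c W \<noteq> \<zero>\<^bsub>M\<^esub>} \<and>
        u = (\<Oplus>\<^bsub>M\<^esub>W\<in>{W\<in>S. c W \<noteq> \<zero>\<^bsub>M\<^esub>}. c W))"

definition quotient_module :: "('l, 'b, 'n) rep_scheme \<Rightarrow> 'b set \<Rightarrow> ('l, 'b set) rep" where
  "quotient_module M N =
    \<lparr>carrier = a_rcosets\<^bsub>M\<^esub> N, mult = undefined, one = undefined, zero = N, add = set_add M,
     smult = (\<lambda>c X. \<Union>u\<in>X. N +>\<^bsub>M\<^esub> (c \<odot>\<^bsub>M\<^esub> u)),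
     act = (\<lambda>x X. \<Union>u\<in>X. N +>\<^bsub>M\<^esub> act M x u)\<rparr>"

definition pullback_module :: "('k \<Rightarrow> 'l) \<Rightarrow> ('l, 'b, 'n) rep_scheme \<Rightarrow> ('k, 'b) rep" where
  "pullback_module \<phi> M =
    \<lparr>carrier = carrier M, mult = mult M, one = one M, zero = zero M, add = add M,
     smult = smult M, act = (\<lambda>x. act M (\<phi> x))\<rparr>"

text \<open>
  A module over a Lie algebra \<open>L\<close> is a Harish-Chandra module for a Lie algebra \<open>K\<close> embedded in \<open>L\<close>
  by \<open>\<phi>\<close>. Nonzero direct summands of a module are pairwise distinct as subspaces, so a set of
  subspaces records all multiplicities.
\<close>

definition harish_chandra_module ::
    "('k, 'm) lie_algebra_scheme \<Rightarrow> ('k \<Rightarrow> 'l) \<Rightarrow> ('l, 'n) lie_algebra_scheme \<Rightarrow> ('l, 'b) rep \<Rightarrow> bool" where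
  "harish_chandra_module K \<phi> L M \<longleftrightarrow> lie_module L M \<and>
     (let R = pullback_module \<phi> M in
      \<exists>S. (\<forall>W\<in>S. lie_submodule K R W \<and> simple_lie_module K (R\<lparr>carrier := W\<rparr>) \<and>
                  finite_dimensional (R\<lparr>carrier := W\<rparr>)) \<and>
          is_direct_sum R S \<and>
          (\<forall>W\<in>S. finite {W'\<in>S. lie_module_iso K (R\<lparr>carrier := W'\<rparr>) (R\<lparr>carrier := W\<rparr>)}))"

definition semidirect :: "'l lie_algebra \<Rightarrow> ('l, 'b) rep \<Rightarrow> ('l \<times> 'b) lie_algebra" where
  "semidirect L M =
    \<lparr>carrier = carrier L \<times> carrier M, mult = undefined, one = undefined,
     zero = (\<zero>\<^bsub>L\<^esub>, \<zero>\<^bsub>M\<^esub>), add = (\<lambda>(x, u) (y, v). (x \<oplus>\<^bsub>L\<^esub> y, u \<oplus>\<^bsub>M\<^esub> v)),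
     smult = (\<lambda>c (x, u). (c \<odot>\<^bsub>L\<^esub> x, c \<odot>\<^bsub>M\<^esub> u)),
     bracket = (\<lambda>(x, u) (y, v). (bracket L x y, act M x v \<ominus>\<^bsub>M\<^esub> act M y u))\<rparr>"


section \<open>The universal enveloping algebra\<close>

definition free_space :: "'x set \<Rightarrow> (complex, 'x \<Rightarrow> complex) module" where
  "free_space X =
    \<lparr>carrier = {p. finite {x. p x \<noteq> 0} \<and> {x. p x \<noteq> 0} \<subseteq> X}, mult = undefined, one = undefined,
     zero = (\<lambda>_. 0), add = (\<lambda>p q x. p x + q x), smult = (\<lambda>c p x. c * p x)\<rparr>"

definition delta :: "'x \<Rightarrow> 'x \<Rightarrow> complex" where
  "delta x = (\<lambda>y. if y = x then 1 else 0)"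

text \<open>
  The linear map of free vector spaces that sends \<open>delta x\<close> to \<open>delta (f x)\<close>.
\<close>

definition push_forward :: "('x \<Rightarrow> 'y) \<Rightarrow> ('x \<Rightarrow> complex) \<Rightarrow> 'y \<Rightarrow> complex" where
  "push_forward f p = (\<lambda>y. \<Sum>x | p x \<noteq> 0 \<and> f x = y. p x)"

text \<open>
  The free associative algebra on the set of all elements of \<open>L\<close>: words are multiplied by
  concatenation. Its quotient by the relations that make the generators linear is the tensor algebra.
\<close>

definition free_algebra :: "('l, 'm) lie_algebra_scheme \<Rightarrow> (complex, 'l list \<Rightarrow> complex) module" where
  "free_algebra L = (free_space (lists (carrier L)))
     \<lparr>mult := (\<lambda>p q w. \<Sum>i\<le>length w. p (take i w) * q (drop i w)), one := delta []\<rparr>"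

definition env_relations :: "('l, 'm) lie_algebra_scheme \<Rightarrow> ('l list \<Rightarrow> complex) set" where
  "env_relations L = (let T = free_algebra L; gen = (\<lambda>x. delta [x]) in
     {gen (x \<oplus>\<^bsub>L\<^esub> y) \<ominus>\<^bsub>T\<^esub> (gen x \<oplus>\<^bsub>T\<^esub> gen y) | x y. x \<in> carrier L \<and> y \<in> carrier L} \<union>
     {gen (c \<odot>\<^bsub>L\<^esub> x) \<ominus>\<^bsub>T\<^esub> (c \<odot>\<^bsub>T\<^esub> gen x) | c x. x \<in> carrier L} \<union>
     {(gen x \<otimes>\<^bsub>T\<^esub> gen y \<ominus>\<^bsub>T\<^esub> gen y \<otimes>\<^bsub>T\<^esub> gen x) \<ominus>\<^bsub>T\<^esub> gen (bracket L x y) | x y.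
        x \<in> carrier L \<and> y \<in> carrier L})"

definition env_ideal :: "('l, 'm) lie_algebra_scheme \<Rightarrow> ('l list \<Rightarrow> complex) set" where
  "env_ideal L = Idl\<^bsub>free_algebra L\<^esub> (env_relations L)"

definition enveloping_algebra ::
    "('l, 'm) lie_algebra_scheme \<Rightarrow> (complex, ('l list \<Rightarrow> complex) set) module" where
  "enveloping_algebra L = (let T = free_algebra L; I = env_ideal L in
     ring.extend (T Quot I) (module.fields (\<lambda>c X. \<Union>p\<in>X. I +>\<^bsub>T\<^esub> (c \<odot>\<^bsub>T\<^esub> p))))"

definition env_gen :: "('l, 'm) lie_algebra_scheme \<Rightarrow> 'l \<Rightarrow> ('l list \<Rightarrow> complex) set" where
  "env_gen L x = env_ideal L +>\<^bsub>free_algebra L\<^esub> delta [x]"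

definition env_map ::
    "('l, 'm) lie_algebra_scheme \<Rightarrow> ('k \<Rightarrow> 'l) \<Rightarrow> ('k list \<Rightarrow> complex) set \<Rightarrow> ('l list \<Rightarrow> complex) set" where
  "env_map L \<phi> X = (\<Union>p\<in>X. env_ideal L +>\<^bsub>free_algebra L\<^esub> push_forward (map \<phi>) p)"

text \<open>
  The module over the enveloping algebra belonging to a module of the Lie algebra: a word
  \<open>[x, y, \<dots>]\<close> operates as the composition of the operators \<open>act M x\<close>, \<open>act M y\<close>, and so on.
\<close>

definition env_module :: "('l, 'b, 'n) rep_scheme \<Rightarrow> (('l list \<Rightarrow> complex) set, 'b) rep" where
  "env_module M =
    \<lparr>carrier = carrier M, mult = mult M, one = one M, zero = zero M, add = add M, smult = smult M,
     act = (\<lambda>X u. the_elem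
       ((\<lambda>p. \<Oplus>\<^bsub>M\<^esub>w\<in>{w. p w \<noteq> 0}. p w \<odot>\<^bsub>M\<^esub> foldr (act M) w u) ` X))\<rparr>"


section \<open>Extension of scalars\<close>

text \<open>
  For a homomorphism \<open>j\<close> of associative algebras from \<open>A\<close> to \<open>B\<close> and a left module \<open>N\<close> over \<open>A\<close>,
  the left \<open>B\<close>-module that is the tensor product of \<open>B\<close> and \<open>N\<close> over \<open>A\<close>. It is the quotient of the
  free vector space on pairs (standing for pure tensors) by the usual relations.
\<close>

definition tensor_relations ::
    "(complex, 'a, 'm) module_scheme \<Rightarrow> (complex, 'u, 'k) module_scheme \<Rightarrow> ('a \<Rightarrow> 'u) \<Rightarrow>
     ('a, 'b, 'n) rep_scheme \<Rightarrow> ('u \<times> 'b \<Rightarrow> complex) set" where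
  "tensor_relations A B j N = (let F = free_space (carrier B \<times> carrier N) in
     {delta (s \<oplus>\<^bsub>B\<^esub> t, u) \<ominus>\<^bsub>F\<^esub> (delta (s, u) \<oplus>\<^bsub>F\<^esub> delta (t, u)) | s t u.
        s \<in> carrier B \<and> t \<in> carrier B \<and> u \<in> carrier N} \<union>
     {delta (s, u \<oplus>\<^bsub>N\<^esub> v) \<ominus>\<^bsub>F\<^esub> (delta (s, u) \<oplus>\<^bsub>F\<^esub> delta (s, v)) | s u v.
        s \<in> carrier B \<and> u \<in> carrier N \<and> v \<in> carrier N} \<union>
     {delta (c \<odot>\<^bsub>B\<^esub> s, u) \<ominus>\<^bsub>F\<^esub> (c \<odot>\<^bsub>F\<^esub> delta (s, u)) | c s u. s \<in> carrier B \<and> u \<in> carrier N} \<union>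
     {delta (s, c \<odot>\<^bsub>N\<^esub> u) \<ominus>\<^bsub>F\<^esub> (c \<odot>\<^bsub>F\<^esub> delta (s, u)) | c s u. s \<in> carrier B \<and> u \<in> carrier N} \<union>
     {delta (s \<otimes>\<^bsub>B\<^esub> j a, u) \<ominus>\<^bsub>F\<^esub> delta (s, act N a u) | a s u.
        a \<in> carrier A \<and> s \<in> carrier B \<and> u \<in> carrier N})"

definition extension_of_scalars ::
    "(complex, 'a, 'm) module_scheme \<Rightarrow> (complex, 'u, 'k) module_scheme \<Rightarrow> ('a \<Rightarrow> 'u) \<Rightarrow>
     ('a, 'b, 'n) rep_scheme \<Rightarrow> ('u, ('u \<times> 'b \<Rightarrow> complex) set) rep" where
  "extension_of_scalars A B j N = (let F = free_space (carrier B \<times> carrier N) in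
     quotient_module
       (module.extend F (rep.fields (\<lambda>s. push_forward (\<lambda>(t, u). (s \<otimes>\<^bsub>B\<^esub> t, u)))))
       (\<Inter>{H. submodule H complex_ring F \<and> tensor_relations A B j N \<subseteq> H}))"


section \<open>The semidirect product of \<open>sl\<^sub>2\<close> and its four-dimensional simple module\<close>

type_synonym mat2 = "complex^2^2"
type_synonym L3_elem = "mat2 \<times> (nat \<Rightarrow> complex)"

definition sl2 :: "mat2 lie_algebra" where
  "sl2 = \<lparr>carrier = {X. trace X = 0}, mult = undefined, one = undefined, zero = 0, add = (+),
          smult = (\<lambda>c X. \<chi> i j. c * X$i$j), bracket = (\<lambda>X Y. X ** Y - Y ** X)\<rparr>"

definition sl2_e :: "mat2" where "sl2_e = vector [vector [0, 1], vector [0, 0]]"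
definition sl2_h :: "mat2" where "sl2_h = vector [vector [1, 0], vector [0, -1]]"
definition sl2_f :: "mat2" where "sl2_f = vector [vector [0, 0], vector [1, 0]]"

text \<open>
  The simple module of dimension \<open>n + 1\<close>, by coordinates with respect to a basis
  \<open>b\<^sub>0, \<dots>, b\<^sub>n\<close> of weight vectors with \<open>h b\<^sub>k = (2 k - n) b\<^sub>k\<close>, \<open>e b\<^sub>k = (k + 1) b\<^bsub>k+1\<^esub>\<close> and
  \<open>f b\<^sub>k = (n - k + 1) b\<^bsub>k-1\<^esub>\<close>.
\<close>

definition simple_sl2 :: "nat \<Rightarrow> (mat2, nat \<Rightarrow> complex) rep" where
  "simple_sl2 n =
    \<lparr>carrier = {u. \<forall>k>n. u k = 0}, mult = undefined, one = undefined,
     zero = (\<lambda>_. 0), add = (\<lambda>u v k. u k + v k), smult = (\<lambda>c u k. c * u k),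
     act = (\<lambda>X u k. if k \<le> n
        then X$1$1 * (2 * of_nat k - of_nat n) * u k + X$1$2 * of_nat k * u (k - 1) +
             X$2$1 * of_nat (n - k) * u (k + 1)
        else 0)\<rparr>"


lemma complex_ring_cring: "cring complex_ring"
proof (intro cringI abelian_groupI comm_monoidI)
  fix x :: complex
  show "\<exists>y\<in>carrier complex_ring. y \<oplus>\<^bsub>complex_ring\<^esub> x = \<zero>\<^bsub>complex_ring\<^esub>"
    by (auto intro: exI[of _ "- x"])
qed (auto simp: algebra_simps)

lemma sl2_simps:
  "carrier sl2 = {X. trace X = 0}" "zero sl2 = 0" "add sl2 = (+)"
  "smult sl2 c X = (\<chi> i j. c * X$i$j)" "bracket sl2 X Y = X ** Y - Y ** X"
  by (simp_all add: sl2_def)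

lemma simple_sl2_simps:
  "carrier (simple_sl2 n) = {u. \<forall>k>n. u k = 0}" "zero (simple_sl2 n) = (\<lambda>_. 0)"
  "add (simple_sl2 n) = (\<lambda>u v k. u k + v k)" "smult (simple_sl2 n) = (\<lambda>c u k. c * u k)"
  by (simp_all add: simple_sl2_def)

lemma module_sl2: "Module.module complex_ring sl2"
proof (intro Module.moduleI complex_ring_cring abelian_groupI)
  fix X assume "X \<in> carrier sl2"
  then show "\<exists>Y\<in>carrier sl2. Y \<oplus>\<^bsub>sl2\<^esub> X = \<zero>\<^bsub>sl2\<^esub>"
    by (auto simp: sl2_simps trace_def sum_2 add_eq_0_iff intro!: exI[of _ "- X"])
qed (auto simp: sl2_simps trace_def sum_2 vec_eq_iff algebra_simps add_eq_0_iff)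

lemma lie_algebra_sl2: "lie_algebra sl2"
proof (intro lie_algebra.intro module_sl2 lie_algebra_axioms.intro)
qed (auto simp: sl2_simps trace_def sum_2 vec_eq_iff matrix_matrix_mult_def forall_2 algebra_simps)

lemma module_simple_sl2: "Module.module complex_ring (simple_sl2 n)"
proof (intro Module.moduleI complex_ring_cring abelian_groupI)
  fix u assume "u \<in> carrier (simple_sl2 n)"
  then show "\<exists>v\<in>carrier (simple_sl2 n). v \<oplus>\<^bsub>simple_sl2 n\<^esub> u = \<zero>\<^bsub>simple_sl2 n\<^esub>"
    by (auto simp: simple_sl2_simps intro!: exI[of _ "\<lambda>k. - u k"])
qed (auto simp: simple_sl2_simps algebra_simps)

lemma a_minus_simple_sl2:
  assumes "u \<in> carrier (simple_sl2 n)" "v \<in> carrier (simple_sl2 n)"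
  shows "u \<ominus>\<^bsub>simple_sl2 n\<^esub> v = (\<lambda>k. u k - v k)"
proof -
  interpret Module.module complex_ring "simple_sl2 n" by (rule module_simple_sl2)
  have "\<ominus>\<^bsub>simple_sl2 n\<^esub> v = (\<lambda>k. - v k)"
    by (rule minus_equality) (use assms in \<open>auto simp: simple_sl2_simps\<close>)
  then show ?thesis by (simp add: a_minus_def simple_sl2_simps)
qed

lemma act_simple_sl2_closed: "act (simple_sl2 n) X u \<in> carrier (simple_sl2 n)"
  by (auto simp: simple_sl2_def)

lemma lie_module_simple_sl2: "lie_module sl2 (simple_sl2 n)"
proof (intro lie_module.intro lie_algebra_sl2 module_simple_sl2 lie_module_axioms.intro)
  fix X Y u
  assume X: "X \<in> carrier sl2" and Y: "Y \<in> carrier sl2" and u: "u \<in> carrier (simple_sl2 n)"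
  have tr: "X$2$2 = - X$1$1" "Y$2$2 = - Y$1$1"
    using X Y by (auto simp: sl2_simps trace_def sum_2 add_eq_0_iff)
  have un: "u k = 0" if "k > n" for k using u that by (auto simp: simple_sl2_simps)
  have "act (simple_sl2 n) (bracket sl2 X Y) u k =
      act (simple_sl2 n) X (act (simple_sl2 n) Y u) k - act (simple_sl2 n) Y (act (simple_sl2 n) X u) k" for k
  proof (cases "k \<le> n")
    case True
    then obtain m where n: "n = k + m" using le_Suc_ex by blast
    show ?thesis
    proof (cases k; cases m)
      fix k' m' assume "k = Suc k'" "m = Suc m'"
      then show ?thesis unfolding n
        by (simp add: simple_sl2_def sl2_simps matrix_matrix_mult_def sum_2 tr algebra_simps)
    qed (use n in \<open>simp_all add: simple_sl2_def sl2_simps matrix_matrix_mult_def sum_2 tr algebra_simps un\<close>)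
  qed (simp add: simple_sl2_def)
  then show "act (simple_sl2 n) (bracket sl2 X Y) u = act (simple_sl2 n) X (act (simple_sl2 n) Y u)
      \<ominus>\<^bsub>simple_sl2 n\<^esub> act (simple_sl2 n) Y (act (simple_sl2 n) X u)"
    by (simp add: a_minus_simple_sl2 act_simple_sl2_closed fun_eq_iff)
qed (auto simp: simple_sl2_def sl2_simps algebra_simps fun_eq_iff)

definition L3 :: "L3_elem lie_algebra" where
  "L3 = semidirect sl2 (simple_sl2 3)"

definition sl2_incl :: "mat2 \<Rightarrow> L3_elem" where
  "sl2_incl X = (X, \<lambda>_. 0)"

text \<open>\<open>rad_vec k\<close> is the basis vector \<open>v\<^sub>i\<close> of weight \<open>i = 2 k - 3\<close> of the radical.\<close>

definition rad_vec :: "nat \<Rightarrow> L3_elem" where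
  "rad_vec k = (0, delta k)"


lemma bracket_L3:
  assumes "u \<in> carrier (simple_sl2 3)" "v \<in> carrier (simple_sl2 3)"
  shows "bracket L3 (X, u) (Y, v) = (bracket sl2 X Y,
    \<lambda>k. act (simple_sl2 3) X v k - act (simple_sl2 3) Y u k)"
  by (simp add: L3_def semidirect_def a_minus_simple_sl2 act_simple_sl2_closed)

lemma lie_algebra_L3: "lie_algebra L3"
proof -
  interpret lie_module sl2 "simple_sl2 3" by (rule lie_module_simple_sl2)
  have bL: "bracket L3 (X, u) (Y, v) = (bracket sl2 X Y,
      \<lambda>k. act (simple_sl2 3) X v k - act (simple_sl2 3) Y u k)"
    if "u \<in> carrier (simple_sl2 3)" "v \<in> carrier (simple_sl2 3)" for X Y u v
    by (rule bracket_L3[OF that])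
  have add: "act (simple_sl2 3) X (\<lambda>k. u k - v k) k = act (simple_sl2 3) X u k - act (simple_sl2 3) X v k"
    for X u v k by (simp add: simple_sl2_def algebra_simps)
  have br: "act (simple_sl2 3) (bracket sl2 X Y) u k =
      act (simple_sl2 3) X (act (simple_sl2 3) Y u) k - act (simple_sl2 3) Y (act (simple_sl2 3) X u) k"
    if "X \<in> carrier sl2" "Y \<in> carrier sl2" "u \<in> carrier (simple_sl2 3)" for X Y u k
    using act_bracket[OF that] that by (simp add: a_minus_simple_sl2 act_simple_sl2_closed)
  have L3_simps: "carrier L3 = carrier sl2 \<times> carrier (simple_sl2 3)"
    "zero L3 = (0, \<lambda>_. 0)" "add L3 (X, u) (Y, v) = (X + Y, \<lambda>k. u k + v k)"
    "smult L3 c (X, u) = (c \<odot>\<^bsub>sl2\<^esub> X, \<lambda>k. c * u k)" for X Y u v c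
    by (simp_all add: L3_def semidirect_def simple_sl2_simps sl2_simps)
  have sub: "(\<lambda>k. u k - v k) \<in> carrier (simple_sl2 3)"
    if "u \<in> carrier (simple_sl2 3)" "v \<in> carrier (simple_sl2 3)" for u v
    using that by (auto simp: simple_sl2_simps)
  have add_closed: "(\<lambda>k. u k + v k) \<in> carrier (simple_sl2 3)"
    if "u \<in> carrier (simple_sl2 3)" "v \<in> carrier (simple_sl2 3)" for u v
    using that by (auto simp: simple_sl2_simps)
  have smult_closed': "(\<lambda>k. c * u k) \<in> carrier (simple_sl2 3)"
    if "u \<in> carrier (simple_sl2 3)" for c u
    using that by (auto simp: simple_sl2_simps)
  have act_add1: "act (simple_sl2 3) (X + Y) u k = act (simple_sl2 3) X u k + act (simple_sl2 3) Y u k"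
    and act_add2: "act (simple_sl2 3) X (\<lambda>k. u k + v k) k = act (simple_sl2 3) X u k + act (simple_sl2 3) X v k"
    and act_smult1: "act (simple_sl2 3) (c \<odot>\<^bsub>sl2\<^esub> X) u k = c * act (simple_sl2 3) X u k"
    and act_smult2: "act (simple_sl2 3) X (\<lambda>k. c * u k) k = c * act (simple_sl2 3) X u k"
    for X Y u v c k by (simp_all add: simple_sl2_def sl2_simps algebra_simps)
  have mod: "Module.module complex_ring L3"
  proof (intro Module.moduleI complex_ring_cring abelian_groupI)
    fix x assume "x \<in> carrier L3"
    then show "\<exists>y\<in>carrier L3. y \<oplus>\<^bsub>L3\<^esub> x = \<zero>\<^bsub>L3\<^esub>"
      by (intro bexI[of _ "(- fst x, \<lambda>k. - snd x k)"])
        (auto simp: L3_simps sl2_simps simple_sl2_simps trace_def sum_2 add_eq_0_iff)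
  qed (auto simp: L3_def semidirect_def L.a_assoc M.a_assoc L.a_comm M.a_comm L.a_lcomm M.a_lcomm
      L.smult_l_distr[simplified] M.smult_l_distr[simplified]
      L.smult_assoc1[simplified] M.smult_assoc1[simplified] L.smult_r_distr M.smult_r_distr
      L.smult_closed[simplified] M.smult_closed[simplified]
      L.smult_one[simplified] M.smult_one[simplified])
  show ?thesis
  proof (intro lie_algebra.intro mod lie_algebra_axioms.intro)
    fix x y z
    assume "x \<in> carrier L3" "y \<in> carrier L3" "z \<in> carrier L3"
    then show "bracket L3 x (bracket L3 y z) \<oplus>\<^bsub>L3\<^esub> bracket L3 y (bracket L3 z x)
        \<oplus>\<^bsub>L3\<^esub> bracket L3 z (bracket L3 x y) = \<zero>\<^bsub>L3\<^esub>"
      using L.jacobi[of "fst x" "fst y" "fst z"]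
      by (cases x; cases y; cases z)
        (simp add: L3_simps bL sub act_simple_sl2_closed br add sl2_simps(2,3) fun_eq_iff)
  next
    fix x y assume "x \<in> carrier L3" "y \<in> carrier L3"
    then show "bracket L3 x y \<in> carrier L3"
      by (cases x; cases y) (simp add: L3_simps bL sub act_simple_sl2_closed L.bracket_closed)
  next
    fix x y z assume "x \<in> carrier L3" "y \<in> carrier L3" "z \<in> carrier L3"
    then show "bracket L3 (x \<oplus>\<^bsub>L3\<^esub> y) z = bracket L3 x z \<oplus>\<^bsub>L3\<^esub> bracket L3 y z"
      "bracket L3 x (y \<oplus>\<^bsub>L3\<^esub> z) = bracket L3 x y \<oplus>\<^bsub>L3\<^esub> bracket L3 x z"
      using L.bracket_add_left[of "fst x" "fst y" "fst z"] L.bracket_add_right[of "fst x" "fst y" "fst z"]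
      by (cases x; cases y; cases z;
          simp add: L3_simps bL add_closed act_add1 act_add2 sl2_simps(3) fun_eq_iff)+
  next
    fix c x y assume "x \<in> carrier L3" "y \<in> carrier L3"
    then show "bracket L3 (c \<odot>\<^bsub>L3\<^esub> x) y = c \<odot>\<^bsub>L3\<^esub> bracket L3 x y"
      "bracket L3 x (c \<odot>\<^bsub>L3\<^esub> y) = c \<odot>\<^bsub>L3\<^esub> bracket L3 x y"
      using L.bracket_smult_left[of "fst x" "fst y" c] L.bracket_smult_right[of "fst x" "fst y" c]
      by (cases x; cases y;
          simp add: L3_simps bL smult_closed' act_smult1 act_smult2 fun_eq_iff algebra_simps)+
  next
    fix x assume "x \<in> carrier L3"
    then show "bracket L3 x x = \<zero>\<^bsub>L3\<^esub>"
      using L.bracket_self[of "fst x"] by (cases x) (simp add: L3_simps bL sl2_simps(2))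
  qed
qed

text \<open>The brackets of the basis vectors of the radical with \<open>h\<close>, \<open>e\<close> and \<open>f\<close>.\<close>

lemma bracket_rad_vec:
  "bracket L3 (sl2_incl sl2_e) (rad_vec 2) = 3 \<odot>\<^bsub>L3\<^esub> rad_vec 3"
  "bracket L3 (sl2_incl sl2_e) (rad_vec 1) = 2 \<odot>\<^bsub>L3\<^esub> rad_vec 2"
  "bracket L3 (sl2_incl sl2_e) (rad_vec 0) = rad_vec 1"
  "bracket L3 (sl2_incl sl2_e) (rad_vec 3) = \<zero>\<^bsub>L3\<^esub>"
  "k \<le> 3 \<Longrightarrow> bracket L3 (sl2_incl sl2_h) (rad_vec k) = (2 * of_nat k - 3) \<odot>\<^bsub>L3\<^esub> rad_vec k"
  "bracket L3 (sl2_incl sl2_f) (rad_vec 3) = rad_vec 2"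
  "bracket L3 (sl2_incl sl2_f) (rad_vec 0) = \<zero>\<^bsub>L3\<^esub>"
  "j \<le> 3 \<Longrightarrow> k \<le> 3 \<Longrightarrow> bracket L3 (rad_vec j) (rad_vec k) = \<zero>\<^bsub>L3\<^esub>"
         apply (simp_all add: rad_vec_def sl2_incl_def bracket_L3 simple_sl2_simps delta_def)
         apply (auto simp: fun_eq_iff simple_sl2_def L3_def semidirect_def sl2_simps sl2_e_def
            sl2_h_def sl2_f_def delta_def matrix_matrix_mult_def vec_eq_iff le_Suc_eq numeral_3_eq_3)
  done

definition cubic_discriminant :: "(L3_elem list \<Rightarrow> complex) set" where
  "cubic_discriminant =
    (let U = enveloping_algebra L3;
         vm3 = env_gen L3 (rad_vec 0); vm1 = env_gen L3 (rad_vec 1);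
         v1 = env_gen L3 (rad_vec 2); v3 = env_gen L3 (rad_vec 3)
     in vm1 [^]\<^bsub>U\<^esub> (2::nat) \<otimes>\<^bsub>U\<^esub> v1 [^]\<^bsub>U\<^esub> (2::nat)
        \<ominus>\<^bsub>U\<^esub> (27 \<odot>\<^bsub>U\<^esub> (vm3 [^]\<^bsub>U\<^esub> (2::nat) \<otimes>\<^bsub>U\<^esub> v3 [^]\<^bsub>U\<^esub> (2::nat)))
        \<ominus>\<^bsub>U\<^esub> (4 \<odot>\<^bsub>U\<^esub> (vm1 [^]\<^bsub>U\<^esub> (3::nat) \<otimes>\<^bsub>U\<^esub> v3))
        \<ominus>\<^bsub>U\<^esub> (4 \<odot>\<^bsub>U\<^esub> (vm3 \<otimes>\<^bsub>U\<^esub> v1 [^]\<^bsub>U\<^esub> (3::nat)))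
        \<oplus>\<^bsub>U\<^esub> (18 \<odot>\<^bsub>U\<^esub> (vm3 \<otimes>\<^bsub>U\<^esub> vm1 \<otimes>\<^bsub>U\<^esub> v1 \<otimes>\<^bsub>U\<^esub> v3)))"

type_synonym U_L3 = "(L3_elem list \<Rightarrow> complex) set"
type_synonym Q_elem = "(U_L3 \<times> (nat \<Rightarrow> complex) \<Rightarrow> complex) set"

definition Q :: "nat \<Rightarrow> (U_L3, Q_elem) rep" where
  "Q n = extension_of_scalars (enveloping_algebra sl2) (enveloping_algebra L3)
     (env_map L3 sl2_incl) (env_module (simple_sl2 n))"

definition Q_chi :: "nat \<Rightarrow> complex \<Rightarrow> (L3_elem, Q_elem set) rep" where
  "Q_chi n chi = (let U = enveloping_algebra L3 in
     quotient_module (pullback_module (env_gen L3) (Q n))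
       {act (Q n) (cubic_discriminant \<ominus>\<^bsub>U\<^esub> (chi \<odot>\<^bsub>U\<^esub> \<one>\<^bsub>U\<^esub>)) q | q. q \<in> carrier (Q n)})"

definition simple_quotient_kernel ::
    "('l, 'm) lie_algebra_scheme \<Rightarrow> ('l, 'b, 'n) rep_scheme \<Rightarrow> 'b set \<Rightarrow> bool" where
  "simple_quotient_kernel L M N \<longleftrightarrow> lie_submodule L M N \<and> simple_lie_module L (quotient_module M N)"

definition V0 :: "complex \<Rightarrow> (L3_elem, Q_elem set set) rep" where
  "V0 chi = quotient_module (Q_chi 0 chi) (THE N. simple_quotient_kernel L3 (Q_chi 0 chi) N)"

end

theory Submission
  imports Defs "HOL-Computational_Algebra.Polynomial"
begin

text \<open>
  The vacuum vector of \<open>Q(0)\<close> is killed by \<open>sl\<^sub>2\<close>, so \<open>Q(0)\<close> is the symmetric algebra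
  \<open>\<complex>[x, y, z, w]\<close> on \<open>x = v\<^sub>3, y = v\<^sub>1, z = v\<^bsub>-1\<^esub>, w = v\<^bsub>-3\<^esub>\<close>, on which \<open>sl\<^sub>2\<close> acts by
  derivations, and submodules of \<open>Q(0, \<chi>)\<close> are the ideals that contain \<open>C - \<chi>\<close> and are stable
  under \<open>sl\<^sub>2\<close>.

  The classical covariants \<open>x\<close>, \<open>H = y\<^sup>2 - 3xz\<close>, \<open>T = 2y\<^sup>3 - 9xyz + 27x\<^sup>2w\<close> of the binary cubic are
  highest weight vectors of weights \<open>3, 2, 3\<close>. Modulo \<open>C - \<chi>\<close> the polynomial ring is spanned by the
  vectors \<open>F\<^sup>i(x\<^sup>aH\<^sup>bT\<^sup>c)\<close>: it suffices that the span is stable under multiplication by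
  \<open>x, y, z, w\<close> and, by the Leibniz rule for \<open>F\<close>, only the case \<open>i = 0\<close> matters, which is settled by
  explicit transvectant identities. As \<open>3a + 2b + 3c = n\<close> has finitely many solutions, all
  multiplicities are finite, and only \<open>a = b = c = 0\<close> contributes to the trivial isotypic component.
  Polynomials in the Casimir operator separate this component, so a sum of proper submodules cannot
  contain \<open>1\<close>, and there is a largest proper submodule.

  If a quotient is finite-dimensional, then \<open>x\<close> and \<open>y\<close> act nilpotently because their powers have
  different weights. Every monomial of \<open>C\<close> contains \<open>x\<close> or \<open>y\<close>, so the scalar \<open>\<chi>\<close> is nilpotent too.
\<close>

section \<open>The symmetric algebra of the radical\<close>

text \<open>The Leibniz rule gives v F u = F(v u) - (F v) u for a variable v, and F sends x, y, z, w
  to y, 2z, 3w, 0; so stability under multiplication passes down each string once it holds at the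
  top. At the top, for u a monomial of weight n in the covariants, F(x u), F(y u) and F(z u)
  determine y u, z u and w u up to terms already treated, with coefficients proportional to n + 3, n
  + 2 and n + 1. These are positive integers, hence invertible in characteristic zero. The spanning
  vectors are not a basis: T^2 = 4 H^3 - 27 C x^2 is a relation among them modulo C - chi. A basis
  of the span of the highest weight monomials is therefore extracted modulo the ideal, separately in
  each weight. Its independence is transported to whole strings by the Casimir operator (weight of
  the string), H (position in it) and powers of E (return to the top).\<close>

type_synonym quartic_ring = "complex poly poly poly poly"

definition cst :: "complex \<Rightarrow> quartic_ring" where "cst c = [:[:[:[:c:]:]:]:]"
definition px :: quartic_ring where "px = [:0, 1:]"
definition py :: quartic_ring where "py = [:[:0, 1:]:]"
definition pz :: quartic_ring where "pz = [:[:[:0, 1:]:]:]"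
definition pw :: quartic_ring where "pw = [:[:[:[:0, 1:]:]:]:]"

lemma cst_simps:
  "cst 0 = 0" "cst 1 = 1" "cst (a + b) = cst a + cst b" "cst (a * b) = cst a * cst b"
  "cst (- a) = - cst a" "cst (a - b) = cst a - cst b" "cst (of_nat n) = of_nat n"
  "cst (numeral k) = numeral k"
  by (simp_all add: cst_def one_pCons of_nat_poly numeral_poly)

lemma cst_sum: "cst (sum f A) = (\<Sum>a\<in>A. cst (f a))"
  by (induction A rule: infinite_finite_induct) (simp_all add: cst_simps)

lemma poly_closed_induct:
  fixes p :: "'a::comm_ring_1 poly"
  assumes c: "\<And>a. P [:a:]" and add: "\<And>p q. P p \<Longrightarrow> P q \<Longrightarrow> P (p + q)" and x: "\<And>p. P p \<Longrightarrow> P ([:0, 1:] * p)"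
  shows "P p"
proof (induction p)
  case 0
  show ?case using c[of 0] by simp
next
  case (pCons a p)
  have "P ([:a:] + [:0, 1:] * p)" by (intro add c x pCons.IH)
  then show ?case by simp
qed

text \<open>Induction multiplies by one variable at a time, because actions and submodules are
  described on the four generators only.\<close>

lemma quartic_induct [case_names cst add x y z w]:
  assumes c: "\<And>c. P (cst c)" and add: "\<And>p q. P p \<Longrightarrow> P q \<Longrightarrow> P (p + q)"
    and x: "\<And>p. P p \<Longrightarrow> P (px * p)" and y: "\<And>p. P p \<Longrightarrow> P (py * p)"
    and z: "\<And>p. P p \<Longrightarrow> P (pz * p)" and w: "\<And>p. P p \<Longrightarrow> P (pw * p)"
  shows "P p"
proof -
  have one: "P [:[:[:p:]:]:]" for p
  proof (induction p rule: poly_closed_induct)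
    case 1 then show ?case using c by (simp add: cst_def)
  next
    case (2 p q) then show ?case using add[of "[:[:[:p:]:]:]" "[:[:[:q:]:]:]"] by simp
  next
    case (3 p) then show ?case using w[of "[:[:[:p:]:]:]"] by (simp add: pw_def)
  qed
  have two: "P [:[:p:]:]" for p
  proof (induction p rule: poly_closed_induct)
    case 1 then show ?case using one by simp
  next
    case (2 p q) then show ?case using add[of "[:[:p:]:]" "[:[:q:]:]"] by simp
  next
    case (3 p) then show ?case using z[of "[:[:p:]:]"] by (simp add: pz_def)
  qed
  have three: "P [:p:]" for p
  proof (induction p rule: poly_closed_induct)
    case 1 then show ?case using two by simp
  next
    case (2 p q) then show ?case using add[of "[:p:]" "[:q:]"] by simp
  next
    case (3 p) then show ?case using y[of "[:p:]"] by (simp add: py_def)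
  qed
  show ?thesis
  proof (induction p rule: poly_closed_induct)
    case 1 then show ?case using three by simp
  next
    case (2 p q) then show ?case by (rule add)
  next
    case (3 p) then show ?case using x by (simp add: px_def)
  qed
qed

section \<open>Derivations and the operators of sl2\<close>

definition derivation :: "('a::comm_ring_1 \<Rightarrow> 'a) \<Rightarrow> bool" where
  "derivation d \<longleftrightarrow> (\<forall>a b. d (a + b) = d a + d b) \<and> (\<forall>a b. d (a * b) = d a * b + a * d b)"

lemma derivation_add: "derivation d \<Longrightarrow> d (a + b) = d a + d b"
  and derivation_mult: "derivation d \<Longrightarrow> d (a * b) = d a * b + a * d b"
  by (simp_all add: derivation_def)

lemma derivation_0: "derivation d \<Longrightarrow> d 0 = 0"
  using derivation_add[of d 0 0] by simp

lemma derivation_1: "derivation d \<Longrightarrow> d 1 = 0"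
  using derivation_mult[of d 1 1] by simp

lemma derivation_uminus: "derivation d \<Longrightarrow> d (- a) = - d a"
  using derivation_add[of d a "- a"] by (simp add: derivation_0 add_eq_0_iff)

lemma derivation_diff: "derivation d \<Longrightarrow> d (a - b) = d a - d b"
  using derivation_add[of d a "- b"] by (simp add: derivation_uminus)

lemma derivation_sum: "derivation d \<Longrightarrow> d (sum f A) = (\<Sum>a\<in>A. d (f a))"
  by (induction A rule: infinite_finite_induct) (simp_all add: derivation_0 derivation_add)

lemma derivation_of_nat: "derivation d \<Longrightarrow> d (of_nat n) = 0"
  by (induction n) (simp_all add: derivation_0 derivation_1 derivation_add)

lemma derivation_numeral: "derivation d \<Longrightarrow> d (numeral n) = 0"
  using derivation_of_nat[of d "numeral n"] by simp

lemma derivation_power: "derivation d \<Longrightarrow> d (a ^ n) = of_nat n * a ^ (n - 1) * d a"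
proof (induction n)
  case (Suc n)
  show ?case
  proof (cases n)
    case (Suc m)
    then show ?thesis using Suc.IH[OF Suc.prems] Suc.prems
      by (simp add: derivation_mult algebra_simps)
  qed (use Suc.prems in \<open>simp add: derivation_mult derivation_1\<close>)
qed (simp add: derivation_1)

lemma derivation_pderiv: "derivation pderiv"
  by (simp add: derivation_def pderiv_add pderiv_mult algebra_simps)

text \<open>Acting on coefficients treats the outer variable as a constant. Iterating this yields
  the partial derivatives in the inner variables.\<close>

lemma derivation_map_poly:
  assumes d: "derivation d" shows "derivation (map_poly d)"
proof -
  have c: "coeff (map_poly d p) n = d (coeff p n)" for p n
    by (rule coeff_map_poly) (rule derivation_0[OF d])
  show ?thesis unfolding derivation_def poly_eq_iff
    by (simp add: c derivation_add[OF d] coeff_mult derivation_sum[OF d] derivation_mult[OF d] sum.distrib)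
qed

lemma derivation_linear:
  assumes "derivation d" "derivation d'" shows "derivation (\<lambda>p. a * d p + b * d' p)"
  using assms by (simp add: derivation_def algebra_simps)

lemma derivation_commutator:
  assumes "derivation d" "derivation d'" shows "derivation (\<lambda>p. d (d' p) - d' (d p))"
  using assms by (simp add: derivation_def algebra_simps)

lemma derivation_eqI:
  assumes d: "derivation d" and d': "derivation d'" and "\<And>c. d (cst c) = d' (cst c)"
    and "d px = d' px" "d py = d' py" "d pz = d' pz" "d pw = d' pw"
  shows "d p = d' p"
  by (induction p rule: quartic_induct)
    (use assms(3-) in \<open>simp_all add: derivation_add[OF d] derivation_add[OF d']
      derivation_mult[OF d] derivation_mult[OF d']\<close>)

definition dx :: "quartic_ring \<Rightarrow> quartic_ring" where "dx = pderiv"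
definition dy :: "quartic_ring \<Rightarrow> quartic_ring" where "dy = map_poly pderiv"
definition dz :: "quartic_ring \<Rightarrow> quartic_ring" where "dz = map_poly (map_poly pderiv)"
definition dw :: "quartic_ring \<Rightarrow> quartic_ring" where "dw = map_poly (map_poly (map_poly pderiv))"

lemmas partial_defs = dx_def dy_def dz_def dw_def

lemma derivation_partial: "derivation dx" "derivation dy" "derivation dz" "derivation dw"
  unfolding partial_defs by (intro derivation_map_poly derivation_pderiv)+

lemma partial_gens [simp]:
  "dx (cst c) = 0" "dy (cst c) = 0" "dz (cst c) = 0" "dw (cst c) = 0"
  "dx px = 1" "dy px = 0" "dz px = 0" "dw px = 0"
  "dx py = 0" "dy py = 1" "dz py = 0" "dw py = 0"
  "dx pz = 0" "dy pz = 0" "dz pz = 1" "dw pz = 0"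
  "dx pw = 0" "dy pw = 0" "dz pw = 0" "dw pw = 1"
  by (auto simp: partial_defs cst_def px_def py_def pz_def pw_def pderiv_pCons map_poly_pCons one_pCons)

text \<open>The factors 1 give all three definitions the shape of \<open>derivation_linear\<close>,
  which then proves them derivations. The coefficients are those of the brackets of e, f, h with the
  basis of the radical.\<close>

definition opE :: "quartic_ring \<Rightarrow> quartic_ring" where
  "opE p = (3 * px) * dy p + 1 * ((2 * py) * dz p + pz * dw p)"
definition opF :: "quartic_ring \<Rightarrow> quartic_ring" where
  "opF p = py * dx p + 1 * ((2 * pz) * dy p + (3 * pw) * dz p)"
definition opH :: "quartic_ring \<Rightarrow> quartic_ring" where
  "opH p = 1 * ((3 * px) * dx p + py * dy p) + 1 * ((- pz) * dz p + (- 3 * pw) * dw p)"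

lemma derivation_E: "derivation opE" and derivation_F: "derivation opF" and derivation_H: "derivation opH"
  unfolding opE_def [abs_def] opF_def [abs_def] opH_def [abs_def]
  by (intro derivation_linear derivation_partial)+

lemma op_gens [simp]:
  "opE (cst c) = 0" "opF (cst c) = 0" "opH (cst c) = 0"
  "opE px = 0" "opE py = 3 * px" "opE pz = 2 * py" "opE pw = pz"
  "opF px = py" "opF py = 2 * pz" "opF pz = 3 * pw" "opF pw = 0"
  "opH px = 3 * px" "opH py = py" "opH pz = - pz" "opH pw = - 3 * pw"
  by (simp_all add: opE_def opF_def opH_def)

lemmas E_simps = derivation_add[OF derivation_E] derivation_mult[OF derivation_E] derivation_0[OF derivation_E]
  derivation_1[OF derivation_E] derivation_uminus[OF derivation_E] derivation_diff[OF derivation_E]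
  derivation_of_nat[OF derivation_E] derivation_numeral[OF derivation_E] derivation_power[OF derivation_E]
  derivation_sum[OF derivation_E]
lemmas F_simps = derivation_add[OF derivation_F] derivation_mult[OF derivation_F] derivation_0[OF derivation_F]
  derivation_1[OF derivation_F] derivation_uminus[OF derivation_F] derivation_diff[OF derivation_F]
  derivation_of_nat[OF derivation_F] derivation_numeral[OF derivation_F] derivation_power[OF derivation_F]
  derivation_sum[OF derivation_F]
lemmas H_simps = derivation_add[OF derivation_H] derivation_mult[OF derivation_H] derivation_0[OF derivation_H]
  derivation_1[OF derivation_H] derivation_uminus[OF derivation_H] derivation_diff[OF derivation_H]
  derivation_of_nat[OF derivation_H] derivation_numeral[OF derivation_H] derivation_power[OF derivation_H]
  derivation_sum[OF derivation_H]

lemma op_cst_mult [simp]: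
  "opE (cst c * p) = cst c * opE p" "opF (cst c * p) = cst c * opF p" "opH (cst c * p) = cst c * opH p"
  by (simp_all add: E_simps F_simps H_simps)

text \<open>A commutator of derivations is a derivation, so each sl2 relation is a check on
  constants and variables.\<close>

lemma EF_commutator: "opE (opF p) = opF (opE p) + opH p"
proof -
  have "opE (opF p) - opF (opE p) = opH p"
    by (rule derivation_eqI[OF derivation_commutator[OF derivation_E derivation_F] derivation_H])
      (simp_all add: E_simps F_simps)
  then show ?thesis by (simp add: algebra_simps)
qed

lemma HE_commutator: "opH (opE p) = opE (opH p) + 2 * opE p"
proof -
  \<comment> \<open>The zero summand brings the right-hand side into the form of
    \<open>derivation_linear\<close>.\<close>
  have "opH (opE p) - opE (opH p) = 2 * opE p + 0 * opE p"
    by (rule derivation_eqI[OF derivation_commutator[OF derivation_H derivation_E]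
          derivation_linear[OF derivation_E derivation_E]])
      (simp_all add: E_simps H_simps)
  then show ?thesis by (simp add: algebra_simps)
qed

lemma HF_commutator: "opH (opF p) = opF (opH p) - 2 * opF p"
proof -
  have "opH (opF p) - opF (opH p) = (- 2) * opF p + 0 * opF p"
    by (rule derivation_eqI[OF derivation_commutator[OF derivation_H derivation_F]
          derivation_linear[OF derivation_F derivation_F]])
      (simp_all add: F_simps H_simps)
  then show ?thesis by (simp add: algebra_simps)
qed

section \<open>Covariants of the binary cubic\<close>

definition cov_H :: quartic_ring where "cov_H = py ^ 2 - 3 * px * pz"
definition cov_T :: quartic_ring where "cov_T = 2 * py ^ 3 - 9 * px * py * pz + 27 * px ^ 2 * pw"
definition disc :: quartic_ring where
  "disc = pz ^ 2 * py ^ 2 - 27 * pw ^ 2 * px ^ 2 - 4 * pz ^ 3 * px - 4 * pw * py ^ 3 + 18 * pw * pz * py * px"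

lemma op_disc [simp]: "opE disc = 0" "opF disc = 0" "opH disc = 0"
  unfolding disc_def by (simp_all add: E_simps F_simps H_simps algebra_simps power2_eq_square power3_eq_cube)

lemma op_cov [simp]: "opE cov_H = 0" "opE cov_T = 0" "opH cov_H = 2 * cov_H" "opH cov_T = 3 * cov_T"
  unfolding cov_H_def cov_T_def by (simp_all add: E_simps H_simps algebra_simps power2_eq_square power3_eq_cube)

text \<open>Up to scalars, \<open>cov_H\<close>, \<open>F_H\<close>, \<open>opF F_H\<close> are the
  coefficients of the Hessian form of the cubic, and \<open>cov_T\<close>, \<open>F_T\<close>,
  \<open>opF F_T\<close> are the first three coefficients of its cubic covariant.\<close>

definition F_H :: quartic_ring where "F_H = opF cov_H"
definition F_T :: quartic_ring where "F_T = opF cov_T"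

lemma F_cov: "F_H = py * pz - 9 * px * pw" "F_T = 3 * py ^ 2 * pz - 18 * px * pz ^ 2 + 27 * px * py * pw"
  unfolding cov_H_def cov_T_def F_H_def F_T_def by (simp_all add: F_simps algebra_simps power2_eq_square power3_eq_cube)

lemma FF_cov: "opF F_H = 2 * pz ^ 2 - 6 * py * pw"
  "opF F_T = 54 * px * pz * pw * (-1) + 36 * py ^ 2 * pw - 6 * py * pz ^ 2"
  unfolding F_cov by (simp_all add: F_simps algebra_simps power2_eq_square power3_eq_cube)

text \<open>All are checked by expansion. Items 1 and 2, then 5 to 7, then 14 to 16 multiply y = F
  x, \<open>F_H\<close> and \<open>F_T\<close> by x, y and z; they produce the transvectant
  formulas. Items 3, 4, 8 to 10 and 12 remove a factor x or T standing before a lowered covariant,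
  and 11 and 13 evaluate products of two lowered ones.\<close>

lemma syzygies:
  "3 * px * F_H = 2 * py * cov_H - cov_T"
  "px * F_T = py * cov_T - 2 * cov_H ^ 2"
  "3 * cov_T * F_H = 2 * cov_H * F_T + 27 * disc * px"
  "cov_T * F_T = 6 * cov_H ^ 2 * F_H - 27 * disc * px * py"
  "py * py = cov_H + 3 * px * pz"
  "3 * py * F_H = 6 * pz * cov_H - F_T"
  "py * F_T = 3 * pz * cov_T - 3 * cov_H * F_H"
  "9 * px * opF F_H = 6 * pz * cov_H - 2 * F_T"
  "px * opF F_T = 2 * pz * cov_T - 4 * cov_H * F_H"
  "3 * cov_T * opF F_H = cov_H * opF F_T + 18 * disc * py"
  "F_H * F_T = cov_H * opF F_T + 9 * disc * py"
  "cov_T * opF F_T = 12 * cov_H ^ 2 * opF F_H - 36 * disc * cov_H - 54 * disc * px * pz"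
  "F_H * F_H = 2 * cov_H * opF F_H - 3 * disc"
  "pz * py = 9 * pw * px + F_H"
  "6 * pz * F_H = 36 * pw * cov_H - opF F_T"
  "pz * F_T = 9 * pw * cov_T - 3 * cov_H * opF F_H + 9 * disc"
  unfolding FF_cov unfolding F_cov cov_H_def cov_T_def disc_def
  by (simp_all add: algebra_simps power2_eq_square power3_eq_cube)

section \<open>Monomials in the covariants and their transvectants\<close>

definition hw :: "nat \<Rightarrow> nat \<Rightarrow> nat \<Rightarrow> quartic_ring" where
  "hw a b c = px ^ a * cov_H ^ b * cov_T ^ c"

lemma hw_simps:
  "px * hw a b c = hw (Suc a) b c" "cov_H * hw a b c = hw a (Suc b) c" "cov_T * hw a b c = hw a b (Suc c)"
  by (simp_all add: hw_def mult_ac)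

lemma op_hw: "opE (hw a b c) = 0" "opH (hw a b c) = of_nat (3 * a + 2 * b + 3 * c) * hw a b c"
proof -
  show "opE (hw a b c) = 0" by (simp add: hw_def E_simps)
  have pow: "of_nat n * v ^ (n - 1) * v = of_nat n * v ^ n" for n and v :: quartic_ring
    by (cases n) simp_all
  have "opH (hw a b c) = (3 * (of_nat a * px ^ (a - 1) * px)) * cov_H ^ b * cov_T ^ c
     + (2 * (of_nat b * cov_H ^ (b - 1) * cov_H)) * px ^ a * cov_T ^ c
     + (3 * (of_nat c * cov_T ^ (c - 1) * cov_T)) * px ^ a * cov_H ^ b"
    by (simp add: hw_def H_simps algebra_simps)
  then show "opH (hw a b c) = of_nat (3 * a + 2 * b + 3 * c) * hw a b c"
    unfolding pow by (simp add: hw_def algebra_simps)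
qed

text \<open>Leibniz rule with a spectator \<open>v\<close>, kept next to y, \<open>F_H\<close> and
  \<open>F_T\<close> so that the syzygies apply. The truncated exponents at zero are harmless, as
  the coefficient vanishes there.\<close>

lemma F_hw:
  "opF (hw a b c) * v = of_nat a * hw (a - 1) b c * (py * v) + of_nat b * hw a (b - 1) c * (F_H * v)
    + of_nat c * hw a b (c - 1) * (F_T * v)"
  by (simp add: hw_def F_simps F_H_def F_T_def algebra_simps)

lemma hw_pred:
  "of_nat a * hw (a - 1) b c * px = of_nat a * hw a b c"
  "of_nat b * hw a (b - 1) c * cov_H = of_nat b * hw a b c"
  "of_nat c * hw a b (c - 1) * cov_T = of_nat c * hw a b c"
  by (cases a, simp_all add: hw_def mult_ac, cases b, simp_all add: mult_ac, cases c, simp_all add: mult_ac)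

text \<open>
  Multiples of \<open>F u\<close> for a monomial \<open>u\<close> of weight \<open>n\<close> in the covariants: modulo the images
  under \<open>F\<close> of other covariants, \<open>x F u\<close>, \<open>y F u\<close> and \<open>z F u\<close> are proportional to \<open>n y u\<close>, \<open>n z u\<close>
  and \<open>n w u\<close>. These are the transvectants of \<open>u\<close> with the binary cubic.
\<close>

lemma F_hw_x:
  "3 * px * opF (hw a b c) = of_nat (3 * a + 2 * b + 3 * c) * py * hw a b c
    - of_nat b * hw a (b - 1) (Suc c) - 6 * of_nat c * hw a (b + 2) (c - 1)"
proof -
  have "3 * px * opF (hw a b c) = opF (hw a b c) * (3 * px)" by (simp only: mult_ac)
  also have "\<dots> = 3 * (of_nat a * hw (a - 1) b c * px) * py + of_nat b * hw a (b - 1) c * (3 * px * F_H)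
      + 3 * of_nat c * hw a b (c - 1) * (px * F_T)"
    unfolding F_hw by (simp only: mult_ac)
  also have "\<dots> = 3 * (of_nat a * hw (a - 1) b c * px) * py + 2 * (of_nat b * hw a (b - 1) c * cov_H) * py
      - of_nat b * (cov_T * hw a (b - 1) c) + 3 * (of_nat c * hw a b (c - 1) * cov_T) * py
      - 6 * of_nat c * (cov_H * (cov_H * hw a b (c - 1)))"
    unfolding syzygies(1,2) by (simp add: algebra_simps power2_eq_square)
  also have "\<dots> = of_nat (3 * a + 2 * b + 3 * c) * py * hw a b c
    - of_nat b * hw a (b - 1) (Suc c) - 6 * of_nat c * hw a (b + 2) (c - 1)"
    unfolding hw_pred hw_simps by (simp add: algebra_simps)
  finally show ?thesis .
qed

lemma F_hw_y:
  "3 * py * opF (hw a b c) = 3 * of_nat (3 * a + 2 * b + 3 * c) * pz * hw a b c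
    + 3 * of_nat a * hw (a - 1) (Suc b) c - of_nat b * (hw a (b - 1) c * F_T)
    - 9 * of_nat c * (hw a (Suc b) (c - 1) * F_H)"
proof -
  have "3 * py * opF (hw a b c) = opF (hw a b c) * (3 * py)" by (simp only: mult_ac)
  also have "\<dots> = 3 * (of_nat a * hw (a - 1) b c * (py * py)) + of_nat b * hw a (b - 1) c * (3 * py * F_H)
      + 3 * of_nat c * hw a b (c - 1) * (py * F_T)"
    unfolding F_hw by (simp only: mult_ac)
  also have "\<dots> = 3 * of_nat a * (cov_H * hw (a - 1) b c) + 9 * (of_nat a * hw (a - 1) b c * px) * pz
      + 6 * (of_nat b * hw a (b - 1) c * cov_H) * pz
      - of_nat b * (hw a (b - 1) c * F_T) + 9 * (of_nat c * hw a b (c - 1) * cov_T) * pz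
      - 9 * of_nat c * (cov_H * hw a b (c - 1)) * F_H"
    unfolding syzygies(5-7) by (simp add: algebra_simps)
  also have "\<dots> = 3 * of_nat (3 * a + 2 * b + 3 * c) * pz * hw a b c
    + 3 * of_nat a * hw (a - 1) (Suc b) c - of_nat b * (hw a (b - 1) c * F_T)
    - 9 * of_nat c * (hw a (Suc b) (c - 1) * F_H)"
    unfolding hw_pred hw_simps by (simp add: algebra_simps)
  finally show ?thesis .
qed

lemma F_hw_z:
  "6 * pz * opF (hw a b c) = 18 * of_nat (3 * a + 2 * b + 3 * c) * pw * hw a b c
    + 6 * of_nat a * (hw (a - 1) b c * F_H) - of_nat b * (hw a (b - 1) c * opF F_T)
    - 18 * of_nat c * (hw a (Suc b) (c - 1) * opF F_H) + 54 * of_nat c * disc * hw a b (c - 1)"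
proof -
  have "6 * pz * opF (hw a b c) = opF (hw a b c) * (6 * pz)" by (simp only: mult_ac)
  also have "\<dots> = 6 * (of_nat a * hw (a - 1) b c * (pz * py)) + of_nat b * hw a (b - 1) c * (6 * pz * F_H)
      + 6 * of_nat c * hw a b (c - 1) * (pz * F_T)"
    unfolding F_hw by (simp only: mult_ac)
  also have "\<dots> = 6 * of_nat a * (hw (a - 1) b c * F_H) + 54 * (of_nat a * hw (a - 1) b c * px) * pw
      + 36 * (of_nat b * hw a (b - 1) c * cov_H) * pw
      - of_nat b * (hw a (b - 1) c * opF F_T) + 54 * (of_nat c * hw a b (c - 1) * cov_T) * pw
      - 18 * of_nat c * (cov_H * hw a b (c - 1)) * opF F_H + 54 * of_nat c * disc * hw a b (c - 1)"
    unfolding syzygies(14-16) by (simp add: algebra_simps)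
  also have "\<dots> = 18 * of_nat (3 * a + 2 * b + 3 * c) * pw * hw a b c
    + 6 * of_nat a * (hw (a - 1) b c * F_H) - of_nat b * (hw a (b - 1) c * opF F_T)
    - 18 * of_nat c * (hw a (Suc b) (c - 1) * opF F_H) + 54 * of_nat c * disc * hw a b (c - 1)"
    unfolding hw_pred hw_simps by (simp add: algebra_simps)
  finally show ?thesis .
qed

text \<open>Abstracts the closure properties of the span of all strings modulo C -
  \<open>chi\<close>; closure under multiplication by C holds there because C acts as the scalar
  \<open>chi\<close>. The goal is \<open>mult_iterate\<close>, closure under the four
  variables.\<close>

locale covariant_span =
  fixes N :: "quartic_ring set"
  assumes add: "p \<in> N \<Longrightarrow> q \<in> N \<Longrightarrow> p + q \<in> N"
    and scale: "p \<in> N \<Longrightarrow> cst k * p \<in> N"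
    and lower: "p \<in> N \<Longrightarrow> opF p \<in> N"
    and disc: "p \<in> N \<Longrightarrow> disc * p \<in> N"
    and hw: "hw a b c \<in> N"
begin

lemma zero: "0 \<in> N" using scale[OF hw, of 0] by (simp add: cst_simps)

lemma of_nat: "p \<in> N \<Longrightarrow> of_nat k * p \<in> N"
  using scale[of p "of_nat k"] by (simp add: cst_simps)

lemma numeral: "p \<in> N \<Longrightarrow> numeral k * p \<in> N"
  using scale[of p "numeral k"] by (simp add: cst_simps)

lemma diff: "p \<in> N \<Longrightarrow> q \<in> N \<Longrightarrow> p - q \<in> N"
  using add[of p "cst (-1) * q"] scale[of q "-1"] by (simp add: cst_simps)

lemma of_nat_cancel:
  assumes "of_nat k * p \<in> N" "k > 0" shows "p \<in> N"
proof -
  have "cst (inverse (of_nat k)) * cst (of_nat k) = 1"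
    unfolding cst_simps(4)[symmetric] using assms(2) by (simp add: cst_simps)
  then have "cst (inverse (of_nat k)) * (of_nat k * p) = p"
    by (simp add: mult.assoc[symmetric] cst_simps)
  then show ?thesis using scale[OF assms(1), of "inverse (of_nat k)"] by metis
qed

lemma numeral_cancel: "numeral k * p \<in> N \<Longrightarrow> p \<in> N"
  using of_nat_cancel[of "numeral k" p] by simp

lemmas closed = add diff of_nat numeral scale lower disc hw zero

text \<open>With u the monomial and n its weight, F(x u) = y u + x F u, and \<open>F_hw_x\<close>
  turns 3 x F u into n y u plus covariants. Hence (n + 3) y u is in the span and the factor can be
  divided out.\<close>

lemma y_hw: "py * hw a b c \<in> N"
proof -
  have "of_nat (3 * a + 2 * b + 3 * c + 3) * (py * hw a b c) = 3 * opF (px * hw a b c)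
      + of_nat b * hw a (b - 1) (Suc c) + 6 * (of_nat c * hw a (b + 2) (c - 1))"
    using F_hw_x[of a b c] by (simp add: F_simps algebra_simps)
  moreover have "\<dots> \<in> N" unfolding hw_simps by (intro closed)
  ultimately have "of_nat (3 * a + 2 * b + 3 * c + 3) * (py * hw a b c) \<in> N" by simp
  then show ?thesis by (rule of_nat_cancel) simp
qed

text \<open>A factor x is absorbed by the first two syzygies, leaving y times a monomial. Without x,
  induction on the exponent of T: syzygies 3 and 4 trade a T for powers of H while swapping
  \<open>F_H\<close> and \<open>F_T\<close>, hence the joint claim for all b. For c = 0 the vectors
  come from F(H^(b+1)) and F(H^b T).\<close>

lemma F_H_T_hw: "hw a b c * F_H \<in> N \<and> hw a b c * F_T \<in> N"
proof (cases a)
  case 0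
  have "hw 0 b c * F_H \<in> N \<and> hw 0 b c * F_T \<in> N"
  proof (induction c arbitrary: b)
    case 0
    have H: "hw 0 b 0 * F_H \<in> N" for b
    proof -
      have "opF (hw 0 (Suc b) 0) = of_nat (Suc b) * (hw 0 b 0 * F_H)"
        using F_hw[of 0 "Suc b" 0 1] by simp
      then show ?thesis using of_nat_cancel[of "Suc b"] closed by (metis zero_less_Suc)
    qed
    have "hw 0 b 0 * F_T \<in> N"
    proof (cases b)
      case 0
      have "opF (hw 0 0 1) = F_T" by (simp add: hw_def F_T_def)
      then show ?thesis using lower[OF hw[of 0 0 1]] 0 by (simp add: hw_def)
    next
      case (Suc b')
      \<comment> \<open>Up to a multiple of C, syzygy 3 turns both Leibniz terms into multiples of
        H^b \<open>F_T\<close>, with total coefficient 2 b + 3.\<close>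
      have "3 * opF (hw 0 b 1) = of_nat b * hw 0 b' 0 * (3 * cov_T * F_H) + 3 * hw 0 b 0 * F_T"
        using F_hw[of 0 b 1 1] Suc by (simp add: hw_simps(3)[of 0 b' 0, symmetric] algebra_simps)
      also have "\<dots> = of_nat (2 * b + 3) * (hw 0 b 0 * F_T) + of_nat b * (27 * (disc * (px * hw 0 b' 0)))"
        unfolding syzygies(3) Suc hw_simps(2)[symmetric] by (simp add: algebra_simps)
      finally have "of_nat (2 * b + 3) * (hw 0 b 0 * F_T) = 3 * opF (hw 0 b 1)
          - of_nat b * (27 * (disc * (px * hw 0 b' 0)))" by simp
      moreover have "\<dots> \<in> N" unfolding hw_simps by (intro closed)
      ultimately have "of_nat (2 * b + 3) * (hw 0 b 0 * F_T) \<in> N" by simp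
      then show ?thesis by (rule of_nat_cancel) simp
    qed
    with H show ?case by blast
  next
    case (Suc c)
    have "3 * (hw 0 b (Suc c) * F_H) = 2 * (hw 0 (Suc b) c * F_T) + 27 * (disc * (px * hw 0 b c))"
      unfolding hw_simps(2,3)[symmetric] using arg_cong[OF syzygies(3), of "\<lambda>u. hw 0 b c * u"]
      by (simp add: algebra_simps power2_eq_square)
    moreover have "\<dots> \<in> N" unfolding hw_simps by (intro closed conjunct2[OF Suc.IH])
    ultimately have 1: "hw 0 b (Suc c) * F_H \<in> N" using numeral_cancel by metis
    have "hw 0 b (Suc c) * F_T = 6 * (hw 0 (Suc (Suc b)) c * F_H) - 27 * (disc * (py * (px * hw 0 b c)))"
      unfolding hw_simps(2,3)[symmetric] using arg_cong[OF syzygies(4), of "\<lambda>u. hw 0 b c * u"]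
      by (simp add: algebra_simps power2_eq_square)
    moreover have "\<dots> \<in> N" unfolding hw_simps by (intro closed conjunct1[OF Suc.IH] y_hw)
    ultimately show ?case using 1 by simp
  qed
  with 0 show ?thesis by simp
next
  case (Suc a')
  have "3 * (hw a b c * F_H) = 2 * (py * hw a' (Suc b) c) - hw a' b (Suc c)"
    unfolding Suc hw_simps[symmetric] using arg_cong[OF syzygies(1), of "\<lambda>u. hw a' b c * u"]
    by (simp add: algebra_simps power2_eq_square)
  moreover have "\<dots> \<in> N" by (intro closed y_hw)
  ultimately have 1: "hw a b c * F_H \<in> N" using numeral_cancel by metis
  have "hw a b c * F_T = py * hw a' b (Suc c) - 2 * hw a' (Suc (Suc b)) c"
    unfolding Suc hw_simps[symmetric] using arg_cong[OF syzygies(2), of "\<lambda>u. hw a' b c * u"]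
    by (simp add: algebra_simps power2_eq_square)
  moreover have "\<dots> \<in> N" by (intro closed y_hw)
  ultimately show ?thesis using 1 by simp
qed

lemmas F_H_hw = conjunct1[OF F_H_T_hw] and F_T_hw = conjunct2[OF F_H_T_hw]

text \<open>The same argument one variable further: since F y = 2 z, F(y u) yields a multiple of (n
  + 2) z u. The leftover terms carry \<open>F_H\<close> and \<open>F_T\<close>.\<close>

lemma z_hw: "pz * hw a b c \<in> N"
proof -
  have "of_nat (3 * (3 * a + 2 * b + 3 * c) + 6) * (pz * hw a b c) = 3 * opF (py * hw a b c)
      - 3 * (of_nat a * hw (a - 1) (Suc b) c) + of_nat b * (hw a (b - 1) c * F_T)
      + 9 * (of_nat c * (hw a (Suc b) (c - 1) * F_H))"
    using F_hw_y[of a b c] by (simp add: F_simps algebra_simps)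
  moreover have "\<dots> \<in> N" by (intro closed y_hw F_H_hw F_T_hw)
  ultimately have "of_nat (3 * (3 * a + 2 * b + 3 * c) + 6) * (pz * hw a b c) \<in> N" by simp
  then show ?thesis by (rule of_nat_cancel) simp
qed

text \<open>Repeats the scheme of \<open>F_H_T_hw\<close> one step lower. For c = 0, F is applied to
  H^b \<open>F_H\<close> and H^b \<open>F_T\<close>; the products of lowered covariants that appear
  are evaluated by syzygies 13 and 11, giving the coefficients 2 b + 1 and b + 1.\<close>

lemma FF_hw: "hw a b c * opF F_H \<in> N \<and> hw a b c * opF F_T \<in> N"
proof (cases a)
  case 0
  have "hw 0 b c * opF F_H \<in> N \<and> hw 0 b c * opF F_T \<in> N"
  proof (induction c arbitrary: b)
    case 0
    show ?case
    proof (cases b)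
      case 0
      have "opF (hw 0 0 0 * F_H) \<in> N" "opF (hw 0 0 0 * F_T) \<in> N" by (intro closed F_H_hw F_T_hw)+
      then show ?thesis using 0 by (simp add: hw_def)
    next
      case (Suc b')
      have "opF (hw 0 b 0 * F_H) = hw 0 b 0 * opF F_H + of_nat b * hw 0 b' 0 * (F_H * F_H)"
        using F_hw[of 0 b 0 F_H] Suc by (simp add: F_simps)
      also have "\<dots> = of_nat (2 * b + 1) * (hw 0 b 0 * opF F_H) - of_nat b * (3 * (disc * hw 0 b' 0))"
        unfolding syzygies(13) Suc hw_simps(2)[symmetric] by (simp add: algebra_simps)
      finally have "of_nat (2 * b + 1) * (hw 0 b 0 * opF F_H) =
          opF (hw 0 b 0 * F_H) + of_nat b * (3 * (disc * hw 0 b' 0))" by simp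
      moreover have "\<dots> \<in> N" by (intro closed F_H_hw)
      ultimately have "of_nat (2 * b + 1) * (hw 0 b 0 * opF F_H) \<in> N" by simp
      then have 1: "hw 0 b 0 * opF F_H \<in> N" by (rule of_nat_cancel) simp
      have "opF (hw 0 b 0 * F_T) = hw 0 b 0 * opF F_T + of_nat b * hw 0 b' 0 * (F_H * F_T)"
        using F_hw[of 0 b 0 F_T] Suc by (simp add: F_simps)
      also have "\<dots> = of_nat (b + 1) * (hw 0 b 0 * opF F_T) + of_nat b * (9 * (disc * (py * hw 0 b' 0)))"
        unfolding syzygies(11) Suc hw_simps(2)[symmetric] by (simp add: algebra_simps)
      finally have "of_nat (b + 1) * (hw 0 b 0 * opF F_T) =
          opF (hw 0 b 0 * F_T) - of_nat b * (9 * (disc * (py * hw 0 b' 0)))" by simp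
      moreover have "\<dots> \<in> N" by (intro closed F_T_hw y_hw)
      ultimately have "of_nat (b + 1) * (hw 0 b 0 * opF F_T) \<in> N" by simp
      then have "hw 0 b 0 * opF F_T \<in> N" by (rule of_nat_cancel) simp
      with 1 show ?thesis by blast
    qed
  next
    case (Suc c)
    have "3 * (hw 0 b (Suc c) * opF F_H) = hw 0 (Suc b) c * opF F_T + 18 * (disc * (py * hw 0 b c))"
      unfolding hw_simps(2,3)[symmetric] using arg_cong[OF syzygies(10), of "\<lambda>u. hw 0 b c * u"]
      by (simp add: algebra_simps)
    moreover have "\<dots> \<in> N" by (intro closed conjunct2[OF Suc.IH] y_hw)
    ultimately have 1: "hw 0 b (Suc c) * opF F_H \<in> N" using numeral_cancel by metis
    have "hw 0 b (Suc c) * opF F_T = 12 * (hw 0 (Suc (Suc b)) c * opF F_H) - 36 * (disc * hw 0 (Suc b) c)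
        - 54 * (disc * (pz * (px * hw 0 b c)))"
      unfolding hw_simps(2,3)[symmetric] using arg_cong[OF syzygies(12), of "\<lambda>u. hw 0 b c * u"]
      by (simp add: algebra_simps power2_eq_square)
    moreover have "\<dots> \<in> N" unfolding hw_simps by (intro closed conjunct1[OF Suc.IH] z_hw)
    ultimately show ?case using 1 by simp
  qed
  with 0 show ?thesis by simp
next
  case (Suc a')
  have "9 * (hw a b c * opF F_H) = 6 * (pz * hw a' (Suc b) c) - 2 * (hw a' b c * F_T)"
    unfolding Suc hw_simps[symmetric] using arg_cong[OF syzygies(8), of "\<lambda>u. hw a' b c * u"]
    by (simp add: algebra_simps power2_eq_square)
  moreover have "\<dots> \<in> N" by (intro closed z_hw F_T_hw)
  ultimately have 1: "hw a b c * opF F_H \<in> N" using numeral_cancel by metis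
  have "hw a b c * opF F_T = 2 * (pz * hw a' b (Suc c)) - 4 * (hw a' (Suc b) c * F_H)"
    unfolding Suc hw_simps[symmetric] using arg_cong[OF syzygies(9), of "\<lambda>u. hw a' b c * u"]
    by (simp add: algebra_simps power2_eq_square)
  moreover have "\<dots> \<in> N" by (intro closed z_hw F_H_hw)
  ultimately show ?thesis using 1 by simp
qed

text \<open>From F z = 3 w the coefficient is 18 (n + 1). The leftover terms now involve
  \<open>opF F_H\<close> and \<open>opF F_T\<close>, the reason for treating these
  beforehand.\<close>

lemma w_hw: "pw * hw a b c \<in> N"
proof -
  have "of_nat (18 * (3 * a + 2 * b + 3 * c) + 18) * (pw * hw a b c) = 6 * opF (pz * hw a b c)
      - 6 * (of_nat a * (hw (a - 1) b c * F_H)) + of_nat b * (hw a (b - 1) c * opF F_T)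
      + 18 * (of_nat c * (hw a (Suc b) (c - 1) * opF F_H)) - 54 * (of_nat c * (disc * hw a b (c - 1)))"
    using F_hw_z[of a b c] by (simp add: F_simps algebra_simps)
  moreover have "\<dots> \<in> N" by (intro closed z_hw F_H_hw conjunct1[OF FF_hw] conjunct2[OF FF_hw])
  ultimately have "of_nat (18 * (3 * a + 2 * b + 3 * c) + 18) * (pw * hw a b c) \<in> N" by simp
  then show ?thesis by (rule of_nat_cancel) simp
qed

lemma x_hw: "px * hw a b c \<in> N" unfolding hw_simps by (rule hw)

text \<open>The four variables go together because F sends each to a multiple of the next.\<close>

lemma mult_iterate:
  "px * (opF ^^ i) (hw a b c) \<in> N \<and> py * (opF ^^ i) (hw a b c) \<in> N \<and>
   pz * (opF ^^ i) (hw a b c) \<in> N \<and> pw * (opF ^^ i) (hw a b c) \<in> N"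
proof (induction i)
  case 0 then show ?case by (simp add: x_hw y_hw z_hw w_hw)
next
  case (Suc i)
  let ?u = "(opF ^^ i) (hw a b c)"
  have "px * opF ?u = opF (px * ?u) - py * ?u" "py * opF ?u = opF (py * ?u) - 2 * (pz * ?u)"
    "pz * opF ?u = opF (pz * ?u) - 3 * (pw * ?u)" "pw * opF ?u = opF (pw * ?u)"
    by (simp_all add: F_simps)
  then show ?case using Suc.IH by (simp add: closed)
qed

end

text \<open>The base case is a whole ideal, so membership is already membership modulo C -
  \<open>chi\<close>. Restricting the exponent triples to \<open>I\<close> isolates isotypic parts:
  leaving out (0, 0, 0) leaves out the string of 1, the trivial component.\<close>

inductive_set hw_span :: "complex \<Rightarrow> (nat \<times> nat \<times> nat) set \<Rightarrow> quartic_ring set" for chi I where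
  base: "(disc - cst chi) * p \<in> hw_span chi I"
| step: "q \<in> hw_span chi I \<Longrightarrow> (a, b, c) \<in> I \<Longrightarrow> cst k * (opF ^^ i) (hw a b c) + q \<in> hw_span chi I"

lemma hw_span_add: "p \<in> hw_span chi I \<Longrightarrow> q \<in> hw_span chi I \<Longrightarrow> p + q \<in> hw_span chi I"
proof (induction p rule: hw_span.induct)
  case (base p)
  from base.prems show ?case
  proof (induction q rule: hw_span.induct)
    case (base p') then show ?case using hw_span.base[of chi "p + p'" I] by (simp add: algebra_simps)
  next
    case (step q a b c k i) then show ?case using hw_span.step[OF step.IH step.hyps(2), of k i] by (simp add: algebra_simps)
  qed
next
  case (step p a b c k i)
  then show ?case using hw_span.step[of "p + q" chi I a b c k i] by (simp add: algebra_simps)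
qed

lemma hw_span_scale: "p \<in> hw_span chi I \<Longrightarrow> cst d * p \<in> hw_span chi I"
proof (induction p rule: hw_span.induct)
  case (base p) then show ?case using hw_span.base[of chi "cst d * p" I] by (simp add: algebra_simps)
next
  case (step p a b c k i)
  then show ?case using hw_span.step[of "cst d * p" chi I a b c "d * k" i] by (simp add: cst_simps algebra_simps)
qed

lemma hw_span_F: "p \<in> hw_span chi I \<Longrightarrow> opF p \<in> hw_span chi I"
proof (induction p rule: hw_span.induct)
  case (base p) then show ?case using hw_span.base[of chi "opF p" I] by (simp add: F_simps)
next
  case (step p a b c k i)
  then show ?case using hw_span.step[of "opF p" chi I a b c k "Suc i"] by (simp add: F_simps)
qed

lemma hw_span_gen: "(a, b, c) \<in> I \<Longrightarrow> cst k * (opF ^^ i) (hw a b c) \<in> hw_span chi I"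
  using hw_span.step[OF hw_span.base[of chi 0 I], of a b c k i] by simp

lemma hw_span_disc: "p \<in> hw_span chi I \<Longrightarrow> disc * p \<in> hw_span chi I"
  using hw_span_add[OF hw_span.base[of chi p I] hw_span_scale[of p chi I chi]] by (simp add: algebra_simps)

lemma hw_span_UNIV: "p \<in> hw_span chi UNIV"
proof -
  interpret covariant_span "hw_span chi UNIV"
  proof
    show "hw a b c \<in> hw_span chi UNIV" for a b c
      using hw_span_gen[of a b c UNIV 1 0] by (simp add: cst_simps)
  qed (auto intro: hw_span_add hw_span_scale hw_span_F hw_span_disc)
  have mult: "v * p \<in> hw_span chi UNIV" if "v \<in> {px, py, pz, pw}" "p \<in> hw_span chi UNIV" for v p
    using that(2)
  proof (induction p rule: hw_span.induct)
    case (base p) then show ?case using hw_span.base[of chi "v * p" UNIV] by (simp add: algebra_simps)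
  next
    case (step p a b c k i)
    then have "cst k * (v * (opF ^^ i) (hw a b c)) + v * p \<in> hw_span chi UNIV"
      using that(1) mult_iterate[of i a b c] by (intro add scale) auto
    then show ?case by (simp add: algebra_simps)
  qed
  show ?thesis
  proof (induction p rule: quartic_induct)
    case (cst c) then show ?case using scale[OF hw[of 0 0 0], of c] by (simp add: hw_def)
  qed (auto intro: add mult)
qed

section \<open>Ideals stable under the Lie algebra\<close>

definition sub_space :: "quartic_ring set \<Rightarrow> bool" where
  "sub_space N \<longleftrightarrow> 0 \<in> N \<and> (\<forall>p\<in>N. \<forall>q\<in>N. p + q \<in> N) \<and> (\<forall>c. \<forall>p\<in>N. cst c * p \<in> N)"

definition sl2_stable :: "quartic_ring set \<Rightarrow> bool" where
  "sl2_stable N \<longleftrightarrow> sub_space N \<and> (\<forall>p\<in>N. opE p \<in> N \<and> opF p \<in> N \<and> opH p \<in> N)"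

text \<open>These are the submodules of the polynomial ring under \<open>quartic_act\<close>, see
  \<open>inv_ideal_iff_act\<close>. Stability under the four variables already yields an ideal, by
  \<open>inv_ideal_mult\<close>.\<close>

definition inv_ideal :: "quartic_ring set \<Rightarrow> bool" where
  "inv_ideal J \<longleftrightarrow> sl2_stable J \<and> (\<forall>p\<in>J. px * p \<in> J \<and> py * p \<in> J \<and> pz * p \<in> J \<and> pw * p \<in> J)"

definition disc_ideal :: "complex \<Rightarrow> quartic_ring set" where
  "disc_ideal chi = range (\<lambda>p. (disc - cst chi) * p)"

lemma sub_spaceD:
  assumes "sub_space N"
  shows sub_space_0: "0 \<in> N" and sub_space_add: "p \<in> N \<Longrightarrow> q \<in> N \<Longrightarrow> p + q \<in> N"
    and sub_space_scale: "p \<in> N \<Longrightarrow> cst c * p \<in> N"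
    and sub_space_minus: "p \<in> N \<Longrightarrow> - p \<in> N"
    and sub_space_diff: "p \<in> N \<Longrightarrow> q \<in> N \<Longrightarrow> p - q \<in> N"
    and sub_space_sum: "(\<And>a. a \<in> A \<Longrightarrow> f a \<in> N) \<Longrightarrow> sum f A \<in> N"
    and sub_space_of_nat: "p \<in> N \<Longrightarrow> of_nat n * p \<in> N"
    and sub_space_numeral: "p \<in> N \<Longrightarrow> numeral k * p \<in> N"
proof -
  show 0: "0 \<in> N" and add: "p \<in> N \<Longrightarrow> q \<in> N \<Longrightarrow> p + q \<in> N" and scale: "p \<in> N \<Longrightarrow> cst c * p \<in> N" for p q c
    using assms by (auto simp: sub_space_def)
  show minus: "p \<in> N \<Longrightarrow> - p \<in> N" for p using scale[of p "- 1"] by (simp add: cst_simps)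
  then show "p \<in> N \<Longrightarrow> q \<in> N \<Longrightarrow> p - q \<in> N" using add[of p "- q"] by simp
  show "(\<And>a. a \<in> A \<Longrightarrow> f a \<in> N) \<Longrightarrow> sum f A \<in> N"
    by (induction A rule: infinite_finite_induct) (auto intro: 0 add)
  show "p \<in> N \<Longrightarrow> of_nat n * p \<in> N" using scale[of p "of_nat n"] by (simp add: cst_simps)
  show "p \<in> N \<Longrightarrow> numeral k * p \<in> N" using scale[of p "numeral k"] by (simp add: cst_simps)
qed

lemma sub_space_cancel:
  assumes N: "sub_space N" and "cst c * p \<in> N" "c \<noteq> 0" shows "p \<in> N"
proof -
  have "cst (inverse c) * cst c = 1" unfolding cst_simps(4)[symmetric] using assms(3) by (simp add: cst_simps)
  then have "cst (inverse c) * (cst c * p) = p" by (simp add: mult.assoc[symmetric])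
  then show ?thesis using sub_space_scale[OF N assms(2), of "inverse c"] by metis
qed

lemma inv_idealD:
  assumes "inv_ideal J"
  shows inv_ideal_sub: "sub_space J" and inv_ideal_E: "p \<in> J \<Longrightarrow> opE p \<in> J"
    and inv_ideal_F: "p \<in> J \<Longrightarrow> opF p \<in> J" and inv_ideal_H: "p \<in> J \<Longrightarrow> opH p \<in> J"
    and inv_ideal_mult: "p \<in> J \<Longrightarrow> q * p \<in> J"
proof -
  show s: "sub_space J" and "p \<in> J \<Longrightarrow> opE p \<in> J" "p \<in> J \<Longrightarrow> opF p \<in> J" "p \<in> J \<Longrightarrow> opH p \<in> J" for p
    using assms by (auto simp: inv_ideal_def sl2_stable_def)
  show "p \<in> J \<Longrightarrow> q * p \<in> J"
    by (induction q rule: quartic_induct)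
      (use assms in \<open>auto simp: inv_ideal_def distrib_right mult.assoc intro: sub_space_add[OF s] sub_space_scale[OF s]\<close>)
qed

text \<open>E, F and H annihilate C and constants, hence commute with multiplication by C -
  \<open>chi\<close>.\<close>

lemma inv_ideal_disc_ideal: "inv_ideal (disc_ideal chi)"
proof -
  have m: "p * ((disc - cst chi) * q) \<in> disc_ideal chi" for p q
    by (auto simp: disc_ideal_def intro!: image_eqI[of _ _ "p * q"] simp: mult_ac)
  have a: "(disc - cst chi) * p + (disc - cst chi) * q \<in> disc_ideal chi" for p q
    by (auto simp: disc_ideal_def intro!: image_eqI[of _ _ "p + q"] simp: algebra_simps)
  show ?thesis unfolding inv_ideal_def sl2_stable_def sub_space_def
    using m[of 0 0] m a by (auto simp: disc_ideal_def E_simps F_simps H_simps)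
qed

lemma inv_ideal_eq_UNIV: "inv_ideal J \<Longrightarrow> 1 \<in> J \<Longrightarrow> J = UNIV"
  using inv_ideal_mult[of J 1] by auto

definition eval_pt :: "complex \<Rightarrow> complex \<Rightarrow> complex \<Rightarrow> complex \<Rightarrow> quartic_ring \<Rightarrow> complex" where
  "eval_pt x y z w p = poly (poly (poly (poly p [:[:[:x:]:]:]) [:[:y:]:]) [:z:]) w"

lemma disc_ideal_proper: "1 \<notin> disc_ideal chi"
proof
  \<comment> \<open>At the point (1, 0, 0, r) the discriminant is -27 r^2, so this r places the
    point on the hypersurface C = \<open>chi\<close>, where every element of the ideal evaluates to
    0.\<close>
  obtain r where r: "r ^ 2 = - chi / 27" by (metis power2_csqrt)
  let ?ev = "eval_pt 1 0 0 r"
  assume "1 \<in> disc_ideal chi"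
  then obtain p where p: "1 = (disc - cst chi) * p" by (auto simp: disc_ideal_def)
  have ev: "?ev (a * b) = ?ev a * ?ev b" "?ev (a - b) = ?ev a - ?ev b" "?ev (a + b) = ?ev a + ?ev b"
     "?ev (a ^ n) = ?ev a ^ n" for a b n
    by (simp_all add: eval_pt_def poly_power)
  have gens: "?ev px = 1" "?ev py = 0" "?ev pz = 0" "?ev pw = r" "?ev (cst c) = c" for c
    by (simp_all add: eval_pt_def px_def py_def pz_def pw_def cst_def)
  have num: "?ev 27 = 27" using gens(5)[of 27] by (simp add: cst_simps)
  have "?ev (disc - cst chi) = 0"
    unfolding disc_def by (simp add: ev gens num r)
  then have "?ev 1 = 0" unfolding p ev by simp
  then show False using gens(5)[of 1] by (simp add: cst_simps)
qed

section \<open>The Casimir operator and the trivial component\<close>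

definition casimir :: "quartic_ring \<Rightarrow> quartic_ring" where
  "casimir p = opH (opH p) + 2 * opH p + 4 * opF (opE p)"

lemma casimir_simps:
  "casimir (p + q) = casimir p + casimir q" "casimir (p - q) = casimir p - casimir q"
  "casimir (cst c * p) = cst c * casimir p"
  "casimir ((disc - cst chi) * p) = (disc - cst chi) * casimir p" "casimir (cst c) = 0" "casimir 0 = 0"
  by (simp_all add: casimir_def E_simps F_simps H_simps algebra_simps)

lemma casimir_F: "casimir (opF p) = opF (casimir p)"
  by (simp add: casimir_def E_simps F_simps H_simps EF_commutator HF_commutator algebra_simps)

text \<open>On a highest weight vector of weight n the term with E vanishes and H^2 + 2 H gives n (n
  + 2); commutation with F carries the eigenvalue down the string.\<close>

lemma casimir_hw:
  "casimir ((opF ^^ i) (hw a b c)) = cst (of_nat ((3 * a + 2 * b + 3 * c) * (3 * a + 2 * b + 3 * c + 2))) * (opF ^^ i) (hw a b c)"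
proof (induction i)
  case 0
  show ?case unfolding casimir_def by (simp add: op_hw F_simps H_simps cst_simps algebra_simps)
next
  case (Suc i)
  then show ?case by (simp add: casimir_F)
qed

text \<open>The monic polynomial with the listed roots, evaluated at the Casimir operator.\<close>

definition casimir_prod :: "complex list \<Rightarrow> quartic_ring \<Rightarrow> quartic_ring" where
  "casimir_prod = foldr (\<lambda>l p. casimir p - cst l * p)"

lemma casimir_prod_simps [simp]:
  "casimir_prod [] p = p" "casimir_prod (l # ls) p = casimir (casimir_prod ls p) - cst l * casimir_prod ls p"
  "casimir_prod (ls @ [l]) p = casimir_prod ls (casimir p - cst l * p)"
  by (simp_all add: casimir_prod_def)

lemma casimir_prod_linear:
  "casimir_prod ls (p + q) = casimir_prod ls p + casimir_prod ls q"
  "casimir_prod ls (p - q) = casimir_prod ls p - casimir_prod ls q"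
  "casimir_prod ls (cst c * p) = cst c * casimir_prod ls p"
  "casimir_prod ls (casimir p) = casimir (casimir_prod ls p)"
proof -
  show "casimir_prod ls (p + q) = casimir_prod ls p + casimir_prod ls q"
    by (induction ls) (simp_all add: casimir_simps algebra_simps)
  show "casimir_prod ls (p - q) = casimir_prod ls p - casimir_prod ls q"
    by (induction ls) (simp_all add: casimir_simps right_diff_distrib)
  show "casimir_prod ls (cst c * p) = cst c * casimir_prod ls p"
    by (induction ls) (simp_all add: casimir_simps right_diff_distrib mult.left_commute)
  show "casimir_prod ls (casimir p) = casimir (casimir_prod ls p)"
    by (induction ls) (simp_all add: casimir_simps)
qed

lemma casimir_prod_commute:
  "casimir_prod ls (casimir p - cst l * p) = casimir (casimir_prod ls p) - cst l * casimir_prod ls p"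
  by (simp add: casimir_prod_linear)

lemma casimir_prod_cst: "casimir_prod ls (cst c) = cst ((\<Prod>l\<leftarrow>ls. - l) * c)"
  by (induction ls) (simp_all add: casimir_simps cst_simps)

lemma casimir_prod_stable: "inv_ideal J \<Longrightarrow> p \<in> J \<Longrightarrow> casimir_prod ls p \<in> J"
proof (induction ls)
  case (Cons l ls)
  note J = sub_spaceD[OF inv_ideal_sub[OF Cons.prems(1)]] inv_idealD[OF Cons.prems(1)]
  show ?case unfolding casimir_prod_simps casimir_def by (intro J Cons)
qed simp

text \<open>Each string vector in the sum is an eigenvector for n (n + 2) with n > 0; adjoining that
  number to the roots kills it. That 0 is never a root keeps the constants alive.\<close>

lemma casimir_prod_annihilates:
  assumes "p \<in> hw_span chi (- {(0, 0, 0)})"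
  shows "\<exists>ls. 0 \<notin> set ls \<and> casimir_prod ls p \<in> disc_ideal chi"
  using assms
proof (induction p rule: hw_span.induct)
  case (base p)
  then show ?case by (intro exI[of _ "[]"]) (auto simp: disc_ideal_def)
next
  case (step q a b c k i)
  then obtain ls where ls: "0 \<notin> set ls" "casimir_prod ls q \<in> disc_ideal chi" by blast
  define l where "l = (of_nat ((3 * a + 2 * b + 3 * c) * (3 * a + 2 * b + 3 * c + 2)) :: complex)"
  have l: "l \<noteq> 0" using step.hyps(2) unfolding l_def of_nat_eq_0_iff by auto
  have "casimir_prod (ls @ [l]) (cst k * (opF ^^ i) (hw a b c) + q) = casimir (casimir_prod ls q) - cst l * casimir_prod ls q"
    unfolding casimir_prod_simps casimir_simps casimir_hw l_def[symmetric]
    by (simp add: casimir_prod_commute[symmetric] algebra_simps)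
  also have "\<dots> \<in> disc_ideal chi"
    using casimir_prod_stable[OF inv_ideal_disc_ideal ls(2), of "[l]"] by simp
  finally show ?case using ls l by (intro exI[of _ "ls @ [l]"]) auto
qed

lemma hw_span_split: "\<exists>k q. p = cst k + q \<and> q \<in> hw_span chi (- {(0, 0, 0)})"
  using hw_span_UNIV[of p chi]
proof (induction p rule: hw_span.induct)
  case (base p)
  show ?case using hw_span.base[of chi p] by (intro exI[of _ 0] exI[of _ "(disc - cst chi) * p"]) (simp add: cst_simps)
next
  case (step q a b c k i)
  then obtain k' q' where q: "q = cst k' + q'" "q' \<in> hw_span chi (- {(0, 0, 0)})" by blast
  show ?case
  proof (cases "(a, b, c) = (0, 0, 0)")
    case True
    \<comment> \<open>F kills constants, so the string of 1 contributes nothing below its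
      top.\<close>
    have "(opF ^^ Suc i) 1 = 0" for i by (induction i) (simp_all add: F_simps)
    then have "\<exists>k''. cst k * (opF ^^ i) (hw a b c) = cst k''"
      using True by (cases i) (auto simp: hw_def cst_simps simp del: funpow.simps intro: exI[of _ 0])
    then obtain k'' where "cst k * (opF ^^ i) (hw a b c) = cst k''" by blast
    with q show ?thesis by (intro exI[of _ "k'' + k'"] exI[of _ q']) (simp add: cst_simps)
  next
    case False
    then have "cst k * (opF ^^ i) (hw a b c) + q' \<in> hw_span chi (- {(0, 0, 0)})"
      by (intro hw_span.step q(2)) simp
    then show ?thesis unfolding q(1)
      by (intro exI[of _ k'] exI[of _ "cst k * (opF ^^ i) (hw a b c) + q'"] conjI) (simp_all add: algebra_simps)
  qed
qed

text \<open>Apply the operator that sends q into the ideal of C - \<open>chi\<close>: it preserves J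
  and multiplies the constant k by the nonzero product of the negated roots.\<close>

lemma one_mem_of_casimir:
  assumes J: "inv_ideal J" "disc_ideal chi \<subseteq> J" and p: "cst k + q \<in> J" "q \<in> hw_span chi (- {(0, 0, 0)})" "k \<noteq> 0"
  shows "1 \<in> J"
proof -
  obtain ls where ls: "0 \<notin> set ls" "casimir_prod ls q \<in> disc_ideal chi"
    using casimir_prod_annihilates[OF p(2)] by blast
  have "casimir_prod ls (cst k + q) - casimir_prod ls q \<in> J"
    using casimir_prod_stable[OF J(1) p(1)] ls(2) J by (auto intro: sub_space_diff[OF inv_ideal_sub])
  then have "cst ((\<Prod>l\<leftarrow>ls. - l) * k) * 1 \<in> J" by (simp add: casimir_prod_linear casimir_prod_cst)
  moreover have "(\<Prod>l\<leftarrow>ls. - l) * k \<noteq> 0" using ls(1) p(3) by (induction ls) auto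
  ultimately show ?thesis using sub_space_cancel[OF inv_ideal_sub[OF J(1)]] by blast
qed

lemma proper_subset_hw_span:
  assumes "inv_ideal J" "disc_ideal chi \<subseteq> J" "1 \<notin> J"
  shows "J \<subseteq> hw_span chi (- {(0, 0, 0)})"
proof
  fix p assume "p \<in> J"
  obtain k q where p: "p = cst k + q" "q \<in> hw_span chi (- {(0, 0, 0)})" using hw_span_split by blast
  then have "k = 0" using one_mem_of_casimir[OF assms(1,2)] \<open>p \<in> J\<close> assms(3) by blast
  with p show "p \<in> hw_span chi (- {(0, 0, 0)})" by (simp add: cst_simps)
qed

lemma one_notin_hw_span: "1 \<notin> hw_span chi (- {(0, 0, 0)})"
proof
  assume 1: "1 \<in> hw_span chi (- {(0, 0, 0)})"
  \<comment> \<open>Zero, written as the constant 1 plus a vector of the reduced span.\<close>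
  have "cst 1 + cst (- 1) * 1 \<in> disc_ideal chi"
    using sub_space_0[OF inv_ideal_sub[OF inv_ideal_disc_ideal]] by (simp add: cst_simps)
  then show False
    using one_mem_of_casimir[OF inv_ideal_disc_ideal order_refl _ hw_span_scale[OF 1]] disc_ideal_proper by force
qed

section \<open>The largest proper invariant ideal\<close>

definition max_ideal :: "complex \<Rightarrow> quartic_ring set" where
  "max_ideal chi = \<Union> {J. inv_ideal J \<and> disc_ideal chi \<subseteq> J \<and> 1 \<notin> J}"

lemma max_ideal_greatest: "inv_ideal J \<Longrightarrow> disc_ideal chi \<subseteq> J \<Longrightarrow> 1 \<notin> J \<Longrightarrow> J \<subseteq> max_ideal chi"
  by (auto simp: max_ideal_def)

lemma disc_ideal_subset_max: "disc_ideal chi \<subseteq> max_ideal chi"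
  by (rule max_ideal_greatest) (auto simp: inv_ideal_disc_ideal disc_ideal_proper)

lemma one_notin_max_ideal: "1 \<notin> max_ideal chi"
  by (auto simp: max_ideal_def)

text \<open>Closure of the union under addition is the point. Two proper ideals J and K both lie in
  the span without the trivial component, which is closed under addition and omits 1; so J + K is
  proper and belongs to the family again.\<close>

lemma inv_ideal_max_ideal: "inv_ideal (max_ideal chi)"
proof -
  have add: "p + q \<in> max_ideal chi" if pq: "p \<in> max_ideal chi" "q \<in> max_ideal chi" for p q
  proof -
    obtain J K where J: "inv_ideal J" "disc_ideal chi \<subseteq> J" "1 \<notin> J" "p \<in> J"
      and K: "inv_ideal K" "disc_ideal chi \<subseteq> K" "1 \<notin> K" "q \<in> K"
      using pq unfolding max_ideal_def by blast
    define L where "L = {u + v | u v. u \<in> J \<and> v \<in> K}"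
    have mem: "u + v \<in> L" if "u \<in> J" "v \<in> K" for u v using that unfolding L_def by blast
    note J' = sub_spaceD[OF inv_ideal_sub[OF J(1)]] inv_idealD[OF J(1)]
    note K' = sub_spaceD[OF inv_ideal_sub[OF K(1)]] inv_idealD[OF K(1)]
    have "inv_ideal L" unfolding inv_ideal_def sl2_stable_def sub_space_def
    proof (intro conjI ballI allI)
      show "0 \<in> L" using mem[of 0 0] J' K' by simp
    next
      fix p q assume "p \<in> L" "q \<in> L"
      then obtain u v u' v' where pq: "p = u + v" "q = u' + v'" "u \<in> J" "v \<in> K" "u' \<in> J" "v' \<in> K"
        unfolding L_def by blast
      have "(u + u') + (v + v') \<in> L" by (intro mem J'(2) K'(2) pq)
      then show "p + q \<in> L" unfolding pq(1,2) by (simp add: algebra_simps)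
    next
      fix p c assume "p \<in> L"
      then obtain u v where p: "p = u + v" "u \<in> J" "v \<in> K" unfolding L_def by blast
      show "cst c * p \<in> L" "opE p \<in> L" "opF p \<in> L" "opH p \<in> L" "px * p \<in> L" "py * p \<in> L" "pz * p \<in> L" "pw * p \<in> L"
        unfolding p(1) distrib_left derivation_add[OF derivation_E] derivation_add[OF derivation_F]
          derivation_add[OF derivation_H]
        by (intro mem J'(3) K'(3) J'(10-13) K'(10-13) p(2,3))+
    qed
    moreover have "disc_ideal chi \<subseteq> L"
    proof
      fix r assume "r \<in> disc_ideal chi"
      then have "r + 0 \<in> L" using J(2) K'(1) by (intro mem) blast+
      then show "r \<in> L" by simp
    qed
    moreover have "1 \<notin> L"
    proof
      assume "1 \<in> L"
      then obtain u v where uv: "1 = u + v" "u \<in> J" "v \<in> K" unfolding L_def by blast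
      then have "u \<in> hw_span chi (- {(0, 0, 0)})" "v \<in> hw_span chi (- {(0, 0, 0)})"
        using proper_subset_hw_span[OF J(1-3)] proper_subset_hw_span[OF K(1-3)] by blast+
      then show False using hw_span_add uv(1) one_notin_hw_span by metis
    qed
    moreover have "p + q \<in> L" by (rule mem[OF J(4) K(4)])
    ultimately show ?thesis unfolding max_ideal_def by blast
  qed
  have mem: "f p \<in> max_ideal chi" if "p \<in> max_ideal chi" "\<And>J. inv_ideal J \<Longrightarrow> p \<in> J \<Longrightarrow> f p \<in> J" for f p
    using that unfolding max_ideal_def by blast
  show ?thesis unfolding inv_ideal_def sl2_stable_def sub_space_def
  proof (intro conjI ballI allI)
    show "0 \<in> max_ideal chi"
      using disc_ideal_subset_max[of chi] sub_space_0[OF inv_ideal_sub[OF inv_ideal_disc_ideal[of chi]]] by blast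
  next
    fix p c assume p: "p \<in> max_ideal chi"
    show "cst c * p \<in> max_ideal chi" "px * p \<in> max_ideal chi" "py * p \<in> max_ideal chi"
      "pz * p \<in> max_ideal chi" "pw * p \<in> max_ideal chi"
      by (rule mem[OF p], erule inv_ideal_mult, assumption)+
    show "opE p \<in> max_ideal chi" by (rule mem[OF p], rule inv_ideal_E)
    show "opF p \<in> max_ideal chi" by (rule mem[OF p], rule inv_ideal_F)
    show "opH p \<in> max_ideal chi" by (rule mem[OF p], rule inv_ideal_H)
  qed (rule add)
qed

section \<open>Strings of weight vectors\<close>

fun hwt :: "nat \<times> nat \<times> nat \<Rightarrow> quartic_ring" where "hwt (a, b, c) = hw a b c"
fun wt :: "nat \<times> nat \<times> nat \<Rightarrow> nat" where "wt (a, b, c) = 3 * a + 2 * b + 3 * c"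

definition strg :: "nat \<times> nat \<times> nat \<Rightarrow> nat \<Rightarrow> quartic_ring" where
  "strg t i = (opF ^^ i) (hwt t)"

lemma finite_wt: "finite {t. wt t = n}"
proof (rule finite_subset)
  show "{t. wt t = n} \<subseteq> {..n} \<times> {..n} \<times> {..n}" by auto
qed auto

lemma F_strg: "opF (strg t i) = strg t (Suc i)"
  by (simp add: strg_def)

lemma H_strg: "opH (strg t i) = cst (of_nat (wt t) - 2 * of_nat i) * strg t i"
proof (induction i)
  case 0
  show ?case using op_hw(2) by (cases t) (simp add: strg_def cst_simps)
next
  case (Suc i)
  have "opH (strg t (Suc i)) = opF (opH (strg t i)) - 2 * opF (strg t i)"
    unfolding F_strg[symmetric] by (rule HF_commutator)
  then show ?case unfolding Suc op_cst_mult F_strg by (simp add: cst_simps algebra_simps)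
qed

lemma E_strg: "opE (strg t (Suc i)) = cst (of_nat (Suc i) * (of_nat (wt t) - of_nat i)) * strg t i"
proof (induction i)
  case 0
  have "opE (strg t 0) = 0" using op_hw(1) by (cases t) (simp add: strg_def)
  then show ?case unfolding F_strg[symmetric, of t 0] EF_commutator by (simp add: H_strg F_simps)
next
  case (Suc i)
  show ?case unfolding F_strg[symmetric, of t "Suc i"] EF_commutator Suc H_strg op_cst_mult
    by (simp add: F_strg cst_simps algebra_simps)
qed

lemma E_strg_0: "opE (strg t 0) = 0"
  using op_hw(1) by (cases t) (simp add: strg_def)

lemma casimir_strg: "casimir (strg t i) = cst (of_nat (wt t * (wt t + 2))) * strg t i"
  using casimir_hw by (cases t) (simp add: strg_def)

lemma iterate_0: "(opF ^^ i) 0 = 0" "(opE ^^ i) 0 = 0"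
  by (induction i) (simp_all add: F_simps E_simps)

lemma iterate_add: "(opF ^^ i) (p + q) = (opF ^^ i) p + (opF ^^ i) q" "(opE ^^ i) (p + q) = (opE ^^ i) p + (opE ^^ i) q"
  by (induction i) (simp_all add: F_simps E_simps)

lemma iterate_scale: "(opF ^^ i) (cst c * p) = cst c * (opF ^^ i) p" "(opE ^^ i) (cst c * p) = cst c * (opE ^^ i) p"
  by (induction i) simp_all

lemma iterate_diff: "(opF ^^ i) (p - q) = (opF ^^ i) p - (opF ^^ i) q"
  by (induction i) (simp_all add: F_simps)

lemma iterate_sum: "(opF ^^ i) (sum f A) = (\<Sum>a\<in>A. (opF ^^ i) (f a))" "(opE ^^ i) (sum f A) = (\<Sum>a\<in>A. (opE ^^ i) (f a))"
  by (induction A rule: infinite_finite_induct) (simp_all add: iterate_0 iterate_add)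

text \<open>In F^(m+n+1)(u v) every Leibniz term applies F more than m times to u or more than n
  times to v. The induction on m + n peels off one F at a time.\<close>

lemma nilpotent_mult:
  "(opF ^^ Suc m) u = 0 \<Longrightarrow> (opF ^^ Suc n) v = 0 \<Longrightarrow> (opF ^^ Suc (m + n)) (u * v) = 0"
proof (induction "m + n" arbitrary: m n u v)
  case 0
  then show ?case by (simp add: F_simps)
next
  case (Suc k)
  have shift: "(opF ^^ Suc i) w = (opF ^^ i) (opF w)" for i w by (simp add: funpow_swap1)
  have 1: "(opF ^^ (m + n)) (opF u * v) = 0"
  proof (cases m)
    case 0
    then show ?thesis using Suc.prems(1) by (simp add: iterate_0)
  next
    case (Suc m')
    then show ?thesis using Suc.hyps(1)[of m' n "opF u" v] Suc.prems Suc.hyps(2)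
      unfolding shift[of m] by simp
  qed
  have 2: "(opF ^^ (m + n)) (u * opF v) = 0"
  proof (cases n)
    case 0
    then show ?thesis using Suc.prems(2) by (simp add: iterate_0)
  next
    case (Suc n')
    then show ?thesis using Suc.hyps(1)[of m n' u "opF v"] Suc.prems Suc.hyps(2)
      unfolding shift[of n] by simp
  qed
  show ?case unfolding shift F_simps(2) iterate_add using 1 2 by simp
qed

lemma nilpotent_power: "(opF ^^ Suc m) u = 0 \<Longrightarrow> (opF ^^ Suc (k * m)) (u ^ k) = 0"
proof (induction k)
  case (Suc k)
  then show ?case using nilpotent_mult[of m u "k * m" "u ^ k"] by simp
qed (simp add: F_simps)

text \<open>The covariants x, H and T are killed by F to the power one more than their weights 3, 2,
  3, and \<open>nilpotent_mult\<close> carries this property over to products.\<close>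

lemma strg_top: "i > wt t \<Longrightarrow> strg t i = 0"
proof -
  assume i: "i > wt t"
  obtain a b c where t: "t = (a, b, c)" by (cases t)
  have x: "(opF ^^ Suc 3) px = 0" and H: "(opF ^^ Suc 2) cov_H = 0" and T: "(opF ^^ Suc 3) cov_T = 0"
    using FF_cov by (simp_all add: numeral_3_eq_3 numeral_2_eq_2 F_H_def[symmetric] F_T_def[symmetric])
      (simp_all add: F_simps algebra_simps power2_eq_square)
  have 0: "(opF ^^ Suc (wt t)) (hwt t) = 0"
    using nilpotent_mult[OF nilpotent_mult[OF nilpotent_power[OF x, of a] nilpotent_power[OF H, of b]]
        nilpotent_power[OF T, of c]] by (simp add: t hw_def mult_ac)
  obtain j where "i = j + Suc (wt t)" using i by (metis Suc_leI add.commute le_Suc_ex)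
  then show ?thesis using 0 by (simp only: strg_def funpow_add o_apply iterate_0)
qed

text \<open>Each step upward contributes a factor (i + 1)(n - i), nonzero while i < n.\<close>

lemma E_iterate_strg:
  assumes "i \<le> wt t" shows "\<exists>k. k \<noteq> 0 \<and> (opE ^^ i) (strg t i) = cst k * hwt t"
  using assms
proof (induction i)
  case 0
  show ?case by (intro exI[of _ 1]) (simp add: strg_def cst_simps)
next
  case (Suc i)
  then obtain k where k: "k \<noteq> 0" "(opE ^^ i) (strg t i) = cst k * hwt t" by auto
  have nz: "of_nat (Suc i) * (of_nat (wt t) - of_nat i) \<noteq> (0::complex)"
    using Suc.prems by (auto simp del: of_nat_Suc)
  have "(opE ^^ Suc i) (strg t (Suc i)) = cst (of_nat (Suc i) * (of_nat (wt t) - of_nat i) * k) * hwt t"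
    unfolding funpow_Suc_right o_apply E_strg iterate_scale k(2) cst_simps(4)[of _ k] by (simp only: mult.assoc)
  moreover have "of_nat (Suc i) * (of_nat (wt t) - of_nat i) * k \<noteq> 0" using nz k(1) by (metis mult_eq_0_iff)
  ultimately show ?case by (intro exI conjI)
qed

lemma E_iterate_strg_0: "j > i \<Longrightarrow> (opE ^^ j) (strg t i) = 0"
proof (induction i arbitrary: j)
  case 0
  then show ?case by (cases j) (simp_all add: funpow_swap1 E_strg_0 iterate_0)
next
  case (Suc i)
  then show ?case by (cases j) (simp_all add: funpow_swap1 E_strg iterate_scale)
qed

section \<open>Ladders spanned by single strings\<close>

definition strg_comb :: "nat \<times> nat \<times> nat \<Rightarrow> (nat \<Rightarrow> complex) \<Rightarrow> quartic_ring" where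
  "strg_comb t c = (\<Sum>i\<le>wt t. cst (c i) * strg t i)"

definition ladder :: "nat \<times> nat \<times> nat \<Rightarrow> quartic_ring set" where
  "ladder t = range (strg_comb t)"

lemma strg_comb_linear:
  "strg_comb t (\<lambda>i. c i + d i) = strg_comb t c + strg_comb t d"
  "strg_comb t (\<lambda>i. k * c i) = cst k * strg_comb t c" "strg_comb t (\<lambda>i. 0) = 0"
  by (simp_all add: strg_comb_def cst_simps sum.distrib sum_distrib_left algebra_simps)

lemma sub_space_ladder: "sub_space (ladder t)"
proof -
  have "0 \<in> ladder t" unfolding ladder_def strg_comb_linear(3)[of t, symmetric] by blast
  moreover have "p + q \<in> ladder t" if "p \<in> ladder t" "q \<in> ladder t" for p q
    using that unfolding ladder_def by (auto simp: strg_comb_linear(1)[symmetric])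
  moreover have "cst k * p \<in> ladder t" if "p \<in> ladder t" for p k
    using that unfolding ladder_def by (auto simp: strg_comb_linear(2)[symmetric])
  ultimately show ?thesis unfolding sub_space_def by blast
qed

lemma strg_mem_ladder: "strg t i \<in> ladder t"
proof (cases "i \<le> wt t")
  case True
  have "strg_comb t (\<lambda>j. if j = i then 1 else 0) = (\<Sum>j\<le>wt t. if j = i then strg t j else 0)"
    unfolding strg_comb_def by (rule sum.cong) (auto simp: cst_simps)
  also have "\<dots> = strg t i" using True by simp
  finally show ?thesis unfolding ladder_def by (metis rangeI)
next
  case False
  then show ?thesis using strg_top sub_space_0[OF sub_space_ladder] by simp
qed

lemma ladder_induct:
  assumes "p \<in> ladder t" "sub_space N" "\<And>i. i \<le> wt t \<Longrightarrow> strg t i \<in> N"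
  shows "p \<in> N"
proof -
  obtain c where "p = (\<Sum>i\<le>wt t. cst (c i) * strg t i)" using assms(1) by (auto simp: ladder_def strg_comb_def)
  then show ?thesis using assms(3) by (auto intro: sub_space_sum[OF assms(2)] sub_space_scale[OF assms(2)])
qed

lemma sl2_stable_ladder: "sl2_stable (ladder t)"
proof -
  note L = sub_spaceD[OF sub_space_ladder[of t]] strg_mem_ladder[of t]
  have lin: "sub_space {p. d p \<in> ladder t}" if "derivation d" "\<And>c p. d (cst c * p) = cst c * d p" for d
    using that L by (auto simp: sub_space_def derivation_add derivation_0)
  have E: "opE (strg t i) \<in> ladder t" for i by (cases i) (simp_all add: E_strg_0 E_strg L)
  have "p \<in> ladder t \<Longrightarrow> p \<in> {p. opE p \<in> ladder t}" for p
    by (erule ladder_induct) (simp_all add: lin derivation_E E)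
  moreover have "p \<in> ladder t \<Longrightarrow> p \<in> {p. opF p \<in> ladder t}" for p
    by (erule ladder_induct) (simp_all add: lin derivation_F F_strg L)
  moreover have "p \<in> ladder t \<Longrightarrow> p \<in> {p. opH p \<in> ladder t}" for p
    by (erule ladder_induct) (simp_all add: lin derivation_H H_strg L)
  ultimately show ?thesis unfolding sl2_stable_def using sub_space_ladder by blast
qed

lemma casimir_ladder: "p \<in> ladder t \<Longrightarrow> casimir p = cst (of_nat (wt t * (wt t + 2))) * p"
proof -
  assume "p \<in> ladder t"
  then have "p \<in> {p. casimir p = cst (of_nat (wt t * (wt t + 2))) * p}"
  proof (rule ladder_induct)
    show "sub_space {p. casimir p = cst (of_nat (wt t * (wt t + 2))) * p}"
      by (simp add: sub_space_def casimir_simps distrib_left mult.left_commute)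
  qed (simp only: casimir_strg mem_Collect_eq)
  then show ?thesis by simp
qed

text \<open>A power of \<open>E\<close> moves a nonzero vector of a ladder to a nonzero multiple of the highest weight vector.\<close>

lemma ladder_generates:
  assumes K: "sub_space K" "\<And>p. p \<in> K \<Longrightarrow> opE p \<in> K" "\<And>p. p \<in> K \<Longrightarrow> opF p \<in> K"
    and p: "strg_comb t c \<in> K" "i \<le> wt t" "c i \<noteq> 0"
  shows "ladder t \<subseteq> K"
proof -
  \<comment> \<open>Coefficients above m vanish and E^m kills the string vectors before position m,
    so only the m-th term survives.\<close>
  define m where "m = Max {i. i \<le> wt t \<and> c i \<noteq> 0}"
  have fin: "finite {i. i \<le> wt t \<and> c i \<noteq> 0}" by simp
  have "m \<in> {i. i \<le> wt t \<and> c i \<noteq> 0}" unfolding m_def by (rule Max_in[OF fin]) (use p in blast)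
  then have m: "m \<le> wt t" "c m \<noteq> 0" by auto
  have above: "c i = 0" if "i > m" "i \<le> wt t" for i
  proof (rule ccontr)
    assume "c i \<noteq> 0"
    then have "i \<le> m" unfolding m_def using that by (intro Max_ge[OF fin]) simp
    then show False using that by simp
  qed
  obtain k where k: "k \<noteq> 0" "(opE ^^ m) (strg t m) = cst k * hwt t" using E_iterate_strg[OF m(1)] by blast
  have "(opE ^^ m) (strg_comb t c) = (\<Sum>i\<le>wt t. cst (c i) * (opE ^^ m) (strg t i))"
    by (simp add: strg_comb_def iterate_sum iterate_scale)
  also have "\<dots> = (\<Sum>i\<le>wt t. if i = m then cst (c m * k) * hwt t else 0)"
  proof (rule sum.cong)
    fix i assume "i \<in> {..wt t}"
    then show "cst (c i) * (opE ^^ m) (strg t i) = (if i = m then cst (c m * k) * hwt t else 0)"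
      using above[of i] k(2) E_iterate_strg_0[of i m t]
      by (cases i m rule: linorder_cases) (simp_all add: cst_simps)
  qed simp
  also have "\<dots> = cst (c m * k) * hwt t" using m(1) by simp
  finally have "cst (c m * k) * hwt t = (opE ^^ m) (strg_comb t c)" by simp
  moreover have "(opE ^^ i) (strg_comb t c) \<in> K" for i by (induction i) (simp_all add: p K)
  ultimately have h: "hwt t \<in> K" using sub_space_cancel[OF K(1)] k(1) m(2) by (metis mult_eq_0_iff)
  have "strg t i \<in> K" for i unfolding strg_def by (induction i) (simp_all add: h K)
  then show ?thesis using ladder_induct[OF _ K(1)] by blast
qed

section \<open>Linear algebra modulo a subspace\<close>

lemma eigenvector_components:
  fixes D :: "quartic_ring \<Rightarrow> quartic_ring"
  assumes J: "sub_space J" "\<And>p. p \<in> J \<Longrightarrow> D p \<in> J"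
    and D: "\<And>p q. D (p + q) = D p + D q" "D 0 = 0" "\<And>c p. D (cst c * p) = cst c * D p"
    and "finite K" "inj_on l K" "\<And>k. k \<in> K \<Longrightarrow> D (f k) = cst (l k) * f k" "(\<Sum>k\<in>K. f k) \<in> J"
  shows "\<forall>k\<in>K. f k \<in> J"
  using assms(6-)
proof (induction K arbitrary: f rule: finite_induct)
  case (insert a K)
  have Dsum: "D (sum f A) = (\<Sum>k\<in>A. D (f k))" for A f
    by (induction A rule: infinite_finite_induct) (simp_all add: D)
  have "D (\<Sum>k\<in>insert a K. f k) = (\<Sum>k\<in>insert a K. cst (l k) * f k)"
    unfolding Dsum by (rule sum.cong) (use insert.prems in auto)
  \<comment> \<open>Applying D - l a removes the a-th component and rescales the others by l k - l
    a, nonzero by injectivity.\<close>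
  then have "(\<Sum>k\<in>insert a K. cst (l k) * f k) - cst (l a) * (\<Sum>k\<in>insert a K. f k) \<in> J"
    using J(2)[OF insert.prems(3)] sub_spaceD[OF J(1)] insert.prems(3) by metis
  also have "(\<Sum>k\<in>insert a K. cst (l k) * f k) - cst (l a) * (\<Sum>k\<in>insert a K. f k)
      = (\<Sum>k\<in>K. cst (l k - l a) * f k)"
    using insert.hyps by (simp add: sum_subtractf sum_distrib_left sum_distrib_right cst_simps algebra_simps)
  finally have sum: "(\<Sum>k\<in>K. cst (l k - l a) * f k) \<in> J" .
  have "\<forall>k\<in>K. cst (l k - l a) * f k \<in> J"
  proof (rule insert.IH[OF _ _ sum])
    show "inj_on l K" using insert.prems(1) by (rule inj_on_subset) blast
    show "D (cst (l k - l a) * f k) = cst (l k) * (cst (l k - l a) * f k)" if "k \<in> K" for k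
      using insert.prems(2)[of k] that by (simp add: D mult.left_commute)
  qed
  moreover have "l k - l a \<noteq> 0" if "k \<in> K" for k
    using inj_onD[OF insert.prems(1), of k a] insert.hyps(2) that by auto
  ultimately have K: "f k \<in> J" if "k \<in> K" for k
    using sub_space_cancel[OF J(1), of "l k - l a" "f k"] that by simp
  have "f a = (\<Sum>k\<in>insert a K. f k) - (\<Sum>k\<in>K. f k)" using insert.hyps by simp
  also have "\<dots> \<in> J" by (intro sub_space_diff[OF J(1)] sub_space_sum[OF J(1)] insert.prems(3) K)
  finally show ?case using K by simp
qed simp

text \<open>Extracts a basis of the span modulo J by adding an element only if it is not yet
  expressible. Relations in the quotient are phrased as membership in J.\<close>

lemma independent_modulo:
  assumes J: "sub_space J" and "finite A"
  shows "\<exists>B\<subseteq>A. (\<forall>c. (\<Sum>b\<in>B. cst (c b) * f b) \<in> J \<longrightarrow> (\<forall>b\<in>B. c b = 0)) \<and>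
    (\<forall>a\<in>A. \<exists>c. f a - (\<Sum>b\<in>B. cst (c b) * f b) \<in> J)"
  using assms(2)
proof (induction A rule: finite_induct)
  case empty
  then show ?case by blast
next
  case (insert a A)
  then obtain B where B: "B \<subseteq> A" "\<And>c. (\<Sum>b\<in>B. cst (c b) * f b) \<in> J \<Longrightarrow> \<forall>b\<in>B. c b = 0"
    "\<And>a. a \<in> A \<Longrightarrow> \<exists>c. f a - (\<Sum>b\<in>B. cst (c b) * f b) \<in> J" by blast
  have fin: "finite B" "a \<notin> B" using B(1) insert.hyps finite_subset by auto
  show ?case
  proof (cases "\<exists>c. f a - (\<Sum>b\<in>B. cst (c b) * f b) \<in> J")
    case True
    with B show ?thesis by (intro exI[of _ B]) auto
  next
    case False
    have "\<forall>b\<in>insert a B. c b = 0" if c: "(\<Sum>b\<in>insert a B. cst (c b) * f b) \<in> J" for c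
    proof -
      have "c a = 0"
      proof (rule ccontr)
        assume ca: "c a \<noteq> 0"
        have "(\<Sum>b\<in>insert a B. cst (c b) * f b) = cst (c a) * (f a - (\<Sum>b\<in>B. cst (- c b / c a) * f b))"
          using fin ca by (simp add: sum_distrib_left right_diff_distrib distrib_left mult.assoc[symmetric] cst_simps(4)[symmetric] sum_negf cst_simps(5))
        then have "f a - (\<Sum>b\<in>B. cst (- c b / c a) * f b) \<in> J"
          using sub_space_cancel[OF J _ ca] c by simp
        then have "\<exists>c. f a - (\<Sum>b\<in>B. cst (c b) * f b) \<in> J" by (rule exI[of _ "\<lambda>b. - c b / c a"])
        with False show False ..
      qed
      with c B(2)[of c] fin show ?thesis by (simp add: cst_simps)
    qed
    moreover have "\<exists>c. f x - (\<Sum>b\<in>insert a B. cst (c b) * f b) \<in> J" if "x \<in> insert a A" for x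
    proof (cases "x = a")
      case True
      have "(\<Sum>b\<in>insert a B. cst (if b = a then 1 else 0) * f b) = f a"
        using fin by (simp add: cst_simps if_distrib[of cst] if_distrib[of "\<lambda>x. x * _"] cong: if_cong)
      then show ?thesis using True sub_space_0[OF J] by (intro exI[of _ "\<lambda>b. if b = a then 1 else 0"]) simp
    next
      case False
      then obtain c where c: "f x - (\<Sum>b\<in>B. cst (c b) * f b) \<in> J" using B(3) \<open>x \<in> insert a A\<close> by auto
      have "(\<Sum>b\<in>B. cst ((c(a := 0)) b) * f b) = (\<Sum>b\<in>B. cst (c b) * f b)"
        by (rule sum.cong) (use fin in auto)
      then show ?thesis using c fin by (intro exI[of _ "c(a := 0)"]) (simp add: cst_simps)
    qed
    ultimately show ?thesis using B(1) by (intro exI[of _ "insert a B"]) auto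
  qed
qed

text \<open>The exchange argument: choose a pivot k0 in which b occurs, eliminate b from the other
  vectors, and apply the induction hypothesis to them over the smaller set.\<close>

lemma linear_relation:
  assumes J: "sub_space J" and "finite B" "finite K" "card B < card K"
    and "\<And>k. k \<in> K \<Longrightarrow> \<exists>c. f k - (\<Sum>b\<in>B. cst (c b) * b) \<in> J"
  shows "\<exists>d. (\<exists>k\<in>K. d k \<noteq> 0) \<and> (\<Sum>k\<in>K. cst (d k) * f k) \<in> J"
  using assms(2-)
proof (induction B arbitrary: K f rule: finite_induct)
  case empty
  then obtain k where "k \<in> K" by fastforce
  then show ?case using empty by (intro exI[of _ "\<lambda>_. 1"]) (auto simp: cst_simps intro: sub_space_sum[OF J])
next
  case (insert b B)
  note J' = sub_spaceD[OF J]
  have "\<forall>k\<in>K. \<exists>c. f k - (\<Sum>b\<in>insert b B. cst (c b) * b) \<in> J" using insert.prems(3) by blast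
  from bchoice[OF this] obtain c where c: "\<And>k. k \<in> K \<Longrightarrow> f k - (\<Sum>b\<in>insert b B. cst (c k b) * b) \<in> J" by blast
  then have c': "f k - cst (c k b) * b - (\<Sum>b\<in>B. cst (c k b) * b) \<in> J" if "k \<in> K" for k
    using insert.hyps that by (simp add: diff_diff_eq)
  show ?case
  proof (cases "\<forall>k\<in>K. c k b = 0")
    case True
    then have "f k - (\<Sum>b\<in>B. cst (c k b) * b) \<in> J" if "k \<in> K" for k
      using c'[OF that] that by (simp add: cst_simps)
    then have "\<exists>c. f k - (\<Sum>b\<in>B. cst (c b) * b) \<in> J" if "k \<in> K" for k using that by blast
    moreover have "card B < card K" using insert.prems(2) insert.hyps by simp
    ultimately show ?thesis by (intro insert.IH insert.prems(1))
  next
    case False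
    then obtain k0 where k0: "k0 \<in> K" "c k0 b \<noteq> 0" by blast
    define r where "r k = c k b / c k0 b" for k
    define g where "g k = f k - cst (r k) * f k0" for k
    have "\<exists>d. (\<exists>k\<in>K - {k0}. d k \<noteq> 0) \<and> (\<Sum>k\<in>K - {k0}. cst (d k) * g k) \<in> J"
    proof (rule insert.IH)
      show "finite (K - {k0})" "card B < card (K - {k0})" using insert.prems insert.hyps k0 by auto
      fix k assume k: "k \<in> K - {k0}"
      have e: "cst (r k) * cst (c k0 b) = cst (c k b)" using k0(2) by (simp add: cst_simps(4)[symmetric] r_def)
      have "(f k - cst (c k b) * b - (\<Sum>b\<in>B. cst (c k b) * b))
          - cst (r k) * (f k0 - cst (c k0 b) * b - (\<Sum>b\<in>B. cst (c k0 b) * b)) \<in> J"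
        using k k0(1) by (intro J'(5)[OF c' J'(3)[OF c']]) auto
      also have "(f k - cst (c k b) * b - (\<Sum>b\<in>B. cst (c k b) * b))
          - cst (r k) * (f k0 - cst (c k0 b) * b - (\<Sum>b\<in>B. cst (c k0 b) * b))
        = g k - (\<Sum>b\<in>B. cst (c k b - r k * c k0 b) * b)"
        unfolding e[symmetric] g_def
        by (simp add: cst_simps sum_subtractf sum_distrib_left sum_distrib_right algebra_simps)
      finally show "\<exists>c. g k - (\<Sum>b\<in>B. cst (c b) * b) \<in> J"
        by (rule exI[of _ "\<lambda>b. c k b - r k * c k0 b"])
    qed
    then obtain d where d: "\<exists>k\<in>K - {k0}. d k \<noteq> 0" "(\<Sum>k\<in>K - {k0}. cst (d k) * g k) \<in> J" by blast
    \<comment> \<open>The pivot coefficient collects what the elimination subtracted, so that the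
      combination of the f equals that of the g.\<close>
    define d' where "d' = d(k0 := - (\<Sum>k\<in>K - {k0}. d k * r k))"
    have "(\<Sum>k\<in>K. cst (d' k) * f k) = cst (d' k0) * f k0 + (\<Sum>k\<in>K - {k0}. cst (d' k) * f k)"
      using insert.prems(1) k0 by (simp add: sum.remove)
    also have "(\<Sum>k\<in>K - {k0}. cst (d' k) * f k) = (\<Sum>k\<in>K - {k0}. cst (d k) * f k)"
      by (rule sum.cong) (auto simp: d'_def)
    also have "cst (d' k0) * f k0 + \<dots> = (\<Sum>k\<in>K - {k0}. cst (d k) * g k)"
      by (simp add: d'_def g_def cst_simps cst_sum sum_subtractf sum_distrib_left sum_distrib_right algebra_simps)
    finally have "(\<Sum>k\<in>K. cst (d' k) * f k) \<in> J" using d(2) by simp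
    moreover have "\<exists>k\<in>K. d' k \<noteq> 0" using d(1) by (auto simp: d'_def)
    ultimately show ?thesis by blast
  qed
qed

section \<open>Infinite dimension of proper quotients for nonzero chi\<close>

lemma weight_power_mem:
  assumes J: "inv_ideal J" and B: "finite B" "\<And>p. \<exists>c. p - (\<Sum>b\<in>B. cst (c b) * b) \<in> J"
    and v: "opH v = cst l * v" "l \<noteq> 0"
  shows "\<exists>k. v ^ k \<in> J"
proof -
  note J' = inv_ideal_sub[OF J]
  \<comment> \<open>More powers of v than elements of B are dependent modulo J. Their H-weights k l
    are distinct, so each term of the relation lies in J separately.\<close>
  obtain d where d: "\<exists>k\<in>{..card B}. d k \<noteq> 0" "(\<Sum>k\<in>{..card B}. cst (d k) * v ^ k) \<in> J"
    using linear_relation[OF J' B(1), of "{..card B}" "\<lambda>k. v ^ k"] B(2) by auto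
  have "\<forall>k\<in>{..card B}. cst (d k) * v ^ k \<in> J"
  proof (rule eigenvector_components[where D = opH and l = "\<lambda>k. of_nat k * l"])
    fix k
    have "opH (v ^ k) = of_nat k * v ^ (k - 1) * (cst l * v)" by (simp add: H_simps v(1))
    then have "opH (v ^ k) = cst (of_nat k * l) * v ^ k"
      by (cases k) (simp_all add: cst_simps algebra_simps)
    then show "opH (cst (d k) * v ^ k) = cst (of_nat k * l) * (cst (d k) * v ^ k)"
      by (simp add: mult.left_commute)
  qed (use J d(2) v(2) in \<open>auto simp: J' inv_ideal_H H_simps(1,3) inj_on_def\<close>)
  moreover obtain k where "k \<in> {..card B}" "d k \<noteq> 0" using d(1) by auto
  ultimately have "v ^ k \<in> J" using sub_space_cancel[OF J', of "d k" "v ^ k"] by simp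
  then show ?thesis ..
qed

lemma proper_infinite_dimensional:
  assumes J: "inv_ideal J" "disc_ideal chi \<subseteq> J" "1 \<notin> J" and chi: "chi \<noteq> 0" and B: "finite B"
  shows "\<exists>p. \<forall>c. p - (\<Sum>b\<in>B. cst (c b) * b) \<notin> J"
proof (rule ccontr)
  assume "\<not> ?thesis"
  then have B': "\<And>p. \<exists>c. p - (\<Sum>b\<in>B. cst (c b) * b) \<in> J" by blast
  note J' = sub_spaceD[OF inv_ideal_sub[OF J(1)]] inv_ideal_mult[OF J(1)]
  obtain m where m: "px ^ m \<in> J"
    using weight_power_mem[OF J(1) B B', of px 3] by (auto simp: cst_simps)
  obtain n where n: "py ^ n \<in> J"
    using weight_power_mem[OF J(1) B B', of py 1] by (auto simp: cst_simps)
  define a where "a = 18 * pw * pz * py - 27 * pw ^ 2 * px - 4 * pz ^ 3"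
  define b where "b = pz ^ 2 * py - 4 * pw * py ^ 2"
  have ab: "disc = px * a + py * b"
    by (simp add: disc_def a_def b_def algebra_simps power2_eq_square power3_eq_cube)
  have dJ: "(disc - cst chi) * p \<in> J" for p using J(2) by (auto simp: disc_ideal_def)
  \<comment> \<open>C acts as \<open>chi\<close> modulo J, so multiplication by C can be
    undone.\<close>
  have unit: "p \<in> J" if "disc * p \<in> J" for p
  proof -
    have "cst chi * p = disc * p - (disc - cst chi) * p" by (simp add: algebra_simps)
    also have "\<dots> \<in> J" by (intro J' that dJ)
    finally show ?thesis using sub_space_cancel[OF inv_ideal_sub[OF J(1)] _ chi] by simp
  qed
  \<comment> \<open>Lowers the exponent of x by one through a descent from y^n to y^0: C times x^i
    y^j is a combination of x^(i+1) and x^i y^(j+1), both already in J.\<close>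
  have "px ^ i \<in> J" if "px ^ Suc i \<in> J" for i
  proof -
    have "px ^ i * py ^ j \<in> J" if "j \<le> n" for j
      using that
    proof (induction j rule: inc_induct)
      case base
      show ?case by (intro J' n)
    next
      case (step j)
      have "disc * (px ^ i * py ^ j) = (a * py ^ j) * px ^ Suc i + b * (px ^ i * py ^ Suc j)"
        unfolding ab by (simp add: algebra_simps)
      also have "\<dots> \<in> J" by (rule J'(2)[OF J'(9)[OF \<open>px ^ Suc i \<in> J\<close>] J'(9)[OF step.IH]])
      finally show ?case by (rule unit)
    qed
    from this[of 0] show ?thesis by simp
  qed
  then have "px ^ 0 \<in> J" using m by (induction m) auto
  then show False using J(3) by simp
qed

section \<open>Decomposition into strings modulo an invariant ideal\<close>

lemma independent_ladders:
  assumes J: "inv_ideal J"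
    and ind: "\<And>n c. (\<Sum>t\<in>{t\<in>T. wt t = n}. cst (c t) * hwt t) \<in> J \<Longrightarrow> \<forall>t\<in>{t\<in>T. wt t = n}. c t = 0"
    and A: "finite A" "A \<subseteq> T" "(\<Sum>t\<in>A. strg_comb t (c t)) \<in> J"
  shows "\<forall>t\<in>A. \<forall>i\<le>wt t. c t i = 0"
proof -
  note J' = sub_spaceD[OF inv_ideal_sub[OF J]] inv_idealD(2-5)[OF J]
  let ?S = "\<lambda>n. {t\<in>A. wt t = n}"
  have fin: "finite (?S n)" for n using A(1) by simp
  have wts: "(\<Sum>t\<in>?S n. strg_comb t (c t)) \<in> J" if "n \<in> wt ` A" for n
  proof -
    \<comment> \<open>The Casimir operator separates the weights of the strings, as n (n + 2) = (n +
      1)^2 - 1 is injective in n.\<close>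
    have 1: "\<forall>n\<in>wt ` A. (\<Sum>t\<in>?S n. strg_comb t (c t)) \<in> J"
    proof (rule eigenvector_components[where D = casimir and l = "\<lambda>n. of_nat (n * (n + 2))"])
      show "casimir p \<in> J" if "p \<in> J" for p unfolding casimir_def by (intro J' that)
      show "inj_on (\<lambda>n. of_nat (n * (n + 2)) :: complex) (wt ` A)"
      proof (rule inj_onI)
        fix m n :: nat assume "of_nat (m * (m + 2)) = (of_nat (n * (n + 2)) :: complex)"
        then have "m * (m + 2) = n * (n + 2)" unfolding of_nat_eq_iff .
        then have "(m + 1) * (m + 1) = (n + 1) * (n + 1)" by simp
        then have "(m + 1)^2 = (n + 1)^2" by (simp only: power2_eq_square)
        then show "m = n" by simp
      qed
      show "(\<Sum>n\<in>wt ` A. \<Sum>t\<in>?S n. strg_comb t (c t)) \<in> J"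
        unfolding sum.group[OF A(1) finite_imageI[OF A(1)] order_refl] by (rule A(3))
      fix n assume "n \<in> wt ` A"
      have cs: "casimir (sum f C) = (\<Sum>t\<in>C. casimir (f t))" for f and C :: "(nat \<times> nat \<times> nat) set"
        by (induction C rule: infinite_finite_induct) (simp_all add: casimir_simps)
      show "casimir (\<Sum>t\<in>?S n. strg_comb t (c t)) = cst (of_nat (n * (n + 2))) * (\<Sum>t\<in>?S n. strg_comb t (c t))"
        unfolding cs sum_distrib_left
      proof (rule sum.cong)
        fix t assume "t \<in> ?S n"
        then show "casimir (strg_comb t (c t)) = cst (of_nat (n * (n + 2))) * strg_comb t (c t)"
          using casimir_ladder[of "strg_comb t (c t)" t] by (simp add: ladder_def)
      qed simp
    qed (use A(1) J'(1) inv_ideal_sub[OF J] in \<open>simp_all add: casimir_simps\<close>)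
    show ?thesis by (rule bspec[OF 1 that])
  qed
  show ?thesis
  proof (intro ballI allI impI)
    fix t i assume t: "t \<in> A" "i \<le> wt t"
    define n where "n = wt t"
    define g where "g i = (\<Sum>t\<in>?S n. cst (c t i) * strg t i)" for i
    have "(\<Sum>i\<le>n. g i) = (\<Sum>t\<in>?S n. \<Sum>i\<le>n. cst (c t i) * strg t i)"
      unfolding g_def by (rule sum.swap)
    also have "\<dots> = (\<Sum>t\<in>?S n. strg_comb t (c t))"
      by (rule sum.cong) (auto simp: strg_comb_def)
    finally have sum: "(\<Sum>i\<le>n. g i) \<in> J" using wts[of n] t(1) by (auto simp: n_def)
    \<comment> \<open>Within one weight, H separates the positions in the strings.\<close>
    have "\<forall>i\<in>{..n}. g i \<in> J"
    proof (rule eigenvector_components[where D = opH and l = "\<lambda>i. of_nat n - 2 * of_nat i"])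
      fix i assume "i \<in> {..n}"
      show "opH (g i) = cst (of_nat n - 2 * of_nat i) * g i"
        unfolding g_def derivation_sum[OF derivation_H] op_cst_mult sum_distrib_left
        by (rule sum.cong) (auto simp: H_strg mult.left_commute)
    qed (use sum J' inv_ideal_sub[OF J] in \<open>auto simp: H_simps(1,3) inj_on_def\<close>)
    then have gi: "g i \<in> J" using t(2) by (simp add: n_def)
    \<comment> \<open>E^i brings all i-th string vectors back to the top, where \<open>ind\<close>
      applies.\<close>
    have Eit: "(opE ^^ i) p \<in> J" if "p \<in> J" for p i by (induction i) (simp_all add: that J')
    have "\<exists>k. k \<noteq> 0 \<and> (opE ^^ i) (strg s i) = cst k * hwt s" if "s \<in> ?S n" for s
      using E_iterate_strg[of i s] t(2) that by (simp add: n_def)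
    then have "\<forall>s\<in>?S n. \<exists>k. k \<noteq> 0 \<and> (opE ^^ i) (strg s i) = cst k * hwt s" by blast
    from bchoice[OF this] obtain k where k: "\<And>s. s \<in> ?S n \<Longrightarrow> k s \<noteq> 0 \<and> (opE ^^ i) (strg s i) = cst (k s) * hwt s"
      by blast
    have "(opE ^^ i) (g i) = (\<Sum>s\<in>?S n. cst (c s i * k s) * hwt s)"
      unfolding g_def iterate_sum iterate_scale by (rule sum.cong) (use k in \<open>auto simp: cst_simps\<close>)
    \<comment> \<open>\<open>ind\<close> sums over all of T in weight n, so coefficients outside A
      are set to 0.\<close>
    also have "\<dots> = (\<Sum>s\<in>{s\<in>T. wt s = n}. cst (if s \<in> A then c s i * k s else 0) * hwt s)"
      by (rule sum.mono_neutral_cong_left) (use A(2) finite_subset[OF _ finite_wt[of n]] in \<open>auto simp: cst_simps\<close>)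
    finally have e: "(opE ^^ i) (g i) = (\<Sum>s\<in>{s\<in>T. wt s = n}. cst (if s \<in> A then c s i * k s else 0) * hwt s)" .
    have "(\<Sum>s\<in>{s\<in>T. wt s = n}. cst (if s \<in> A then c s i * k s else 0) * hwt s) \<in> J"
      using Eit[OF gi, of i] unfolding e .
    from ind[OF this] have "(if t \<in> A then c t i * k t else 0) = 0"
      by (rule bspec) (use t(1) A(2) in \<open>auto simp: n_def\<close>)
    then show "c t i = 0" using k[of t] t(1) by (auto simp: n_def)
  qed
qed

text \<open>T collects, weight by weight, a subset of the finitely many monomials that is a basis of
  their span modulo J. Since J is stable under F, a relation at the top of the strings holds at
  every position, so the chosen strings still span.\<close>

lemma strg_decomposition:
  assumes J: "inv_ideal J" "disc_ideal chi \<subseteq> J"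
  shows "\<exists>T. (\<forall>A c. finite A \<longrightarrow> A \<subseteq> T \<longrightarrow> (\<Sum>t\<in>A. strg_comb t (c t)) \<in> J \<longrightarrow> (\<forall>t\<in>A. \<forall>i\<le>wt t. c t i = 0)) \<and>
    (\<forall>p. \<exists>A c. finite A \<and> A \<subseteq> T \<and> p - (\<Sum>t\<in>A. strg_comb t (c t)) \<in> J)"
proof -
  note J' = sub_spaceD[OF inv_ideal_sub[OF J(1)]] inv_idealD(2-5)[OF J(1)]
  define good where "good n B \<longleftrightarrow> B \<subseteq> {t. wt t = n} \<and>
      (\<forall>c. (\<Sum>t\<in>B. cst (c t) * hwt t) \<in> J \<longrightarrow> (\<forall>t\<in>B. c t = 0)) \<and>
      (\<forall>a\<in>{t. wt t = n}. \<exists>c. hwt a - (\<Sum>t\<in>B. cst (c t) * hwt t) \<in> J)" for n B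
  have "\<forall>n. \<exists>B. good n B"
  proof
    fix n
    obtain B where "B \<subseteq> {t. wt t = n}" "\<forall>c. (\<Sum>t\<in>B. cst (c t) * hwt t) \<in> J \<longrightarrow> (\<forall>t\<in>B. c t = 0)"
        "(\<forall>a\<in>{t. wt t = n}. \<exists>c. hwt a - (\<Sum>t\<in>B. cst (c t) * hwt t) \<in> J)"
      using independent_modulo[OF inv_ideal_sub[OF J(1)] finite_wt, of n hwt] by (elim exE conjE) (rule that)
    then have "good n B" unfolding good_def by (intro conjI)
    then show "\<exists>B. good n B" ..
  qed
  then obtain B where good: "\<And>n. good n (B n)" using choice[of good] by blast
  have B: "B n \<subseteq> {t. wt t = n}" "(\<Sum>t\<in>B n. cst (c t) * hwt t) \<in> J \<Longrightarrow> \<forall>t\<in>B n. c t = 0"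
    "wt t = n \<Longrightarrow> \<exists>c. hwt t - (\<Sum>t\<in>B n. cst (c t) * hwt t) \<in> J" for n c t
    using good[of n] unfolding good_def by (simp_all del: split_paired_All)
  define T where "T = (\<Union>n. B n)"
  have Tn: "{t\<in>T. wt t = n} = B n" for n using B(1) by (auto simp: T_def)
  have finB: "finite (B n)" for n using finite_subset[OF B(1) finite_wt] .
  define W where "W = {p. \<exists>A c. finite A \<and> A \<subseteq> T \<and> p - (\<Sum>t\<in>A. strg_comb t (c t)) \<in> J}"
  have WI: "p \<in> W" if "finite A" "A \<subseteq> T" "p - (\<Sum>t\<in>A. strg_comb t (c t)) \<in> J" for p A c
    unfolding W_def by (intro CollectI exI conjI) (fact that)+
  have extend: "(\<Sum>t\<in>A. strg_comb t (c t)) = (\<Sum>t\<in>A'. strg_comb t (if t \<in> A then c t else (\<lambda>_. 0)))"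
    if "finite A'" "A \<subseteq> A'" for A A' c
    by (rule sum.mono_neutral_cong_left) (use that in \<open>auto simp: strg_comb_linear\<close>)
  have W_add: "p + q \<in> W" if p: "p \<in> W" and q: "q \<in> W" for p q
  proof -
    obtain A c A' c' where A: "finite A" "A \<subseteq> T" "p - (\<Sum>t\<in>A. strg_comb t (c t)) \<in> J"
      and A': "finite A'" "A' \<subseteq> T" "q - (\<Sum>t\<in>A'. strg_comb t (c' t)) \<in> J" using p q unfolding W_def by blast
    have fin: "finite (A \<union> A')" using A A' by simp
    have "(p - (\<Sum>t\<in>A. strg_comb t (c t))) + (q - (\<Sum>t\<in>A'. strg_comb t (c' t))) \<in> J"
      by (rule J'(2)[OF A(3) A'(3)])
    also have "(p - (\<Sum>t\<in>A. strg_comb t (c t))) + (q - (\<Sum>t\<in>A'. strg_comb t (c' t))) =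
       (p + q) - (\<Sum>t\<in>A \<union> A'. strg_comb t (\<lambda>i. (if t \<in> A then c t else (\<lambda>_. 0)) i + (if t \<in> A' then c' t else (\<lambda>_. 0)) i))"
      unfolding strg_comb_linear sum.distrib extend[OF fin Un_upper1, symmetric] extend[OF fin Un_upper2, symmetric] by simp
    finally show ?thesis by (rule WI[OF fin Un_least[OF A(2) A'(2)]])
  qed
  have W_J: "p \<in> W" if "p \<in> J" for p using that by (intro WI[of "{}"]) simp_all
  have W_strg: "cst k * strg t i \<in> W" if "t \<in> T" for t i k
  proof -
    obtain d where "cst k * strg t i = strg_comb t d"
      using sub_space_scale[OF sub_space_ladder strg_mem_ladder] unfolding ladder_def by blast
    then show ?thesis using that J'(1) by (intro WI[of "{t}" _ "\<lambda>_. d"]) simp_all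
  qed
  have W_sum: "(\<And>t. t \<in> A \<Longrightarrow> f t \<in> W) \<Longrightarrow> sum f A \<in> W" for f and A :: "(nat \<times> nat \<times> nat) set"
    by (induction A rule: infinite_finite_induct) (auto intro: W_add W_J J'(1))
  have "p \<in> W" for p
    using hw_span_UNIV[of p chi]
  proof (induction p rule: hw_span.induct)
    case (base p)
    then show ?case using J(2) by (intro W_J) (auto simp: disc_ideal_def)
  next
    case (step q a b c k i)
    define n where "n = wt (a, b, c)"
    obtain d where d: "hwt (a, b, c) - (\<Sum>t\<in>B n. cst (d t) * hwt t) \<in> J" using B(3) n_def by blast
    have "(opF ^^ i) p \<in> J" if "p \<in> J" for p by (induction i) (simp_all add: that J')
    from this[OF d] have "strg (a, b, c) i - (\<Sum>t\<in>B n. cst (d t) * strg t i) \<in> J"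
      by (simp add: iterate_diff iterate_sum iterate_scale strg_def)
    then have "cst k * (strg (a, b, c) i - (\<Sum>t\<in>B n. cst (d t) * strg t i)) \<in> W" by (rule W_J[OF J'(3)])
    moreover have "(\<Sum>t\<in>B n. cst (k * d t) * strg t i) \<in> W"
      by (intro W_sum W_strg) (auto simp: T_def)
    ultimately have "cst k * (strg (a, b, c) i - (\<Sum>t\<in>B n. cst (d t) * strg t i)) + (\<Sum>t\<in>B n. cst (k * d t) * strg t i) + q \<in> W"
      using step.IH by (intro W_add)
    then show ?case by (simp add: strg_def cst_simps algebra_simps sum_distrib_left)
  qed
  then have span: "\<forall>p. \<exists>A c. finite A \<and> A \<subseteq> T \<and> p - (\<Sum>t\<in>A. strg_comb t (c t)) \<in> J"
    unfolding W_def by blast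
  have ind: "\<forall>t\<in>A. \<forall>i\<le>wt t. c t i = 0" if "finite A" "A \<subseteq> T" "(\<Sum>t\<in>A. strg_comb t (c t)) \<in> J" for A c
    by (rule independent_ladders[OF J(1) _ that]) (unfold Tn, rule B(2))
  show ?thesis by (intro exI[of _ T] conjI span allI impI ind)
qed

section \<open>Quotient modules\<close>

text \<open>Stated for bare vector spaces so that it also covers the enveloping algebra as a
  quotient of the free algebra; \<open>vs_quotient\<close> adds the operators.\<close>

locale vs_coset = Module.module complex_ring M for M :: "(complex, 'b, 'n) module_scheme" and N +
  assumes N: "submodule N complex_ring M"
begin

lemma abelian_subgroup_N: "abelian_subgroup N M"
  using submodule.axioms(1)[OF N] by (intro abelian_subgroupI3 additive_subgroupI abelian_group_axioms)

interpretation N: abelian_subgroup N M by (rule abelian_subgroup_N)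

lemma coset_eq_iff:
  assumes "u \<in> carrier M" "v \<in> carrier M"
  shows "N +>\<^bsub>M\<^esub> u = N +>\<^bsub>M\<^esub> v \<longleftrightarrow> u \<ominus>\<^bsub>M\<^esub> v \<in> N"
proof
  assume "N +>\<^bsub>M\<^esub> u = N +>\<^bsub>M\<^esub> v"
  then have "u \<in> N +>\<^bsub>M\<^esub> v" using N.a_rcos_self[OF assms(1)] by simp
  then show "u \<ominus>\<^bsub>M\<^esub> v \<in> N" unfolding a_minus_def by (rule N.a_rcos_module_imp[OF assms(2)])
next
  assume "u \<ominus>\<^bsub>M\<^esub> v \<in> N"
  then have "u \<in> N +>\<^bsub>M\<^esub> v" unfolding a_minus_def by (rule N.a_rcos_module_rev[OF assms(2,1)])
  then show "N +>\<^bsub>M\<^esub> u = N +>\<^bsub>M\<^esub> v" using N.a_repr_independence'[OF _ assms(2)] by simp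
qed

lemma coset_zero: "N +>\<^bsub>M\<^esub> \<zero>\<^bsub>M\<^esub> = N"
  by (rule N.a_rcos_const) simp

lemma coset_eq_N: "u \<in> carrier M \<Longrightarrow> N +>\<^bsub>M\<^esub> u = N \<longleftrightarrow> u \<in> N"
  using N.a_rcos_self[of u] N.a_rcos_const[of u] by auto

text \<open>Operations on cosets are defined as unions over all representatives; additivity of f and
  stability of N make all members of the union equal.\<close>

lemma Union_coset:
  assumes f: "\<And>u. u \<in> carrier M \<Longrightarrow> f u \<in> carrier M"
    and add: "\<And>u v. u \<in> carrier M \<Longrightarrow> v \<in> carrier M \<Longrightarrow> f (u \<oplus>\<^bsub>M\<^esub> v) = f u \<oplus>\<^bsub>M\<^esub> f v"
    and N: "\<And>u. u \<in> N \<Longrightarrow> f u \<in> N" and u: "u \<in> carrier M"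
  shows "(\<Union>v\<in>N +>\<^bsub>M\<^esub> u. N +>\<^bsub>M\<^esub> f v) = N +>\<^bsub>M\<^esub> f u"
proof -
  have "N +>\<^bsub>M\<^esub> f v = N +>\<^bsub>M\<^esub> f u" if "v \<in> N +>\<^bsub>M\<^esub> u" for v
  proof -
    obtain n where n: "n \<in> N" "v = n \<oplus>\<^bsub>M\<^esub> u" using \<open>v \<in> _\<close> by (auto simp: a_r_coset_def')
    have nM: "n \<in> carrier M" using n(1) N.a_subset by blast
    then have "f v \<ominus>\<^bsub>M\<^esub> f u = f n" using f add u n(2) by (simp add: a_minus_def a_assoc r_neg)
    then show ?thesis using coset_eq_iff[of "f v" "f u"] f N n u nM by simp
  qed
  then show ?thesis using N.a_rcos_self[OF u] by blast
qed

end

locale vs_quotient = vs_coset M N for M :: "('l, 'b, 'n) rep_scheme" and N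
begin

interpretation N: abelian_subgroup N M by (rule abelian_subgroup_N)

lemma carrier_quotient: "carrier (quotient_module M N) = (\<lambda>u. N +>\<^bsub>M\<^esub> u) ` carrier M"
  by (auto simp: quotient_module_def A_RCOSETS_def')

lemma zero_quotient: "zero (quotient_module M N) = N"
  by (simp add: quotient_module_def)

lemma add_quotient:
  "u \<in> carrier M \<Longrightarrow> v \<in> carrier M \<Longrightarrow>
    (N +>\<^bsub>M\<^esub> u) \<oplus>\<^bsub>quotient_module M N\<^esub> (N +>\<^bsub>M\<^esub> v) = N +>\<^bsub>M\<^esub> (u \<oplus>\<^bsub>M\<^esub> v)"
  by (simp add: quotient_module_def N.a_rcos_sum)

lemma smult_quotient:
  "u \<in> carrier M \<Longrightarrow> c \<odot>\<^bsub>quotient_module M N\<^esub> (N +>\<^bsub>M\<^esub> u) = N +>\<^bsub>M\<^esub> (c \<odot>\<^bsub>M\<^esub> u)"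
  unfolding quotient_module_def
  using Union_coset[of "\<lambda>u. c \<odot>\<^bsub>M\<^esub> u" u] submodule.smult_closed[OF N, of c] smult_closed[of c] smult_r_distr[of c]
  by simp

lemma act_quotient:
  assumes "\<And>u. u \<in> carrier M \<Longrightarrow> act M x u \<in> carrier M"
    and "\<And>u v. u \<in> carrier M \<Longrightarrow> v \<in> carrier M \<Longrightarrow> act M x (u \<oplus>\<^bsub>M\<^esub> v) = act M x u \<oplus>\<^bsub>M\<^esub> act M x v"
    and "\<And>u. u \<in> N \<Longrightarrow> act M x u \<in> N" and "u \<in> carrier M"
  shows "act (quotient_module M N) x (N +>\<^bsub>M\<^esub> u) = N +>\<^bsub>M\<^esub> act M x u"
  unfolding quotient_module_def using Union_coset[of "act M x" u, OF assms] by simp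

end

section \<open>Modules that are images of the symmetric algebra\<close>

text \<open>Modules are presented as linear images of polynomials and inherit their laws from them.
  The domain D is the whole ring for modules over L3 and a ladder for their simple
  sl2-components.\<close>

locale quartic_image =
  fixes D :: "quartic_ring set" and \<pi> :: "quartic_ring \<Rightarrow> 'b" and M :: "(complex, 'b, 'n) module_scheme"
  assumes D: "sub_space D" and carrier_image: "carrier M = \<pi> ` D" and zero_image: "zero M = \<pi> 0"
    and add_image: "\<And>p q. p \<in> D \<Longrightarrow> q \<in> D \<Longrightarrow> \<pi> p \<oplus>\<^bsub>M\<^esub> \<pi> q = \<pi> (p + q)"
    and smult_image: "\<And>c p. p \<in> D \<Longrightarrow> c \<odot>\<^bsub>M\<^esub> \<pi> p = \<pi> (cst c * p)"
begin

lemmas D_closed = sub_spaceD[OF D]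

lemma module_image: "Module.module complex_ring M"
proof (intro Module.moduleI complex_ring_cring abelian_groupI)
  fix u assume "u \<in> carrier M"
  then obtain p where p: "p \<in> D" "u = \<pi> p" by (auto simp: carrier_image)
  then show "\<exists>v\<in>carrier M. v \<oplus>\<^bsub>M\<^esub> u = \<zero>\<^bsub>M\<^esub>"
    using D_closed by (intro bexI[of _ "\<pi> (- p)"]) (simp_all add: carrier_image zero_image add_image)
qed (auto simp: carrier_image zero_image add_image smult_image D_closed cst_simps distrib_left distrib_right mult.assoc add_ac)

sublocale Module.module complex_ring M by (rule module_image)

lemma image_closed: "p \<in> D \<Longrightarrow> \<pi> p \<in> carrier M"
  by (simp add: carrier_image)

lemma minus_image: "p \<in> D \<Longrightarrow> q \<in> D \<Longrightarrow> \<pi> p \<ominus>\<^bsub>M\<^esub> \<pi> q = \<pi> (p - q)"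
proof -
  assume pq: "p \<in> D" "q \<in> D"
  then have "\<ominus>\<^bsub>M\<^esub> \<pi> q = \<pi> (- q)"
    by (intro minus_equality) (simp_all add: carrier_image zero_image add_image D_closed)
  with pq show ?thesis by (simp add: a_minus_def add_image D_closed)
qed

lemma image_eq_iff: "p \<in> D \<Longrightarrow> q \<in> D \<Longrightarrow> \<pi> p = \<pi> q \<longleftrightarrow> \<pi> (p - q) = \<zero>\<^bsub>M\<^esub>"
proof
  assume pq: "p \<in> D" "q \<in> D" and "\<pi> p = \<pi> q"
  then show "\<pi> (p - q) = \<zero>\<^bsub>M\<^esub>" using minus_image[of p q] by (simp add: a_minus_def r_neg image_closed)
next
  assume pq: "p \<in> D" "q \<in> D" and "\<pi> (p - q) = \<zero>\<^bsub>M\<^esub>"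
  then show "\<pi> p = \<pi> q" using add_image[of "p - q" q] by (simp add: D_closed image_closed)
qed

lemma finsum_image: "g ` A \<subseteq> D \<Longrightarrow> finite A \<Longrightarrow> (\<Oplus>\<^bsub>M\<^esub>a\<in>A. \<pi> (g a)) = \<pi> (\<Sum>a\<in>A. g a)"
proof (induction A rule: infinite_finite_induct)
  case (insert a A)
  then have "(\<lambda>a. \<pi> (g a)) \<in> A \<rightarrow> carrier M" by (auto simp: carrier_image)
  with insert show ?case by (simp add: finsum_insert image_closed add_image D_closed image_subset_iff)
qed (simp_all add: zero_image)

end

section \<open>The action of the semidirect product on polynomials\<close>

definition lin_form :: "(nat \<Rightarrow> complex) \<Rightarrow> quartic_ring" where
  "lin_form u = cst (u 0) * pw + cst (u 1) * pz + cst (u 2) * py + cst (u 3) * px"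

text \<open>A traceless X equals X11 h + X12 e + X21 f.\<close>

definition mat_op :: "mat2 \<Rightarrow> quartic_ring \<Rightarrow> quartic_ring" where
  "mat_op X p = cst (X$1$1) * opH p + cst (X$1$2) * opE p + cst (X$2$1) * opF p"

definition quartic_act :: "L3_elem \<Rightarrow> quartic_ring \<Rightarrow> quartic_ring" where
  "quartic_act x p = mat_op (fst x) p + lin_form (snd x) * p"

lemma mat_op_basis: "mat_op sl2_e p = opE p" "mat_op sl2_f p = opF p" "mat_op sl2_h p = opH p" "mat_op 0 p = 0"
  by (simp_all add: mat_op_def sl2_e_def sl2_f_def sl2_h_def cst_simps)

lemma L3_ops:
  "carrier L3 = {X. trace X = 0} \<times> {u. \<forall>k>3. u k = 0}"
  "add L3 x y = (fst x + fst y, \<lambda>k. snd x k + snd y k)"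
  "c \<odot>\<^bsub>L3\<^esub> x = (\<chi> i j. c * fst x $ i $ j, \<lambda>k. c * snd x k)"
  by (simp_all add: L3_def semidirect_def sl2_simps simple_sl2_simps split_def)

lemma quartic_act_simps:
  "quartic_act x (p + q) = quartic_act x p + quartic_act x q"
  "quartic_act x (cst c * p) = cst c * quartic_act x p"
  "quartic_act (x \<oplus>\<^bsub>L3\<^esub> y) p = quartic_act x p + quartic_act y p"
  "quartic_act (c \<odot>\<^bsub>L3\<^esub> x) p = cst c * quartic_act x p"
  "quartic_act x 0 = 0"
  by (simp_all add: quartic_act_def mat_op_def lin_form_def L3_ops E_simps F_simps H_simps cst_simps algebra_simps)

lemma quartic_act_sl2_incl: "quartic_act (sl2_incl X) p = mat_op X p"
  by (simp add: quartic_act_def sl2_incl_def lin_form_def cst_simps)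

lemma quartic_act_rad_vec:
  "quartic_act (rad_vec 0) p = pw * p" "quartic_act (rad_vec 1) p = pz * p"
  "quartic_act (rad_vec 2) p = py * p" "quartic_act (rad_vec 3) p = px * p"
  by (simp_all add: quartic_act_def rad_vec_def mat_op_basis lin_form_def delta_def cst_simps)

lemma mat_op_bracket:
  assumes "X \<in> carrier sl2" "Y \<in> carrier sl2"
  shows "mat_op (bracket sl2 X Y) p = mat_op X (mat_op Y p) - mat_op Y (mat_op X p)"
proof -
  have t: "X$2$2 = - X$1$1" "Y$2$2 = - Y$1$1"
    using assms by (auto simp: sl2_simps trace_def sum_2 add_eq_0_iff)
  show ?thesis
    by (simp add: sl2_simps mat_op_def matrix_matrix_mult_def sum_2 t E_simps F_simps H_simps EF_commutator
        HE_commutator HF_commutator cst_simps algebra_simps)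
qed

text \<open>The sl2 part is \<open>mat_op_bracket\<close>. For mixed brackets, the commutator of a
  derivation with multiplication by q is multiplication by its value at q, and
  \<open>lin_form\<close> intertwines the action on the radical with \<open>mat_op\<close>.
  Multiplications commute, as radical elements do.\<close>

lemma quartic_act_bracket:
  assumes "x \<in> carrier L3" "y \<in> carrier L3"
  shows "quartic_act (bracket L3 x y) p = quartic_act x (quartic_act y p) - quartic_act y (quartic_act x p)"
proof -
  obtain X u Y v where xy: "x = (X, u)" "y = (Y, v)" by (cases x; cases y)
  have uv: "u \<in> carrier (simple_sl2 3)" "v \<in> carrier (simple_sl2 3)"
    using assms by (auto simp: xy L3_ops simple_sl2_simps)
  have add: "mat_op X (p + q) = mat_op X p + mat_op X q" for X p q
    by (simp add: mat_op_def E_simps F_simps H_simps algebra_simps)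
  have leibniz: "mat_op X (p * q) = mat_op X p * q + p * mat_op X q" for X p q
    by (simp add: mat_op_def E_simps F_simps H_simps algebra_simps)
  have lin: "lin_form (\<lambda>k. act (simple_sl2 3) X v k - act (simple_sl2 3) Y u k)
     = mat_op X (lin_form v) - mat_op Y (lin_form u)" 
    by (simp add: lin_form_def mat_op_def simple_sl2_def E_simps F_simps H_simps cst_simps algebra_simps
        numeral_2_eq_2[symmetric])
  have mat: "mat_op (X ** Y - Y ** X) p = mat_op X (mat_op Y p) - mat_op Y (mat_op X p)"
    using mat_op_bracket[of X Y p] assms by (auto simp: xy L3_ops sl2_simps)
  show ?thesis
    unfolding xy bracket_L3[OF uv] quartic_act_def fst_conv snd_conv lin sl2_simps mat add leibniz
    by (simp add: algebra_simps)
qed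

lemma inv_ideal_iff_act:
  "inv_ideal J \<longleftrightarrow> sub_space J \<and> (\<forall>x\<in>carrier L3. \<forall>p\<in>J. quartic_act x p \<in> J)"
proof safe
  assume J: "inv_ideal J"
  note J' = inv_idealD[OF J] sub_spaceD[OF inv_ideal_sub[OF J]]
  show "sub_space J" by (rule J')
  fix x p assume "p \<in> J"
  then show "quartic_act x p \<in> J"
    unfolding quartic_act_def mat_op_def by (simp add: J')
next
  assume J: "sub_space J" "\<forall>x\<in>carrier L3. \<forall>p\<in>J. quartic_act x p \<in> J"
  have mem: "sl2_incl sl2_e \<in> carrier L3" "sl2_incl sl2_f \<in> carrier L3" "sl2_incl sl2_h \<in> carrier L3"
    "rad_vec 0 \<in> carrier L3" "rad_vec 1 \<in> carrier L3" "rad_vec 2 \<in> carrier L3" "rad_vec 3 \<in> carrier L3"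
    by (auto simp: L3_ops sl2_incl_def rad_vec_def delta_def trace_def sum_2 sl2_e_def sl2_f_def sl2_h_def)
  from J(2) mem have "\<forall>p\<in>J. quartic_act (sl2_incl sl2_e) p \<in> J \<and> quartic_act (sl2_incl sl2_f) p \<in> J \<and>
      quartic_act (sl2_incl sl2_h) p \<in> J \<and> quartic_act (rad_vec 0) p \<in> J \<and> quartic_act (rad_vec 1) p \<in> J \<and>
      quartic_act (rad_vec 2) p \<in> J \<and> quartic_act (rad_vec 3) p \<in> J" by blast
  then show "inv_ideal J"
    unfolding quartic_act_sl2_incl quartic_act_rad_vec mat_op_basis inv_ideal_def sl2_stable_def
    using J(1) by blast
qed

section \<open>Quotients of the polynomial module and their submodules\<close>

locale quartic_rep = quartic_image UNIV \<pi> M for \<pi> and M :: "(L3_elem, 'b, 'n) rep_scheme" +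
  assumes act_image: "x \<in> carrier L3 \<Longrightarrow> act M x (\<pi> p) = \<pi> (quartic_act x p)"
begin

definition ker :: "quartic_ring set" where "ker = {p. \<pi> p = \<zero>\<^bsub>M\<^esub>}"

lemma image_eq_ker: "\<pi> p = \<pi> q \<longleftrightarrow> p - q \<in> ker"
  by (simp add: ker_def image_eq_iff)

lemma lie_module_image: "lie_module L3 M"
proof (intro lie_module.intro lie_algebra_L3 module_image lie_module_axioms.intro)
  fix x y u assume "x \<in> carrier L3" "y \<in> carrier L3" "u \<in> carrier M"
  moreover have "bracket L3 x y \<in> carrier L3"
    using calculation lie_algebra.bracket_closed[OF lie_algebra_L3] by blast
  ultimately show "act M (bracket L3 x y) u = act M x (act M y u) \<ominus>\<^bsub>M\<^esub> act M y (act M x u)"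
    by (auto simp: carrier_image act_image minus_image quartic_act_bracket)
next
  interpret L: lie_algebra L3 by (rule lie_algebra_L3)
  show "act M (x \<oplus>\<^bsub>L3\<^esub> y) u = act M x u \<oplus>\<^bsub>M\<^esub> act M y u"
    if "x \<in> carrier L3" "y \<in> carrier L3" "u \<in> carrier M" for x y u
    using that L.a_closed[OF that(1,2)] by (auto simp: carrier_image act_image add_image quartic_act_simps)
  show "act M (c \<odot>\<^bsub>L3\<^esub> x) u = c \<odot>\<^bsub>M\<^esub> act M x u" if "x \<in> carrier L3" "u \<in> carrier M" for c x u
    using that L.smult_closed[of c x] by (auto simp: carrier_image act_image smult_image quartic_act_simps)
qed (auto simp: carrier_image act_image add_image smult_image quartic_act_simps)

lemma submodule_preimage:
  assumes "submodule N complex_ring M"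
  shows "sub_space (\<pi> -` N)" "\<pi> ` (\<pi> -` N) = N"
proof -
  note N = submoduleE[OF assms]
  have "\<pi> 0 \<in> N" using assms subgroup.one_closed[OF submodule.axioms(1)[OF assms]] by (simp add: zero_image)
  moreover have "\<pi> (p + q) \<in> N" if "\<pi> p \<in> N" "\<pi> q \<in> N" for p q
    using N(5)[OF that] by (simp add: add_image)
  moreover have "\<pi> (cst c * p) \<in> N" if "\<pi> p \<in> N" for c p
    using N(4)[OF _ that, of c] by (simp add: smult_image)
  ultimately show "sub_space (\<pi> -` N)" by (simp add: sub_space_def)
  show "\<pi> ` (\<pi> -` N) = N" using N(1) by (auto simp: carrier_image)
qed

lemma submodule_image: "sub_space S \<Longrightarrow> submodule (\<pi> ` S) complex_ring M"
proof (rule submoduleI)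
  assume S: "sub_space S"
  note S' = sub_spaceD[OF S]
  have minus: "\<ominus>\<^bsub>M\<^esub> \<pi> q = \<pi> (- q)" for q
    by (intro minus_equality) (simp_all add: carrier_image zero_image add_image)
  show "\<And>a. a \<in> \<pi> ` S \<Longrightarrow> \<ominus>\<^bsub>M\<^esub> a \<in> \<pi> ` S" by (auto simp: minus S')
qed (auto simp: carrier_image zero_image add_image smult_image sub_space_0 sub_space_add sub_space_scale)

lemma preimage_image: "sub_space S \<Longrightarrow> ker \<subseteq> S \<Longrightarrow> \<pi> -` (\<pi> ` S) = S"
proof (intro equalityI subsetI)
  fix p assume S: "sub_space S" "ker \<subseteq> S" "p \<in> \<pi> -` (\<pi> ` S)"
  then obtain q where q: "q \<in> S" "\<pi> p = \<pi> q" by auto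
  then have "(p - q) + q \<in> S" using S by (intro sub_space_add) (auto simp: image_eq_ker)
  then show "p \<in> S" by simp
qed auto

lemma lie_submodule_preimage: "lie_submodule L3 M N \<Longrightarrow> inv_ideal (\<pi> -` N)"
  unfolding inv_ideal_iff_act lie_submodule_def using submodule_preimage(1)
  by (auto simp: act_image[symmetric])

lemma lie_submodule_image: "inv_ideal J \<Longrightarrow> lie_submodule L3 M (\<pi> ` J)"
  unfolding inv_ideal_iff_act lie_submodule_def using submodule_image by (auto simp: act_image)

lemma ker_subset_preimage: "lie_submodule L3 M N \<Longrightarrow> ker \<subseteq> \<pi> -` N"
  using submodule_preimage(1)[of N] sub_space_0 by (fastforce simp: lie_submodule_def ker_def zero_image)

lemma lie_submodule_zero: "lie_submodule L3 M {\<zero>\<^bsub>M\<^esub>}"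
proof -
  have "inv_ideal {0}" by (auto simp: inv_ideal_iff_act sub_space_def quartic_act_simps)
  from lie_submodule_image[OF this] show ?thesis by (simp add: zero_image)
qed

lemma inv_ideal_ker: "inv_ideal ker"
  using lie_submodule_preimage[OF lie_submodule_zero] by (simp add: ker_def vimage_def)

text \<open>Closure under quotients puts Q(0), Q(0, chi) and V(0, chi) into the same locale, with
  kernels computed as preimages.\<close>

lemma quartic_rep_quotient:
  assumes N: "lie_submodule L3 M N"
  shows "quartic_rep (\<lambda>p. N +>\<^bsub>M\<^esub> \<pi> p) (quotient_module M N)"
    and "N +>\<^bsub>M\<^esub> \<pi> p = \<zero>\<^bsub>quotient_module M N\<^esub> \<longleftrightarrow> p \<in> \<pi> -` N"
proof -
  interpret lie_module L3 M by (rule lie_module_image)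
  interpret N: vs_quotient M N
    using N by (intro vs_quotient.intro vs_coset.intro vs_coset_axioms.intro module_image) (simp add: lie_submodule_def)
  show "N +>\<^bsub>M\<^esub> \<pi> p = \<zero>\<^bsub>quotient_module M N\<^esub> \<longleftrightarrow> p \<in> \<pi> -` N"
    by (simp add: N.zero_quotient N.coset_eq_N image_closed)
  show "quartic_rep (\<lambda>p. N +>\<^bsub>M\<^esub> \<pi> p) (quotient_module M N)"
  proof (intro quartic_rep.intro quartic_image.intro quartic_rep_axioms.intro D)
    fix x p assume x: "x \<in> carrier L3"
    have "act (quotient_module M N) x (N +>\<^bsub>M\<^esub> \<pi> p) = N +>\<^bsub>M\<^esub> act M x (\<pi> p)"
      by (rule N.act_quotient) (use N x in \<open>auto simp: act_closed act_add_right image_closed lie_submodule_def\<close>)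
    then show "act (quotient_module M N) x (N +>\<^bsub>M\<^esub> \<pi> p) = N +>\<^bsub>M\<^esub> \<pi> (quartic_act x p)"
      by (simp add: act_image x)
  qed (auto simp: N.carrier_quotient N.zero_quotient N.add_quotient N.smult_quotient N.coset_zero image_closed
      carrier_image zero_image[symmetric] add_image smult_image)
qed

lemma simple_lie_module_iff:
  "simple_lie_module L3 M \<longleftrightarrow> 1 \<notin> ker \<and> (\<forall>J. inv_ideal J \<and> ker \<subseteq> J \<longrightarrow> J = ker \<or> J = UNIV)"
proof -
  have zero: "carrier M = {\<zero>\<^bsub>M\<^esub>} \<longleftrightarrow> 1 \<in> ker"
  proof
    assume "1 \<in> ker"
    then have "ker = UNIV" by (rule inv_ideal_eq_UNIV[OF inv_ideal_ker])
    then show "carrier M = {\<zero>\<^bsub>M\<^esub>}" by (auto simp: carrier_image ker_def zero_image)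
  qed (auto simp: carrier_image ker_def)
  have pre0: "\<pi> -` {\<zero>\<^bsub>M\<^esub>} = ker" by (auto simp: ker_def)
  have "(\<forall>N. lie_submodule L3 M N \<longrightarrow> N = {\<zero>\<^bsub>M\<^esub>} \<or> N = carrier M) \<longleftrightarrow>
    (\<forall>J. inv_ideal J \<and> ker \<subseteq> J \<longrightarrow> J = ker \<or> J = UNIV)"
  proof (intro iffI allI impI)
    fix J assume N: "\<forall>N. lie_submodule L3 M N \<longrightarrow> N = {\<zero>\<^bsub>M\<^esub>} \<or> N = carrier M" and J: "inv_ideal J \<and> ker \<subseteq> J"
    have J': "\<pi> -` (\<pi> ` J) = J" using J inv_ideal_sub by (intro preimage_image) auto
    from N J have "\<pi> ` J = {\<zero>\<^bsub>M\<^esub>} \<or> \<pi> ` J = carrier M" using lie_submodule_image by blast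
    then have "\<pi> -` (\<pi> ` J) = \<pi> -` {\<zero>\<^bsub>M\<^esub>} \<or> \<pi> -` (\<pi> ` J) = \<pi> -` carrier M" by auto
    then show "J = ker \<or> J = UNIV" unfolding J' pre0 by (auto simp: carrier_image)
  next
    fix N assume J: "\<forall>J. inv_ideal J \<and> ker \<subseteq> J \<longrightarrow> J = ker \<or> J = UNIV" and N: "lie_submodule L3 M N"
    from J lie_submodule_preimage[OF N] ker_subset_preimage[OF N] have "\<pi> -` N = ker \<or> \<pi> -` N = UNIV" by blast
    then have "\<pi> ` (\<pi> -` N) = \<pi> ` ker \<or> \<pi> ` (\<pi> -` N) = range \<pi>" by auto
    moreover have "\<pi> ` ker = {\<zero>\<^bsub>M\<^esub>}" by (auto simp: ker_def zero_image)
    ultimately show "N = {\<zero>\<^bsub>M\<^esub>} \<or> N = carrier M"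
      using N submodule_preimage(2)[of N] by (auto simp: carrier_image lie_submodule_def)
  qed
  then show ?thesis unfolding simple_lie_module_def using lie_module_image zero by blast
qed

text \<open>A kernel with simple quotient pulls back to a maximal proper invariant ideal containing
  C - \<open>chi\<close>; this lies in \<open>max_ideal\<close> and therefore equals it.\<close>

lemma simple_quotient_kernel_iff:
  assumes "disc_ideal chi \<subseteq> ker" "1 \<notin> ker"
  shows "simple_quotient_kernel L3 M N \<longleftrightarrow> N = \<pi> ` max_ideal chi"
proof -
  have ker: "ker \<subseteq> max_ideal chi" using assms by (intro max_ideal_greatest inv_ideal_ker)
  have pre: "\<pi> -` (\<pi> ` max_ideal chi) = max_ideal chi"
    by (rule preimage_image[OF inv_ideal_sub[OF inv_ideal_max_ideal] ker])
  have simple: "simple_lie_module L3 (quotient_module M N) \<longleftrightarrow>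
      1 \<notin> \<pi> -` N \<and> (\<forall>J. inv_ideal J \<and> \<pi> -` N \<subseteq> J \<longrightarrow> J = \<pi> -` N \<or> J = UNIV)"
    if N: "lie_submodule L3 M N" for N
  proof -
    interpret Q: quartic_rep "\<lambda>p. N +>\<^bsub>M\<^esub> \<pi> p" "quotient_module M N"
      by (rule quartic_rep_quotient(1)[OF N])
    have "Q.ker = \<pi> -` N" unfolding Q.ker_def quartic_rep_quotient(2)[OF N] by auto
    then show ?thesis using Q.simple_lie_module_iff by simp
  qed
  show ?thesis
  proof
    assume "simple_quotient_kernel L3 M N"
    then have sub: "lie_submodule L3 M N" and "simple_lie_module L3 (quotient_module M N)"
      by (simp_all add: simple_quotient_kernel_def)
    with simple[OF sub] have N: "lie_submodule L3 M N" "1 \<notin> \<pi> -` N"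
        "\<And>J. inv_ideal J \<Longrightarrow> \<pi> -` N \<subseteq> J \<Longrightarrow> J = \<pi> -` N \<or> J = UNIV" by blast+
    have "\<pi> -` N \<subseteq> max_ideal chi"
      using N assms(1) ker_subset_preimage[OF N(1)] by (intro max_ideal_greatest lie_submodule_preimage) auto
    then have "max_ideal chi = \<pi> -` N"
      using N(3)[OF inv_ideal_max_ideal[of chi]] one_notin_max_ideal[of chi] by auto
    then show "N = \<pi> ` max_ideal chi" using submodule_preimage(2)[of N] N(1) by (simp add: lie_submodule_def)
  next
    assume N: "N = \<pi> ` max_ideal chi"
    have sub: "lie_submodule L3 M N" unfolding N by (rule lie_submodule_image[OF inv_ideal_max_ideal])
    have "J = max_ideal chi \<or> J = UNIV" if "inv_ideal J" "max_ideal chi \<subseteq> J" for J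
      using max_ideal_greatest[OF that(1), of chi] that disc_ideal_subset_max[of chi] inv_ideal_eq_UNIV[OF that(1)]
      by blast
    then have "simple_lie_module L3 (quotient_module M N)"
      unfolding simple[OF sub] unfolding N pre using one_notin_max_ideal by blast
    with sub show "simple_quotient_kernel L3 M N" by (simp add: simple_quotient_kernel_def)
  qed
qed

end

section \<open>Harish-Chandra decomposition\<close>

lemma pullback_simps [simp]:
  "carrier (pullback_module \<phi> M) = carrier M" "zero (pullback_module \<phi> M) = zero M"
  "add (pullback_module \<phi> M) = add M" "module.smult (pullback_module \<phi> M) = module.smult M"
  "act (pullback_module \<phi> M) x = act M (\<phi> x)"
  by (simp_all add: pullback_module_def)

lemma sl2_incl_closed: "X \<in> carrier sl2 \<Longrightarrow> sl2_incl X \<in> carrier L3"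
  by (simp add: L3_ops sl2_simps sl2_incl_def)

lemma sl2_basis_closed: "sl2_e \<in> carrier sl2" "sl2_f \<in> carrier sl2" "sl2_h \<in> carrier sl2"
  by (simp_all add: sl2_simps trace_def sum_2 sl2_e_def sl2_f_def sl2_h_def)

lemma mat_op_stable: "sl2_stable N \<Longrightarrow> p \<in> N \<Longrightarrow> mat_op X p \<in> N"
  unfolding mat_op_def sl2_stable_def by (auto intro!: sub_space_add sub_space_scale)

lemma mat_op_simps:
  "mat_op X (p + q) = mat_op X p + mat_op X q" "mat_op X (cst c * p) = cst c * mat_op X p"
  "mat_op (X \<oplus>\<^bsub>sl2\<^esub> Y) p = mat_op X p + mat_op Y p" "mat_op (c \<odot>\<^bsub>sl2\<^esub> X) p = cst c * mat_op X p"
  by (simp_all add: mat_op_def sl2_simps E_simps F_simps H_simps cst_simps algebra_simps)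

context quartic_rep
begin

abbreviation res :: "(mat2, 'b) rep" where "res \<equiv> pullback_module sl2_incl M"

lemma act_res: "X \<in> carrier sl2 \<Longrightarrow> act M (sl2_incl X) (\<pi> p) = \<pi> (mat_op X p)"
  by (simp add: act_image sl2_incl_closed quartic_act_sl2_incl)

lemma quartic_image_res: "sub_space D \<Longrightarrow> quartic_image D \<pi> (res\<lparr>carrier := \<pi> ` D\<rparr>)"
  by unfold_locales (simp_all add: zero_image add_image smult_image)

lemma lie_module_res:
  assumes D: "sl2_stable D"
  shows "lie_module sl2 (res\<lparr>carrier := \<pi> ` D\<rparr>)"
proof -
  interpret I: quartic_image D \<pi> "res\<lparr>carrier := \<pi> ` D\<rparr>"
    using D by (intro quartic_image_res) (simp add: sl2_stable_def)
  interpret sl2: lie_algebra sl2 by (rule lie_algebra_sl2)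
  note D' = mat_op_stable[OF D] I.D_closed
  show ?thesis
  proof (intro lie_module.intro lie_algebra_sl2 I.module_image lie_module_axioms.intro)
    fix X Y u assume XY: "X \<in> carrier sl2" "Y \<in> carrier sl2" and "u \<in> carrier (res\<lparr>carrier := \<pi> ` D\<rparr>)"
    then obtain p where p: "p \<in> D" "u = \<pi> p" by auto
    let ?M = "res\<lparr>carrier := \<pi> ` D\<rparr>"
    have "act ?M X (act ?M Y u) \<ominus>\<^bsub>?M\<^esub> act ?M Y (act ?M X u) = \<pi> (mat_op X (mat_op Y p) - mat_op Y (mat_op X p))"
      using I.minus_image[of "mat_op X (mat_op Y p)" "mat_op Y (mat_op X p)"] by (simp add: p XY act_res D')
    then show "act ?M (bracket sl2 X Y) u = act ?M X (act ?M Y u) \<ominus>\<^bsub>?M\<^esub> act ?M Y (act ?M X u)"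
      using sl2.bracket_closed[OF XY] by (simp add: p act_res mat_op_bracket XY)
  next
    fix X Y u assume "X \<in> carrier sl2" "Y \<in> carrier sl2" and u: "u \<in> carrier (res\<lparr>carrier := \<pi> ` D\<rparr>)"
    with sl2.a_closed show "act (res\<lparr>carrier := \<pi> ` D\<rparr>) (X \<oplus>\<^bsub>sl2\<^esub> Y) u =
        act (res\<lparr>carrier := \<pi> ` D\<rparr>) X u \<oplus>\<^bsub>res\<lparr>carrier := \<pi> ` D\<rparr>\<^esub> act (res\<lparr>carrier := \<pi> ` D\<rparr>) Y u"
      by (auto simp: act_res mat_op_simps add_image)
  next
    fix c X u assume "X \<in> carrier sl2" and u: "u \<in> carrier (res\<lparr>carrier := \<pi> ` D\<rparr>)"
    with sl2.smult_closed[of c X] show "act (res\<lparr>carrier := \<pi> ` D\<rparr>) (c \<odot>\<^bsub>sl2\<^esub> X) u =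
        c \<odot>\<^bsub>res\<lparr>carrier := \<pi> ` D\<rparr>\<^esub> act (res\<lparr>carrier := \<pi> ` D\<rparr>) X u"
      by (auto simp: act_res mat_op_simps smult_image)
  qed (auto simp: act_res mat_op_simps add_image smult_image D')
qed

lemma submodule_res: "submodule H complex_ring res \<longleftrightarrow> submodule H complex_ring M"
  by (simp add: submodule_def submodule_axioms_def subgroup_def add_pow_def m_inv_def)

lemma res_carrier: "res\<lparr>carrier := \<pi> ` UNIV\<rparr> = res"
  by (simp add: carrier_image[symmetric] pullback_module_def)

lemma lie_submodule_res:
  assumes D: "sl2_stable D"
  shows "lie_submodule sl2 res (\<pi> ` D)"
  unfolding lie_submodule_def submodule_res
  using D submodule_image[of D] mat_op_stable[OF D] by (auto simp: sl2_stable_def act_res)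

text \<open>Pulls an sl2-submodule of the image of D back to polynomials, where
  \<open>ladder_generates\<close> can be applied.\<close>

lemma preimage_res:
  assumes D: "sub_space D" and N: "lie_submodule sl2 (res\<lparr>carrier := \<pi> ` D\<rparr>) N"
  shows "sub_space (\<pi> -` N)" "p \<in> \<pi> -` N \<Longrightarrow> opE p \<in> \<pi> -` N" "p \<in> \<pi> -` N \<Longrightarrow> opF p \<in> \<pi> -` N"
    "N \<subseteq> \<pi> ` D" "\<zero>\<^bsub>M\<^esub> \<in> N"
proof -
  interpret I: quartic_image D \<pi> "res\<lparr>carrier := \<pi> ` D\<rparr>" by (rule quartic_image_res[OF D])
  have N': "submodule N complex_ring (res\<lparr>carrier := \<pi> ` D\<rparr>)"
    and act: "\<And>X u. X \<in> carrier sl2 \<Longrightarrow> u \<in> N \<Longrightarrow> act M (sl2_incl X) u \<in> N"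
    using N by (auto simp: lie_submodule_def)
  note N'' = I.submoduleE[OF N']
  show 0: "\<zero>\<^bsub>M\<^esub> \<in> N" using subgroup.one_closed[OF submodule.axioms(1)[OF N']] by simp
  have "\<pi> (p + q) \<in> N" if "\<pi> p \<in> N" "\<pi> q \<in> N" for p q
    using N''(5)[OF that] by (simp add: add_image)
  moreover have "\<pi> (cst c * p) \<in> N" if "\<pi> p \<in> N" for c p
    using N''(4)[OF _ that, of c] by (simp add: smult_image)
  ultimately show "sub_space (\<pi> -` N)" using 0 by (simp add: sub_space_def zero_image)
  show "N \<subseteq> \<pi> ` D" using N''(1) by simp
  show "p \<in> \<pi> -` N \<Longrightarrow> opE p \<in> \<pi> -` N" "p \<in> \<pi> -` N \<Longrightarrow> opF p \<in> \<pi> -` N"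
    using act[OF sl2_basis_closed(1), of "\<pi> p"] act[OF sl2_basis_closed(2), of "\<pi> p"]
    by (simp_all add: act_res sl2_basis_closed mat_op_basis)
qed

end

section \<open>The direct sum of the simple sl2-components\<close>

locale decomposed_rep = quartic_rep \<pi> M for \<pi> and M :: "(L3_elem, 'b, 'n) rep_scheme" +
  fixes T :: "(nat \<times> nat \<times> nat) set"
  assumes independent: "\<And>A c. finite A \<Longrightarrow> A \<subseteq> T \<Longrightarrow> (\<Sum>t\<in>A. strg_comb t (c t)) \<in> ker \<Longrightarrow>
      \<forall>t\<in>A. \<forall>i\<le>wt t. c t i = 0"
    and spanning: "\<And>p. \<exists>A c. finite A \<and> A \<subseteq> T \<and> p - (\<Sum>t\<in>A. strg_comb t (c t)) \<in> ker"
begin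

abbreviation V :: "nat \<times> nat \<times> nat \<Rightarrow> 'b set" where "V t \<equiv> \<pi> ` ladder t"

lemma strg_comb_ker: "t \<in> T \<Longrightarrow> strg_comb t c \<in> ker \<Longrightarrow> i \<le> wt t \<Longrightarrow> c i = 0"
  using independent[of "{t}" "\<lambda>_. c"] by simp

lemma strg_comb_eq: "(\<And>i. i \<le> wt t \<Longrightarrow> c i = d i) \<Longrightarrow> strg_comb t c = strg_comb t d"
  unfolding strg_comb_def by (rule sum.cong) auto

lemma hwt_notin_ker: "t \<in> T \<Longrightarrow> hwt t \<notin> ker"
proof
  assume t: "t \<in> T" "hwt t \<in> ker"
  have "strg t 0 \<in> ladder t" by (rule strg_mem_ladder)
  then obtain c where c: "hwt t = strg_comb t c" by (auto simp: ladder_def strg_def)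
  then have "strg_comb t c = strg_comb t (\<lambda>_. 0)" using t strg_comb_ker by (intro strg_comb_eq) simp
  then have "hwt t = 0" using c by (simp add: strg_comb_linear)
  \<comment> \<open>With the whole string zero, the combination with all coefficients 1 lies in
    \<open>ker\<close>, against independence.\<close>
  then have "strg t i = 0" for i by (simp add: strg_def iterate_0)
  then have "strg_comb t (\<lambda>_. 1) \<in> ker" using sub_space_0[OF inv_ideal_sub[OF inv_ideal_ker]] by (simp add: strg_comb_def)
  from strg_comb_ker[OF t(1) this, of 0] show False by simp
qed

text \<open>Direct sums and multiplicities are recorded by a set of subspaces, so no two indices may
  share one.\<close>

lemma inj_V: "inj_on V T"
proof (rule inj_onI, rule ccontr)
  fix t s assume ts: "t \<in> T" "s \<in> T" "V t = V s" "t \<noteq> s"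
  obtain c where c: "hwt t = strg_comb t c"
    using strg_mem_ladder[of t 0] by (auto simp: ladder_def strg_def)
  have "\<pi> (hwt t) \<in> V s" unfolding ts(3)[symmetric] c by (auto simp: ladder_def)
  then obtain d where "\<pi> (strg_comb t c) = \<pi> (strg_comb s d)" by (auto simp: ladder_def c)
  then have "strg_comb t c - strg_comb s d \<in> ker" by (simp add: image_eq_ker)
  moreover have "strg_comb s (\<lambda>i. - 1 * d i) = - strg_comb s d" unfolding strg_comb_linear by (simp add: cst_simps)
  ultimately have "(\<Sum>r\<in>{t, s}. strg_comb r (if r = t then c else (\<lambda>i. - 1 * d i))) \<in> ker"
    using ts(4) by simp
  from independent[OF _ _ this] ts have "\<forall>i\<le>wt t. c i = 0" by simp
  then have "strg_comb t c = strg_comb t (\<lambda>_. 0)" by (intro strg_comb_eq) simp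
  then have "hwt t \<in> ker" using sub_space_0[OF inv_ideal_sub[OF inv_ideal_ker]] by (simp add: c strg_comb_linear)
  then show False using hwt_notin_ker ts(1) by blast
qed

lemma simple_V:
  assumes t: "t \<in> T"
  shows "simple_lie_module sl2 (res\<lparr>carrier := V t\<rparr>)"
  unfolding simple_lie_module_def
proof (intro conjI allI impI)
  show "lie_module sl2 (res\<lparr>carrier := V t\<rparr>)" by (rule lie_module_res[OF sl2_stable_ladder])
  have "\<pi> (hwt t) \<in> V t" using strg_mem_ladder[of t 0] by (simp add: strg_def)
  then show "carrier (res\<lparr>carrier := V t\<rparr>) \<noteq> {\<zero>\<^bsub>res\<lparr>carrier := V t\<rparr>\<^esub>}"
    using hwt_notin_ker[OF t] by (auto simp: ker_def)
  fix N assume N: "lie_submodule sl2 (res\<lparr>carrier := V t\<rparr>) N"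
  note N' = preimage_res[OF sub_space_ladder N]
  show "N = {\<zero>\<^bsub>res\<lparr>carrier := V t\<rparr>\<^esub>} \<or> N = carrier (res\<lparr>carrier := V t\<rparr>)"
  proof (cases "N = {\<zero>\<^bsub>M\<^esub>}")
    case False
    then obtain u where u: "u \<in> N" "u \<noteq> \<zero>\<^bsub>M\<^esub>" using N'(5) by blast
    then obtain c where c: "u = \<pi> (strg_comb t c)" using N'(4) by (auto simp: ladder_def)
    have "\<exists>i\<le>wt t. c i \<noteq> 0"
    proof (rule ccontr)
      assume "\<not> ?thesis"
      then have "strg_comb t c = strg_comb t (\<lambda>_. 0)" by (intro strg_comb_eq) blast
      then show False using u(2) by (simp add: c strg_comb_linear zero_image)
    qed
    then have "ladder t \<subseteq> \<pi> -` N"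
      using ladder_generates[OF N'(1-3)] u(1) c by blast
    with N'(4) show ?thesis by auto
  qed simp
qed

lemma finite_dimensional_V:
  assumes t: "t \<in> T"
  shows "finite_dimensional (res\<lparr>carrier := V t\<rparr>)"
proof -
  interpret I: quartic_image "ladder t" \<pi> "res\<lparr>carrier := V t\<rparr>" by (rule quartic_image_res[OF sub_space_ladder])
  define b where "b i = \<pi> (strg t i)" for i
  \<comment> \<open>The definition of finite dimension attaches coefficients to vectors, so the
    string vectors must be distinct for the sum over i to be reindexed.\<close>
  have inj: "inj_on b {..wt t}"
  proof (rule inj_onI, rule ccontr)
    fix i j assume ij: "i \<in> {..wt t}" "j \<in> {..wt t}" "b i = b j" "i \<noteq> j"
    define c where "c k = (if k = i then 1 else if k = j then - 1 else 0 :: complex)" for k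
    have "strg_comb t c = (\<Sum>k\<in>{i, j}. cst (c k) * strg t k)"
      unfolding strg_comb_def by (rule sum.mono_neutral_right) (use ij in \<open>auto simp: c_def cst_simps\<close>)
    also have "\<dots> = strg t i - strg t j" using ij(4) by (simp add: c_def cst_simps)
    also have "\<dots> \<in> ker" using ij(3) by (simp add: b_def image_eq_ker)
    finally have "c i = 0" using strg_comb_ker[OF t] ij(1) by blast
    then show False by (simp add: c_def)
  qed
  have inv: "the_inv_into {..wt t} b (\<pi> (strg t i)) = i" if "i \<le> wt t" for i
    using the_inv_into_f_f[OF inj, of i] that by (simp add: b_def)
  show ?thesis unfolding finite_dimensional_def
  proof (intro exI[of _ "b ` {..wt t}"] conjI ballI)
    show "b ` {..wt t} \<subseteq> carrier (res\<lparr>carrier := V t\<rparr>)" using strg_mem_ladder[of t] by (auto simp: b_def)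
    fix u assume "u \<in> carrier (res\<lparr>carrier := V t\<rparr>)"
    then obtain c where c: "u = \<pi> (\<Sum>i\<le>wt t. cst (c i) * strg t i)" by (auto simp: ladder_def strg_comb_def)
    have "u = (\<Oplus>\<^bsub>res\<lparr>carrier := V t\<rparr>\<^esub>i\<in>{..wt t}. \<pi> (cst (c i) * strg t i))"
      unfolding c by (rule I.finsum_image[symmetric]) (auto intro: I.D_closed strg_mem_ladder)
    also have "\<dots> = (\<Oplus>\<^bsub>res\<lparr>carrier := V t\<rparr>\<^esub>i\<in>{..wt t}. c (the_inv_into {..wt t} b (b i)) \<odot>\<^bsub>res\<lparr>carrier := V t\<rparr>\<^esub> b i)"
      by (rule I.finsum_cong')
        (auto simp: inv b_def smult_image intro!: imageI I.D_closed strg_mem_ladder)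
    also have "\<dots> = (\<Oplus>\<^bsub>res\<lparr>carrier := V t\<rparr>\<^esub>v\<in>b ` {..wt t}. c (the_inv_into {..wt t} b v) \<odot>\<^bsub>res\<lparr>carrier := V t\<rparr>\<^esub> v)"
      by (rule I.finsum_reindex[symmetric, OF _ inj])
        (auto simp: b_def smult_image intro!: imageI I.D_closed strg_mem_ladder)
    finally show "\<exists>c. u = (\<Oplus>\<^bsub>res\<lparr>carrier := V t\<rparr>\<^esub>v\<in>b ` {..wt t}. c v \<odot>\<^bsub>res\<lparr>carrier := V t\<rparr>\<^esub> v)"
      by (rule exI[of _ "\<lambda>v. c (the_inv_into {..wt t} b v)"])
  qed simp
qed

text \<open>The image q of the top vector is nonzero, killed by E and of weight \<open>wt s\<close>,
  all modulo \<open>ker\<close>, so the Casimir operator acts on it by the value for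
  \<open>wt s\<close>. As a vector of \<open>ladder t\<close> it has the value for
  \<open>wt t\<close>.\<close>

lemma iso_V_wt:
  assumes t: "t \<in> T" "s \<in> T" and iso: "lie_module_iso sl2 (res\<lparr>carrier := V s\<rparr>) (res\<lparr>carrier := V t\<rparr>)"
  shows "wt s = wt t"
proof -
  have "\<exists>\<phi>. bij_betw \<phi> (V s) (V t) \<and> (\<forall>u\<in>V s. \<forall>v\<in>V s. \<phi> (u \<oplus>\<^bsub>M\<^esub> v) = \<phi> u \<oplus>\<^bsub>M\<^esub> \<phi> v) \<and>
     (\<forall>c. \<forall>u\<in>V s. \<phi> (c \<odot>\<^bsub>M\<^esub> u) = c \<odot>\<^bsub>M\<^esub> \<phi> u) \<and>
     (\<forall>X\<in>carrier sl2. \<forall>u\<in>V s. \<phi> (act M (sl2_incl X) u) = act M (sl2_incl X) (\<phi> u))"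
    using iso by (simp add: lie_module_iso_def)
  then obtain \<phi> where bij: "bij_betw \<phi> (V s) (V t)"
    and sm: "\<forall>c. \<forall>u\<in>V s. \<phi> (c \<odot>\<^bsub>M\<^esub> u) = c \<odot>\<^bsub>M\<^esub> \<phi> u"
    and ac: "\<forall>X\<in>carrier sl2. \<forall>u\<in>V s. \<phi> (act M (sl2_incl X) u) = act M (sl2_incl X) (\<phi> u)"
    by (elim exE conjE) (rule that)
  have smult: "\<phi> (c \<odot>\<^bsub>M\<^esub> u) = c \<odot>\<^bsub>M\<^esub> \<phi> u" if "u \<in> V s" for c u
    by (rule bspec[OF spec[OF sm] that])
  have act: "\<phi> (act M (sl2_incl X) u) = act M (sl2_incl X) (\<phi> u)" if "X \<in> carrier sl2" "u \<in> V s" for X u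
    by (rule bspec[OF bspec[OF ac that(1)] that(2)])
  define u where "u = \<pi> (hwt s)"
  have u: "u \<in> V s" using strg_mem_ladder[of s 0] by (simp add: u_def strg_def)
  then obtain q where q: "q \<in> ladder t" "\<phi> u = \<pi> q" using bij by (auto simp: bij_betw_def)
  have q': "\<phi> (\<pi> (hwt s)) = \<pi> q" using q(2) by (simp add: u_def)
  have zero: "\<zero>\<^bsub>M\<^esub> \<in> V s" using sub_space_0[OF sub_space_ladder] by (auto simp: zero_image)
  have \<phi>0: "\<phi> \<zero>\<^bsub>M\<^esub> = \<zero>\<^bsub>M\<^esub>"
    using smult[OF u, of 0] by (simp add: q' u_def smult_image cst_simps zero_image)
  have "q \<notin> ker"
  proof
    assume "q \<in> ker"
    then have "\<phi> u = \<phi> \<zero>\<^bsub>M\<^esub>" by (simp add: q(2) \<phi>0 ker_def)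
    then have "u = \<zero>\<^bsub>M\<^esub>" by (rule inj_onD[OF bij_betw_imp_inj_on[OF bij] _ u zero])
    then show False using hwt_notin_ker[OF t(2)] by (simp add: u_def ker_def)
  qed
  have hE: "opE (hwt s) = 0" using E_strg_0[of s] by (simp add: strg_def)
  have hH: "opH (hwt s) = cst (of_nat (wt s)) * hwt s" using H_strg[of s 0] by (simp add: strg_def)
  have "\<pi> (opE q) = \<phi> (\<pi> (opE (hwt s)))"
    using act[OF sl2_basis_closed(1) u] by (simp add: q' u_def act_res sl2_basis_closed mat_op_basis)
  then have E: "opE q \<in> ker" by (simp add: hE \<phi>0 zero_image[symmetric] ker_def)
  have "\<pi> (opH q) = \<phi> (\<pi> (opH (hwt s)))"
    using act[OF sl2_basis_closed(3) u] by (simp add: q' u_def act_res sl2_basis_closed mat_op_basis)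
  also have "\<dots> = \<pi> (cst (of_nat (wt s)) * q)"
    using smult[OF u, of "of_nat (wt s)"] by (simp add: hH q' u_def smult_image)
  finally have H: "opH q - cst (of_nat (wt s)) * q \<in> ker" by (simp add: image_eq_ker)
  note ker' = sub_spaceD[OF inv_ideal_sub[OF inv_ideal_ker]] inv_idealD[OF inv_ideal_ker]
  define n where "n = (of_nat (wt s) :: complex)"
  define d where "d = opH q - cst n * q"
  \<comment> \<open>From H^2 + 2 H - n (n + 2) = (H + n + 2)(H - n).\<close>
  have "opH d + cst n * d + 2 * d + 4 * opF (opE q) \<in> ker"
    using H E unfolding d_def n_def by (intro ker'(2,3,8,11,12))
  also have "opH d + cst n * d + 2 * d + 4 * opF (opE q) = casimir q - cst (n * (n + 2)) * q"
    by (simp add: d_def casimir_def H_simps cst_simps algebra_simps)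
  also have "\<dots> = cst (of_nat (wt t * (wt t + 2)) - n * (n + 2)) * q"
    unfolding casimir_ladder[OF q(1)] by (simp add: cst_simps algebra_simps)
  finally have mem: "cst (of_nat (wt t * (wt t + 2)) - n * (n + 2)) * q \<in> ker" .
  have "of_nat (wt t * (wt t + 2)) - n * (n + 2) = 0"
    using sub_space_cancel[OF inv_ideal_sub[OF inv_ideal_ker] mem] \<open>q \<notin> ker\<close> by blast
  then have "(of_nat (wt t * (wt t + 2)) :: complex) = of_nat (wt s * (wt s + 2))" by (simp add: n_def algebra_simps)
  then have "wt t * (wt t + 2) = wt s * (wt s + 2)" unfolding of_nat_eq_iff .
  then have "(wt t + 1) ^ 2 = (wt s + 1) ^ 2" by (simp add: power2_eq_square)
  then show ?thesis by simp
qed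

text \<open>Bridges two indexings: \<open>is_direct_sum\<close> chooses a component for each
  subspace, while spanning and independence speak of coefficients over T.\<close>

lemma finsum_V:
  assumes A: "finite A" "A \<subseteq> T" "\<And>t. t \<in> T - A \<Longrightarrow> d t = (\<lambda>_. 0)"
    and c: "\<And>t. t \<in> T \<Longrightarrow> c (V t) = \<pi> (strg_comb t (d t))"
  shows "finite {X \<in> V ` T. c X \<noteq> \<zero>\<^bsub>M\<^esub>}"
    "(\<Oplus>\<^bsub>res\<^esub>X\<in>{X \<in> V ` T. c X \<noteq> \<zero>\<^bsub>M\<^esub>}. c X) = \<pi> (\<Sum>t\<in>A. strg_comb t (d t))"
proof -
  interpret I: quartic_image UNIV \<pi> res
    using quartic_image_res[OF D] unfolding res_carrier .
  define B where "B = {t \<in> A. c (V t) \<noteq> \<zero>\<^bsub>M\<^esub>}"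
  have B: "B \<subseteq> A" "finite B" using A(1) by (auto simp: B_def)
  have eq: "{X \<in> V ` T. c X \<noteq> \<zero>\<^bsub>M\<^esub>} = V ` B"
  proof (intro equalityI subsetI)
    fix X assume "X \<in> {X \<in> V ` T. c X \<noteq> \<zero>\<^bsub>M\<^esub>}"
    then obtain t where t: "t \<in> T" "X = V t" "c (V t) \<noteq> \<zero>\<^bsub>M\<^esub>" by blast
    have "t \<in> A"
    proof (rule ccontr)
      assume "t \<notin> A"
      then have "d t = (\<lambda>_. 0)" using A(3) t(1) by blast
      then show False using c[OF t(1)] t(3) by (simp add: strg_comb_linear zero_image)
    qed
    then show "X \<in> V ` B" using t by (simp add: B_def)
  next
    fix X assume "X \<in> V ` B"
    then show "X \<in> {X \<in> V ` T. c X \<noteq> \<zero>\<^bsub>M\<^esub>}" using A(2) unfolding B_def by blast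
  qed
  show "finite {X \<in> V ` T. c X \<noteq> \<zero>\<^bsub>M\<^esub>}" unfolding eq using B by simp
  have inj: "inj_on V B" using inj_V A(2) B(1) by (meson inj_on_subset subset_trans)
  have cB: "c (V t) = \<pi> (strg_comb t (d t))" if "t \<in> B" for t using c that A(2) B(1) by blast
  have "(\<Oplus>\<^bsub>res\<^esub>X\<in>V ` B. c X) = (\<Oplus>\<^bsub>res\<^esub>t\<in>B. c (V t))"
    by (rule I.finsum_reindex[OF _ inj]) (auto simp: cB carrier_image)
  also have "\<dots> = (\<Oplus>\<^bsub>res\<^esub>t\<in>B. \<pi> (strg_comb t (d t)))"
    by (rule I.finsum_cong') (auto simp: cB carrier_image)
  also have "\<dots> = \<pi> (\<Sum>t\<in>B. strg_comb t (d t))" by (rule I.finsum_image) (auto simp: B)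
  \<comment> \<open>Indices in A - B have zero component, so their polynomials lie in
    \<open>ker\<close> without having to vanish.\<close>
  also have "\<dots> = \<pi> (\<Sum>t\<in>A. strg_comb t (d t))"
  proof -
    have "(\<Sum>t\<in>A. strg_comb t (d t)) - (\<Sum>t\<in>B. strg_comb t (d t)) = (\<Sum>t\<in>A - B. strg_comb t (d t))"
      using A(1) B(1) by (simp add: sum_diff)
    also have "\<dots> \<in> ker"
      by (rule sub_space_sum[OF inv_ideal_sub[OF inv_ideal_ker]])
        (use A(2) c in \<open>auto simp: B_def ker_def\<close>)
    finally show ?thesis using image_eq_ker by metis
  qed
  finally show "(\<Oplus>\<^bsub>res\<^esub>X\<in>{X \<in> V ` T. c X \<noteq> \<zero>\<^bsub>M\<^esub>}. c X) = \<pi> (\<Sum>t\<in>A. strg_comb t (d t))" unfolding eq .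
qed

lemma component_coefficients:
  assumes c: "c \<in> (\<Pi>\<^sub>E X\<in>V ` T. X)" "finite {X \<in> V ` T. c X \<noteq> \<zero>\<^bsub>M\<^esub>}"
  obtains A d where "finite A" "A \<subseteq> T" "\<And>t. t \<notin> A \<Longrightarrow> d t = (\<lambda>_. 0)"
    "\<And>t. t \<in> T \<Longrightarrow> c (V t) = \<pi> (strg_comb t (d t))"
proof -
  define A where "A = {t \<in> T. c (V t) \<noteq> \<zero>\<^bsub>M\<^esub>}"
  have "V ` A \<subseteq> {X \<in> V ` T. c X \<noteq> \<zero>\<^bsub>M\<^esub>}" by (auto simp: A_def)
  then have "finite (V ` A)" using c(2) by (rule finite_subset)
  moreover have "inj_on V A" by (rule inj_on_subset[OF inj_V]) (simp add: A_def)
  ultimately have fin: "finite A" by (rule finite_imageD)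
  have "\<forall>t\<in>A. \<exists>d. c (V t) = \<pi> (strg_comb t d)"
  proof
    fix t assume "t \<in> A"
    then have "c (V t) \<in> V t" using c(1) by (auto simp: A_def PiE_def Pi_def)
    then show "\<exists>d. c (V t) = \<pi> (strg_comb t d)" by (auto simp: ladder_def)
  qed
  from bchoice[OF this] obtain d where d: "\<And>t. t \<in> A \<Longrightarrow> c (V t) = \<pi> (strg_comb t (d t))" by blast
  show ?thesis
  proof
    show "finite A" by (rule fin)
    show "A \<subseteq> T" by (simp add: A_def)
    show "t \<notin> A \<Longrightarrow> (if t \<in> A then d t else (\<lambda>_. 0)) = (\<lambda>_. 0)" for t by simp
    show "c (V t) = \<pi> (strg_comb t (if t \<in> A then d t else (\<lambda>_. 0)))" if "t \<in> T" for t
      using d[of t] that by (auto simp: A_def strg_comb_linear zero_image)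
  qed
qed

lemma direct_sum_V: "is_direct_sum res (V ` T)"
  unfolding is_direct_sum_def
proof (intro conjI ballI)
  fix W assume "W \<in> V ` T"
  then show "submodule W complex_ring res"
    unfolding submodule_res using submodule_image[OF sub_space_ladder] by auto
next
  fix u assume "u \<in> carrier res"
  then obtain p where p: "u = \<pi> p" by (auto simp: carrier_image)
  obtain A c where A: "finite A" "A \<subseteq> T" "p - (\<Sum>t\<in>A. strg_comb t (c t)) \<in> ker" using spanning by blast
  define d where "d t = (if t \<in> A then c t else (\<lambda>_. 0))" for t
  have ud: "u = \<pi> (\<Sum>t\<in>A. strg_comb t (d t))" using A(3) unfolding p d_def by (simp add: image_eq_ker)
  define f where "f = (\<lambda>X\<in>V ` T. \<pi> (strg_comb (the_inv_into T V X) (d (the_inv_into T V X))))"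
  have f: "f (V t) = \<pi> (strg_comb t (d t))" if "t \<in> T" for t
    using that by (simp add: f_def the_inv_into_f_f[OF inj_V])
  have d0: "\<And>t. t \<in> T - A \<Longrightarrow> d t = (\<lambda>_. 0)" by (simp add: d_def)
  note fs = finsum_V[OF A(1,2) d0 f]
  show "\<exists>!c. c \<in> (\<Pi>\<^sub>E W\<in>V ` T. W) \<and> finite {W \<in> V ` T. c W \<noteq> \<zero>\<^bsub>res\<^esub>} \<and>
      u = (\<Oplus>\<^bsub>res\<^esub>W\<in>{W \<in> V ` T. c W \<noteq> \<zero>\<^bsub>res\<^esub>}. c W)"
  proof (rule ex1I[of _ f])
    have "f \<in> (\<Pi>\<^sub>E W\<in>V ` T. W)"
    proof (rule PiE_I)
      fix X assume "X \<in> V ` T"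
      then show "f X \<in> X" using f by (auto simp: ladder_def)
    qed (auto simp: f_def)
    then show "f \<in> (\<Pi>\<^sub>E W\<in>V ` T. W) \<and> finite {W \<in> V ` T. f W \<noteq> \<zero>\<^bsub>res\<^esub>} \<and>
      u = (\<Oplus>\<^bsub>res\<^esub>W\<in>{W \<in> V ` T. f W \<noteq> \<zero>\<^bsub>res\<^esub>}. f W)" using fs ud by simp
  next
    fix g assume "g \<in> (\<Pi>\<^sub>E W\<in>V ` T. W) \<and> finite {W \<in> V ` T. g W \<noteq> \<zero>\<^bsub>res\<^esub>} \<and>
      u = (\<Oplus>\<^bsub>res\<^esub>W\<in>{W \<in> V ` T. g W \<noteq> \<zero>\<^bsub>res\<^esub>}. g W)"
    then have g: "g \<in> (\<Pi>\<^sub>E W\<in>V ` T. W)" "finite {W \<in> V ` T. g W \<noteq> \<zero>\<^bsub>M\<^esub>}"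
      "u = (\<Oplus>\<^bsub>res\<^esub>W\<in>{W \<in> V ` T. g W \<noteq> \<zero>\<^bsub>M\<^esub>}. g W)" by simp_all
    obtain B e where B: "finite B" "B \<subseteq> T" "\<And>t. t \<notin> B \<Longrightarrow> e t = (\<lambda>_. 0)"
      "\<And>t. t \<in> T \<Longrightarrow> g (V t) = \<pi> (strg_comb t (e t))" using component_coefficients[OF g(1,2)] by blast
    have e0: "\<And>t. t \<in> T - B \<Longrightarrow> e t = (\<lambda>_. 0)" using B(3) by blast
    have ue: "u = \<pi> (\<Sum>t\<in>B. strg_comb t (e t))" using finsum_V(2)[OF B(1,2) e0 B(4)] g(3) by simp
    \<comment> \<open>For uniqueness both expressions are extended by zero to the union of their
      index sets and then subtracted.\<close>
    have sum_ext: "(\<Sum>t\<in>C. strg_comb t (h t)) = (\<Sum>t\<in>A \<union> B. strg_comb t (h t))"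
      if "C \<subseteq> A \<union> B" "\<And>t. t \<notin> C \<Longrightarrow> h t = (\<lambda>_. 0)" for C and h :: "nat \<times> nat \<times> nat \<Rightarrow> nat \<Rightarrow> complex"
      by (rule sum.mono_neutral_left) (use A(1) B(1) that in \<open>auto simp: strg_comb_linear\<close>)
    have sA: "(\<Sum>t\<in>A. strg_comb t (d t)) = (\<Sum>t\<in>A \<union> B. strg_comb t (d t))"
      by (rule sum_ext) (auto simp: d_def)
    have sB: "(\<Sum>t\<in>B. strg_comb t (e t)) = (\<Sum>t\<in>A \<union> B. strg_comb t (e t))"
      by (rule sum_ext) (auto simp: B(3))
    have minus: "strg_comb t (\<lambda>i. d t i + - 1 * e t i) = strg_comb t (d t) - strg_comb t (e t)" for t
      unfolding strg_comb_linear by (simp add: cst_simps)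
    have "\<pi> (\<Sum>t\<in>A \<union> B. strg_comb t (d t)) = \<pi> (\<Sum>t\<in>A \<union> B. strg_comb t (e t))"
      using ud ue unfolding sA sB by simp
    then have "(\<Sum>t\<in>A \<union> B. strg_comb t (\<lambda>i. d t i + - 1 * e t i)) \<in> ker"
      unfolding minus sum_subtractf image_eq_ker .
    from independent[OF _ _ this] A B have de: "\<forall>t\<in>A \<union> B. \<forall>i\<le>wt t. d t i + - 1 * e t i = 0" by simp
    have "strg_comb t (d t) = strg_comb t (e t)" for t
    proof (cases "t \<in> A \<union> B")
      case True
      then show ?thesis using de by (intro strg_comb_eq) auto
    qed (simp add: d_def B(3))
    then have "g (V t) = f (V t)" if "t \<in> T" for t using that B(4) f by simp
    then show "g = f" using g(1) by (intro PiE_ext[OF g(1), of f]) (use fs f in \<open>auto simp: f_def ladder_def\<close>)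
  qed
qed

end

lemma (in quartic_rep) decomposition:
  assumes "disc_ideal chi \<subseteq> ker"
  shows "\<exists>S. (\<forall>W\<in>S. lie_submodule sl2 res W \<and> simple_lie_module sl2 (res\<lparr>carrier := W\<rparr>) \<and>
        finite_dimensional (res\<lparr>carrier := W\<rparr>)) \<and> is_direct_sum res S \<and>
      (\<forall>W\<in>S. finite {W'\<in>S. lie_module_iso sl2 (res\<lparr>carrier := W'\<rparr>) (res\<lparr>carrier := W\<rparr>)})"
proof -
  obtain T where T: "\<forall>A c. finite A \<longrightarrow> A \<subseteq> T \<longrightarrow> (\<Sum>t\<in>A. strg_comb t (c t)) \<in> ker \<longrightarrow> (\<forall>t\<in>A. \<forall>i\<le>wt t. c t i = 0)"
    "\<forall>p. \<exists>A c. finite A \<and> A \<subseteq> T \<and> p - (\<Sum>t\<in>A. strg_comb t (c t)) \<in> ker"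
    using strg_decomposition[OF inv_ideal_ker assms] by (elim exE conjE)
  interpret decomposed_rep \<pi> M T
  proof (intro decomposed_rep.intro quartic_rep_axioms decomposed_rep_axioms.intro)
    show "\<forall>t\<in>A. \<forall>i\<le>wt t. c t i = 0" if "finite A" "A \<subseteq> T" "(\<Sum>t\<in>A. strg_comb t (c t)) \<in> ker" for A c
      using T(1) that by simp
    show "\<exists>A c. finite A \<and> A \<subseteq> T \<and> p - (\<Sum>t\<in>A. strg_comb t (c t)) \<in> ker" for p
      by (rule spec[OF T(2)])
  qed
  have "finite {W' \<in> V ` T. lie_module_iso sl2 (res\<lparr>carrier := W'\<rparr>) (res\<lparr>carrier := V t\<rparr>)}" if "t \<in> T" for t
  proof (rule finite_subset)
    show "{W' \<in> V ` T. lie_module_iso sl2 (res\<lparr>carrier := W'\<rparr>) (res\<lparr>carrier := V t\<rparr>)} \<subseteq> V ` {s. wt s = wt t}"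
      using iso_V_wt[OF that] by blast
  qed (simp add: finite_wt)
  then show ?thesis
    using lie_submodule_res[OF sl2_stable_ladder] simple_V finite_dimensional_V direct_sum_V
    by (intro exI[of _ "V ` T"]) auto
qed

lemma harish_chandra_image:
  fixes M :: "(L3_elem, 'b) rep"
  assumes "quartic_rep \<pi> M" "disc_ideal chi \<subseteq> quartic_rep.ker \<pi> M"
  shows "harish_chandra_module sl2 sl2_incl L3 M"
  unfolding harish_chandra_module_def Let_def
  using quartic_rep.lie_module_image[OF assms(1)] quartic_rep.decomposition[OF assms] by (rule conjI)

lemma (in quartic_rep) infinite_dimensional:
  assumes "disc_ideal chi \<subseteq> ker" "1 \<notin> ker" "chi \<noteq> 0"
  shows "\<not> finite_dimensional M"
proof
  assume "finite_dimensional M"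
  then obtain B where B: "finite B" "B \<subseteq> carrier M" "\<And>u. u \<in> carrier M \<Longrightarrow> \<exists>c. u = (\<Oplus>\<^bsub>M\<^esub>b\<in>B. c b \<odot>\<^bsub>M\<^esub> b)"
    by (auto simp: finite_dimensional_def)
  \<comment> \<open>Preimages of a spanning set of M span the polynomials modulo \<open>ker\<close>,
    which \<open>proper_infinite_dimensional\<close> excludes.\<close>
  define r where "r b = (SOME p. \<pi> p = b)" for b
  have r: "\<pi> (r b) = b" if "b \<in> B" for b
    unfolding r_def by (rule someI_ex) (use that B(2) in \<open>auto simp: carrier_image\<close>)
  have inj: "inj_on r B" by (rule inj_on_inverseI[of _ \<pi>]) (rule r)
  obtain p where p: "\<forall>c. p - (\<Sum>b\<in>r ` B. cst (c b) * b) \<notin> ker"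
    using proper_infinite_dimensional[OF inv_ideal_ker assms, of "r ` B"] B(1) by blast
  obtain c where "\<pi> p = (\<Oplus>\<^bsub>M\<^esub>b\<in>B. c b \<odot>\<^bsub>M\<^esub> b)" using B(3)[of "\<pi> p"] by (auto simp: carrier_image)
  also have "\<dots> = (\<Oplus>\<^bsub>M\<^esub>b\<in>B. \<pi> (cst (c b) * r b))"
    by (rule finsum_cong') (use B(2) in \<open>auto simp: smult_image[symmetric] r intro!: smult_closed\<close>)
  also have "\<dots> = \<pi> (\<Sum>b\<in>B. cst (c b) * r b)" by (rule finsum_image) (auto simp: B)
  also have "(\<Sum>b\<in>B. cst (c b) * r b) = (\<Sum>b\<in>r ` B. cst (c (\<pi> b)) * b)"
    unfolding sum.reindex[OF inj] by (rule sum.cong) (auto simp: r)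
  finally show False using p by (simp add: image_eq_ker)
qed

section \<open>Free vector spaces and the free algebra\<close>

lemma free_space_simps:
  "carrier (free_space X) = {p. finite {x. p x \<noteq> 0} \<and> {x. p x \<noteq> 0} \<subseteq> X}"
  "zero (free_space X) = (\<lambda>_. 0)" "add (free_space X) = (\<lambda>p q x. p x + q x)"
  "module.smult (free_space X) = (\<lambda>c p x. c * p x)"
  by (simp_all add: free_space_def)

lemma free_space_closed:
  "p \<in> carrier (free_space X) \<Longrightarrow> q \<in> carrier (free_space X) \<Longrightarrow> (\<lambda>x. p x + q x) \<in> carrier (free_space X)"
  "p \<in> carrier (free_space X) \<Longrightarrow> (\<lambda>x. c * p x) \<in> carrier (free_space X)"
  "(\<lambda>_. 0) \<in> carrier (free_space X)"
proof -
  assume "p \<in> carrier (free_space X)" "q \<in> carrier (free_space X)"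
  then have "finite ({x. p x \<noteq> 0} \<union> {x. q x \<noteq> 0})" "{x. p x \<noteq> 0} \<union> {x. q x \<noteq> 0} \<subseteq> X"
    by (auto simp: free_space_simps)
  moreover have "{x. p x + q x \<noteq> 0} \<subseteq> {x. p x \<noteq> 0} \<union> {x. q x \<noteq> 0}" by auto
  ultimately have "finite {x. p x + q x \<noteq> 0}" "{x. p x + q x \<noteq> 0} \<subseteq> X"
    using finite_subset by (blast, blast)
  then show "(\<lambda>x. p x + q x) \<in> carrier (free_space X)" by (simp add: free_space_simps)
next
  assume "p \<in> carrier (free_space X)"
  then show "(\<lambda>x. c * p x) \<in> carrier (free_space X)"
    by (auto simp: free_space_simps intro: finite_subset[of _ "{x. p x \<noteq> 0}"])
qed (simp add: free_space_simps)

lemma free_space_minus_closed: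
  assumes "p \<in> carrier (free_space X)" "q \<in> carrier (free_space X)"
  shows "(\<lambda>x. p x - q x) \<in> carrier (free_space X)"
  using free_space_closed(1)[OF assms(1) free_space_closed(2)[OF assms(2), of "- 1"]] by simp

lemma delta_closed: "x \<in> X \<Longrightarrow> delta x \<in> carrier (free_space X)"
  by (auto simp: free_space_simps delta_def)

lemma free_space_induct [consumes 1, case_names zero step]:
  assumes "p \<in> carrier (free_space X)" and "P (\<lambda>_. 0)"
    and "\<And>c x q. x \<in> X \<Longrightarrow> q \<in> carrier (free_space X) \<Longrightarrow> P q \<Longrightarrow> P (\<lambda>y. c * delta x y + q y)"
  shows "P p"
proof -
  have "finite S \<Longrightarrow> S \<subseteq> X \<Longrightarrow> {x. p x \<noteq> 0} \<subseteq> S \<Longrightarrow> P p" for S p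
  proof (induction S arbitrary: p rule: finite_induct)
    case empty
    then have "p = (\<lambda>_. 0)" by auto
    then show ?case using assms(2) by simp
  next
    case (insert x S)
    define q where "q = p(x := 0)"
    have sub: "{y. q y \<noteq> 0} \<subseteq> S" using insert.prems(2) by (auto simp: q_def)
    then have "P q" using insert by blast
    moreover have "q \<in> carrier (free_space X)"
      using sub insert.prems(1) insert.hyps(1) finite_subset by (auto simp: free_space_simps)
    ultimately have "P (\<lambda>y. p x * delta x y + q y)" using insert.prems(1) by (intro assms(3)) auto
    moreover have "(\<lambda>y. p x * delta x y + q y) = p" by (auto simp: q_def delta_def)
    ultimately show ?case by simp
  qed
  then show ?thesis using assms(1) by (auto simp: free_space_simps)
qed

lemma module_free_space:
  assumes "carrier F = carrier (free_space X)" "zero F = zero (free_space X)" "add F = add (free_space X)"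
    "module.smult F = module.smult (free_space X)"
  shows "Module.module complex_ring F"
proof (intro Module.moduleI complex_ring_cring abelian_groupI)
  fix p assume "p \<in> carrier F"
  then show "\<exists>q\<in>carrier F. q \<oplus>\<^bsub>F\<^esub> p = \<zero>\<^bsub>F\<^esub>"
    using free_space_closed(2)[of p X "- 1"] by (intro bexI[of _ "\<lambda>x. - p x"]) (simp_all add: assms free_space_simps)
qed (use free_space_closed in \<open>auto simp: assms free_space_simps(2-) algebra_simps\<close>)

lemma free_space_minus:
  assumes "carrier F = carrier (free_space X)" "zero F = zero (free_space X)" "add F = add (free_space X)"
    "module.smult F = module.smult (free_space X)" and p: "p \<in> carrier F" "q \<in> carrier F"
  shows "p \<ominus>\<^bsub>F\<^esub> q = (\<lambda>x. p x - q x)"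
proof -
  interpret Module.module complex_ring F by (rule module_free_space[OF assms(1-4)])
  have "\<ominus>\<^bsub>F\<^esub> q = (\<lambda>x. - q x)"
    using p free_space_closed(2)[of q X "- 1"] by (intro minus_equality) (simp_all add: assms(1-4) free_space_simps(2-))
  then show ?thesis by (simp add: a_minus_def assms(3) free_space_simps)
qed

section \<open>Linear extension and push-forward\<close>

definition lin_ext :: "('x \<Rightarrow> quartic_ring) \<Rightarrow> ('x \<Rightarrow> complex) \<Rightarrow> quartic_ring" where
  "lin_ext f p = (\<Sum>x | p x \<noteq> 0. cst (p x) * f x)"

lemma lin_ext_eq: "finite S \<Longrightarrow> {x. p x \<noteq> 0} \<subseteq> S \<Longrightarrow> lin_ext f p = (\<Sum>x\<in>S. cst (p x) * f x)"
  unfolding lin_ext_def by (rule sum.mono_neutral_left) (auto simp: cst_simps)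

lemma lin_ext_add:
  assumes "p \<in> carrier (free_space X)" "q \<in> carrier (free_space Y)"
  shows "lin_ext f (\<lambda>x. p x + q x) = lin_ext f p + lin_ext f q"
proof -
  let ?S = "{x. p x \<noteq> 0} \<union> {x. q x \<noteq> 0}"
  have "finite ?S" using assms by (auto simp: free_space_simps)
  then have "lin_ext f (\<lambda>x. p x + q x) = (\<Sum>x\<in>?S. cst (p x + q x) * f x)" "lin_ext f p = (\<Sum>x\<in>?S. cst (p x) * f x)"
    "lin_ext f q = (\<Sum>x\<in>?S. cst (q x) * f x)" by (auto intro!: lin_ext_eq)
  then show ?thesis by (simp add: cst_simps distrib_right sum.distrib)
qed

lemma lin_ext_scale: "lin_ext f (\<lambda>x. c * p x) = cst c * lin_ext f p"
  by (cases "c = 0") (simp_all add: lin_ext_def cst_simps sum_distrib_left mult.assoc)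

lemma lin_ext_delta: "lin_ext f (delta x) = f x"
  by (simp add: lin_ext_def delta_def cst_simps)

lemma lin_ext_zero: "lin_ext f (\<lambda>_. 0) = 0"
  by (simp add: lin_ext_def)

lemma push_forward_eq:
  assumes "finite S" "{x. p x \<noteq> 0} \<subseteq> S"
  shows "push_forward f p y = (\<Sum>x\<in>S. if f x = y then p x else 0)"
proof -
  have "push_forward f p y = (\<Sum>x\<in>{x. p x \<noteq> 0 \<and> f x = y}. if f x = y then p x else 0)"
    unfolding push_forward_def by (rule sum.cong) auto
  also have "\<dots> = (\<Sum>x\<in>S. if f x = y then p x else 0)"
    by (rule sum.mono_neutral_left) (use assms in auto)
  finally show ?thesis .
qed

lemma push_forward_simps:
  "p \<in> carrier (free_space X) \<Longrightarrow> q \<in> carrier (free_space X) \<Longrightarrow>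
    push_forward f (\<lambda>x. p x + q x) = (\<lambda>y. push_forward f p y + push_forward f q y)"
  "push_forward f (\<lambda>x. c * p x) = (\<lambda>y. c * push_forward f p y)"
  "push_forward f (delta x) = delta (f x)" "push_forward f (\<lambda>_. 0) = (\<lambda>_. 0)"
proof -
  assume "p \<in> carrier (free_space X)" "q \<in> carrier (free_space X)"
  then have fin: "finite ({x. p x \<noteq> 0} \<union> {x. q x \<noteq> 0})" by (auto simp: free_space_simps)
  show "push_forward f (\<lambda>x. p x + q x) = (\<lambda>y. push_forward f p y + push_forward f q y)"
  proof
    fix y
    have "push_forward f p y = (\<Sum>x\<in>{x. p x \<noteq> 0} \<union> {x. q x \<noteq> 0}. if f x = y then p x else 0)"
      "push_forward f q y = (\<Sum>x\<in>{x. p x \<noteq> 0} \<union> {x. q x \<noteq> 0}. if f x = y then q x else 0)"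
      "push_forward f (\<lambda>x. p x + q x) y = (\<Sum>x\<in>{x. p x \<noteq> 0} \<union> {x. q x \<noteq> 0}. if f x = y then p x + q x else 0)"
      by (rule push_forward_eq[OF fin]; auto)+
    then show "push_forward f (\<lambda>x. p x + q x) y = push_forward f p y + push_forward f q y"
      by (simp add: sum.distrib[symmetric] if_distrib cong: if_cong)
  qed
next
  show "push_forward f (\<lambda>x. c * p x) = (\<lambda>y. c * push_forward f p y)"
    by (cases "c = 0") (simp_all add: push_forward_def sum_distrib_left)
  show "push_forward f (delta x) = delta (f x)"
  proof
    fix y
    have "push_forward f (delta x) y = (\<Sum>z\<in>{x}. if f z = y then delta x z else 0)"
      by (rule push_forward_eq) (auto simp: delta_def)
    then show "push_forward f (delta x) y = delta (f x) y" by (simp add: delta_def)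
  qed
qed (simp add: push_forward_def)

lemma push_forward_closed:
  assumes "p \<in> carrier (free_space X)" "\<And>x. x \<in> X \<Longrightarrow> f x \<in> Y"
  shows "push_forward f p \<in> carrier (free_space Y)"
  using assms(1)
proof (induction p rule: free_space_induct)
  case (step c x q)
  have "(\<lambda>y. c * delta x y) \<in> carrier (free_space X)" using step.hyps by (intro free_space_closed delta_closed)
  moreover have "(\<lambda>y. c * delta (f x) y + push_forward f q y) \<in> carrier (free_space Y)"
    using step assms(2) by (intro free_space_closed delta_closed)
  ultimately show ?case using step by (simp add: push_forward_simps(1)[where X = X] push_forward_simps)
qed (simp add: push_forward_simps free_space_closed)

section \<open>The free algebra on words\<close>

definition conv :: "('l list \<Rightarrow> complex) \<Rightarrow> ('l list \<Rightarrow> complex) \<Rightarrow> 'l list \<Rightarrow> complex" where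
  "conv p q = (\<lambda>w. \<Sum>i\<le>length w. p (take i w) * q (drop i w))"

lemma conv_linear:
  "conv (\<lambda>w. p w + p' w) q = (\<lambda>w. conv p q w + conv p' q w)"
  "conv p (\<lambda>w. q w + q' w) = (\<lambda>w. conv p q w + conv p q' w)"
  "conv (\<lambda>w. c * p w) q = (\<lambda>w. c * conv p q w)" "conv p (\<lambda>w. c * q w) = (\<lambda>w. c * conv p q w)"
  "conv (\<lambda>_. 0) q = (\<lambda>_. 0)" "conv p (\<lambda>_. 0) = (\<lambda>_. 0)"
  by (simp_all add: conv_def fun_eq_iff algebra_simps sum.distrib sum_distrib_left)

lemma conv_delta: "conv (delta u) (delta v) = delta (u @ v)"
proof
  fix w
  have "conv (delta u) (delta v) w = (\<Sum>i\<le>length w. if i = length u then (if w = u @ v then 1 else 0) else 0)"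
    unfolding conv_def
  proof (rule sum.cong)
    fix i assume i: "i \<in> {..length w}"
    show "delta u (take i w) * delta v (drop i w) = (if i = length u then (if w = u @ v then 1 else 0) else 0)"
    proof (cases "i = length u")
      case True
      then have "w = u @ v \<longleftrightarrow> take i w = u \<and> drop i w = v" by (metis append_eq_conv_conj)
      with True show ?thesis by (auto simp: delta_def)
    next
      case False
      then have "take i w \<noteq> u" using i by auto
      with False show ?thesis by (simp add: delta_def)
    qed
  qed simp
  also have "\<dots> = delta (u @ v) w" by (auto simp: delta_def)
  finally show "conv (delta u) (delta v) w = delta (u @ v) w" .
qed

lemma free_algebra_simps:
  "carrier (free_algebra L) = carrier (free_space (lists (carrier L)))"
  "zero (free_algebra L) = (\<lambda>_. 0)" "add (free_algebra L) = (\<lambda>p q x. p x + q x)"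
  "module.smult (free_algebra L) = (\<lambda>c p x. c * p x)" "mult (free_algebra L) = conv" "one (free_algebra L) = delta []"
  by (simp_all add: free_algebra_def free_space_simps conv_def fun_eq_iff)

abbreviation words :: "('l, 'm) lie_algebra_scheme \<Rightarrow> ('l list \<Rightarrow> complex) set" where
  "words L \<equiv> carrier (free_space (lists (carrier L)))"

lemma module_free_algebra: "Module.module complex_ring (free_algebra L)"
  by (rule module_free_space) (simp_all add: free_algebra_simps free_space_simps(2-))

lemma free_algebra_minus: "p \<in> words L \<Longrightarrow> q \<in> words L \<Longrightarrow> p \<ominus>\<^bsub>free_algebra L\<^esub> q = (\<lambda>x. p x - q x)"
  by (rule free_space_minus) (simp_all add: free_algebra_simps free_space_simps(2-))

lemma conv_closed: "p \<in> carrier (free_space (lists X)) \<Longrightarrow> q \<in> carrier (free_space (lists X)) \<Longrightarrow> conv p q \<in> carrier (free_space (lists X))"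
proof (induction p rule: free_space_induct)
  case (step c u p)
  have "conv (delta u) q \<in> carrier (free_space (lists X))" using step.prems
  proof (induction q rule: free_space_induct)
    case (step d v q)
    then show ?case using \<open>u \<in> _\<close> by (simp add: conv_linear conv_delta free_space_closed delta_closed)
  qed (simp add: conv_linear free_space_closed)
  then show ?case using step by (simp add: conv_linear free_space_closed)
qed (simp add: conv_linear free_space_closed)

lemma conv_assoc: "p \<in> words L \<Longrightarrow> q \<in> words L \<Longrightarrow> r \<in> words L \<Longrightarrow> conv (conv p q) r = conv p (conv q r)"
proof (induction p rule: free_space_induct)
  case (step c u p)
  have "conv (conv (delta u) q) r = conv (delta u) (conv q r)" using step.prems
  proof (induction q rule: free_space_induct)
    case (step d v q)
    have "conv (conv (delta u) (delta v)) r = conv (delta u) (conv (delta v) r)" using step.prems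
      by (induction r rule: free_space_induct) (simp_all add: conv_linear conv_delta)
    then show ?case using step by (simp add: conv_linear)
  qed (simp add: conv_linear)
  then show ?case using step by (simp add: conv_linear)
qed (simp add: conv_linear)

lemma conv_one: "conv (delta []) p = p" "conv p (delta []) = p"
proof -
  have "conv (delta []) p w = (\<Sum>i\<le>length w. if i = 0 then p w else 0)" for w
    unfolding conv_def by (rule sum.cong) (auto simp: delta_def)
  then show "conv (delta []) p = p" by (simp add: fun_eq_iff)
  have "conv p (delta []) w = (\<Sum>i\<le>length w. if i = length w then p w else 0)" for w
    unfolding conv_def by (rule sum.cong) (auto simp: delta_def)
  then show "conv p (delta []) = p" by (simp add: fun_eq_iff)
qed

lemma ring_free_algebra: "ring (free_algebra L)"
proof -
  interpret Module.module complex_ring "free_algebra L" by (rule module_free_algebra)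
  show ?thesis
  proof (intro ringI abelian_group_axioms monoidI)
    fix p q r assume "p \<in> carrier (free_algebra L)" "q \<in> carrier (free_algebra L)" "r \<in> carrier (free_algebra L)"
    then show "p \<otimes>\<^bsub>free_algebra L\<^esub> q \<otimes>\<^bsub>free_algebra L\<^esub> r = p \<otimes>\<^bsub>free_algebra L\<^esub> (q \<otimes>\<^bsub>free_algebra L\<^esub> r)"
      using conv_assoc by (simp add: free_algebra_simps)
  qed (auto simp: free_algebra_simps conv_one conv_linear conv_closed delta_closed)
qed

section \<open>The enveloping algebra\<close>

context lie_algebra
begin

abbreviation "TL \<equiv> free_algebra L"
abbreviation "UL \<equiv> enveloping_algebra L"

lemma gen_closed: "x \<in> carrier L \<Longrightarrow> delta [x] \<in> words L"
  by (rule delta_closed) simp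

lemma minus_TL: "p \<in> words L \<Longrightarrow> q \<in> words L \<Longrightarrow> p \<ominus>\<^bsub>TL\<^esub> q = (\<lambda>w. p w - q w)"
  by (rule free_algebra_minus)

text \<open>The defining relations as explicit functions on words, so that actions and push-forwards
  can be evaluated on them.\<close>

definition rel_add where "rel_add x y = (\<lambda>w. delta [x \<oplus> y] w - (delta [x] w + delta [y] w :: complex))"
definition rel_smult where "rel_smult c x = (\<lambda>w. delta [c \<odot> x] w - (c * delta [x] w :: complex))"
definition rel_bracket where
  "rel_bracket x y = (\<lambda>w. (delta [x, y] w - delta [y, x] w) - (delta [bracket L x y] w :: complex))"

lemma env_relations_eq:
  "env_relations L = {rel_add x y | x y. x \<in> carrier L \<and> y \<in> carrier L} \<union> {rel_smult c x | c x. x \<in> carrier L} \<union>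
    {rel_bracket x y | x y. x \<in> carrier L \<and> y \<in> carrier L}"
proof -
  have 1: "delta [x \<oplus> y] \<ominus>\<^bsub>TL\<^esub> (delta [x] \<oplus>\<^bsub>TL\<^esub> delta [y]) = rel_add x y" if "x \<in> carrier L" "y \<in> carrier L" for x y
    using that by (subst minus_TL) (simp_all add: free_algebra_simps gen_closed free_space_closed rel_add_def)
  have 2: "delta [c \<odot> x] \<ominus>\<^bsub>TL\<^esub> (c \<odot>\<^bsub>TL\<^esub> delta [x]) = rel_smult c x" if "x \<in> carrier L" for c x
    using that by (subst minus_TL) (simp_all add: free_algebra_simps gen_closed free_space_closed rel_smult_def)
  have 3: "(delta [x] \<otimes>\<^bsub>TL\<^esub> delta [y] \<ominus>\<^bsub>TL\<^esub> delta [y] \<otimes>\<^bsub>TL\<^esub> delta [x]) \<ominus>\<^bsub>TL\<^esub> delta [bracket L x y] = rel_bracket x y"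
    if "x \<in> carrier L" "y \<in> carrier L" for x y
  proof -
    have w: "delta [x, y] \<in> words L" "delta [y, x] \<in> words L" using that by (auto intro!: delta_closed)
    have "(\<lambda>v. delta [x, y] v - delta [y, x] v) \<in> words L"
      using free_space_closed(1)[OF w(1) free_space_closed(2)[OF w(2), of "- 1"]] by simp
    then show ?thesis using that w
      by (simp add: free_algebra_simps conv_delta minus_TL gen_closed bracket_closed rel_bracket_def)
  qed
  show ?thesis unfolding env_relations_def Let_def
    by (intro arg_cong2[where f = "(\<union>)"] Collect_cong) (metis 1, metis 2, metis 3)
qed

lemma env_relations_closed: "env_relations L \<subseteq> words L"
proof -
  have minus: "(\<lambda>w. p w - q w) \<in> words L" if "p \<in> words L" "q \<in> words L" for p q
    using free_space_closed(1)[OF that(1) free_space_closed(2)[OF that(2), of "- 1"]] by simp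
  show ?thesis unfolding env_relations_eq
    by (auto simp: rel_add_def rel_smult_def rel_bracket_def intro!: minus free_space_closed delta_closed bracket_closed)
qed

lemma ideal_env_ideal: "ideal (env_ideal L) TL"
  unfolding env_ideal_def
  by (rule ring.genideal_ideal[OF ring_free_algebra]) (simp add: free_algebra_simps(1) env_relations_closed)

text \<open>Serves as an induction principle: the action on polynomials, the push-forward from sl2
  and the augmentation all descend to enveloping algebras through it.\<close>

lemma env_ideal_subset:
  assumes K: "K \<subseteq> words L" "(\<lambda>_. 0) \<in> K" "\<And>p q. p \<in> K \<Longrightarrow> q \<in> K \<Longrightarrow> (\<lambda>w. p w + q w) \<in> K"
    and mult: "\<And>p q. p \<in> K \<Longrightarrow> q \<in> words L \<Longrightarrow> conv q p \<in> K" "\<And>p q. p \<in> K \<Longrightarrow> q \<in> words L \<Longrightarrow> conv p q \<in> K"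
    and rels: "\<And>x y. x \<in> carrier L \<Longrightarrow> y \<in> carrier L \<Longrightarrow> rel_add x y \<in> K"
      "\<And>c x. x \<in> carrier L \<Longrightarrow> rel_smult c x \<in> K" "\<And>x y. x \<in> carrier L \<Longrightarrow> y \<in> carrier L \<Longrightarrow> rel_bracket x y \<in> K"
  shows "env_ideal L \<subseteq> K"
proof -
  interpret T: ring TL by (rule ring_free_algebra)
  have neg: "(\<lambda>w. - p w) \<in> K" if "p \<in> K" for p
  proof -
    \<comment> \<open>Negation is multiplication by minus the empty word, so closure under products
      covers it.\<close>
    have "(\<lambda>w. - 1 * delta [] w) \<in> words L" by (intro free_space_closed delta_closed) simp
    from mult(1)[OF that this] show ?thesis unfolding conv_linear(3) conv_one by simp
  qed
  have "ideal K TL"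
  proof (intro idealI ring_free_algebra T.add.subgroupI)
    fix p assume p: "p \<in> K"
    then have "(\<lambda>w. - p w) = \<ominus>\<^bsub>TL\<^esub> p"
      using K(1) neg[OF p] by (intro T.minus_equality[symmetric]) (auto simp: free_algebra_simps)
    with neg[OF p] show "\<ominus>\<^bsub>TL\<^esub> p \<in> K" by simp
  qed (use K mult in \<open>auto simp: free_algebra_simps\<close>)
  then show ?thesis unfolding env_ideal_def
    by (rule T.genideal_minimal) (auto simp: env_relations_eq rels)
qed

definition kap :: "('l list \<Rightarrow> complex) \<Rightarrow> ('l list \<Rightarrow> complex) set" where
  "kap p = env_ideal L +>\<^bsub>TL\<^esub> p"

lemma vs_coset_TL: "vs_coset TL (env_ideal L)"
proof -
  interpret I: ideal "env_ideal L" TL by (rule ideal_env_ideal)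
  interpret M: Module.module complex_ring TL by (rule module_free_algebra)
  show ?thesis
  proof (intro vs_coset.intro vs_coset_axioms.intro module_free_algebra submodule.intro submodule_axioms.intro I.a_subgroup)
    fix c p assume p: "p \<in> env_ideal L"
    \<comment> \<open>A ring ideal is also a subspace, because scalars are multiples of the empty
      word.\<close>
    have "(\<lambda>w. c * delta [] w) \<otimes>\<^bsub>TL\<^esub> p \<in> env_ideal L"
      using p by (intro I.I_l_closed) (auto simp: free_algebra_simps intro!: free_space_closed delta_closed)
    then show "c \<odot>\<^bsub>TL\<^esub> p \<in> env_ideal L" by (simp add: free_algebra_simps conv_linear conv_one)
  qed
qed

lemma UL_fields:
  "carrier UL = carrier (TL Quot env_ideal L)" "mult UL = mult (TL Quot env_ideal L)"
  "one UL = one (TL Quot env_ideal L)" "zero UL = zero (TL Quot env_ideal L)"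
  "add UL = add (TL Quot env_ideal L)"
  "module.smult UL = (\<lambda>c X. \<Union>p\<in>X. env_ideal L +>\<^bsub>TL\<^esub> (c \<odot>\<^bsub>TL\<^esub> p))"
  by (simp_all add: enveloping_algebra_def Let_def ring.defs module.defs)

lemma ring_UL: "ring UL"
proof -
  interpret Q: ring "TL Quot env_ideal L" by (rule ideal.quotient_is_ring[OF ideal_env_ideal])
  show ?thesis
  proof (intro ringI abelian_groupI monoidI)
    fix s assume "s \<in> carrier UL"
    then show "\<exists>t\<in>carrier UL. t \<oplus>\<^bsub>UL\<^esub> s = \<zero>\<^bsub>UL\<^esub>"
      using Q.l_neg Q.a_inv_closed by (auto simp: UL_fields)
  qed (auto simp: UL_fields Q.a_ac Q.m_assoc Q.l_distr Q.r_distr)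
qed

lemma carrier_UL: "carrier UL = kap ` words L"
  by (auto simp: UL_fields FactRing_def A_RCOSETS_def' kap_def free_algebra_simps)

lemma kap_hom:
  assumes "p \<in> words L" "q \<in> words L"
  shows "kap p \<oplus>\<^bsub>UL\<^esub> kap q = kap (\<lambda>w. p w + q w)" "kap p \<otimes>\<^bsub>UL\<^esub> kap q = kap (conv p q)"
proof -
  interpret I: ideal "env_ideal L" TL by (rule ideal_env_ideal)
  have h: "(+>\<^bsub>TL\<^esub>) (env_ideal L) \<in> ring_hom TL (TL Quot env_ideal L)" by (rule I.rcos_ring_hom)
  show "kap p \<oplus>\<^bsub>UL\<^esub> kap q = kap (\<lambda>w. p w + q w)" "kap p \<otimes>\<^bsub>UL\<^esub> kap q = kap (conv p q)"
    using ring_hom_add[OF h, of p q] ring_hom_mult[OF h, of p q] assms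
    by (simp_all add: UL_fields kap_def free_algebra_simps)
qed

lemma kap_one: "\<one>\<^bsub>UL\<^esub> = kap (delta [])"
  by (simp add: UL_fields FactRing_def kap_def free_algebra_simps)

lemma kap_smult:
  assumes "p \<in> words L" shows "c \<odot>\<^bsub>UL\<^esub> kap p = kap (\<lambda>w. c * p w)"
proof -
  interpret T: vs_coset TL "env_ideal L" by (rule vs_coset_TL)
  have "(\<Union>v\<in>env_ideal L +>\<^bsub>TL\<^esub> p. env_ideal L +>\<^bsub>TL\<^esub> (c \<odot>\<^bsub>TL\<^esub> v)) = env_ideal L +>\<^bsub>TL\<^esub> (c \<odot>\<^bsub>TL\<^esub> p)"
    using assms submodule.smult_closed[OF T.N, of c] T.smult_closed[of c] T.smult_r_distr[of c]
    by (intro T.Union_coset) (simp_all add: free_algebra_simps)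
  then show ?thesis by (simp add: UL_fields kap_def free_algebra_simps)
qed

lemma kap_eq_iff:
  assumes "p \<in> words L" "q \<in> words L" shows "kap p = kap q \<longleftrightarrow> (\<lambda>w. p w - q w) \<in> env_ideal L"
  unfolding kap_def using vs_coset.coset_eq_iff[OF vs_coset_TL, of p q] assms
  by (simp add: free_algebra_simps minus_TL)

lemma env_ideal_closed: "env_ideal L \<subseteq> words L"
  using ideal.Icarr[OF ideal_env_ideal] by (auto simp: free_algebra_simps(1)[symmetric])

lemma kap_mem: "p \<in> words L \<Longrightarrow> p' \<in> kap p \<Longrightarrow> p' \<in> words L \<and> kap p' = kap p"
proof -
  interpret T: vs_coset TL "env_ideal L" by (rule vs_coset_TL)
  interpret N: abelian_subgroup "env_ideal L" TL by (rule T.abelian_subgroup_N)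
  assume p: "p \<in> words L" "p' \<in> kap p"
  then have "p' \<in> carrier TL" using N.a_elemrcos_carrier[of p p'] by (simp add: kap_def free_algebra_simps)
  moreover have "kap p' = kap p"
    using N.a_repr_independence'[of p' p] p by (simp add: kap_def free_algebra_simps)
  ultimately show ?thesis by (simp add: free_algebra_simps)
qed

lemma kap_self: "p \<in> words L \<Longrightarrow> p \<in> kap p"
proof -
  interpret T: vs_coset TL "env_ideal L" by (rule vs_coset_TL)
  interpret N: abelian_subgroup "env_ideal L" TL by (rule T.abelian_subgroup_N)
  show "p \<in> words L \<Longrightarrow> p \<in> kap p" using N.a_rcos_self[of p] by (simp add: kap_def free_algebra_simps)
qed

lemma env_gen_kap: "env_gen L x = kap (delta [x])"
  by (simp add: env_gen_def kap_def)

lemma rels_in_ideal: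
  assumes "x \<in> carrier L" "y \<in> carrier L"
  shows "rel_add x y \<in> env_ideal L" "rel_smult c x \<in> env_ideal L" "rel_bracket x y \<in> env_ideal L"
proof -
  have "env_relations L \<subseteq> env_ideal L" unfolding env_ideal_def
    by (rule ring.genideal_self[OF ring_free_algebra]) (simp add: free_algebra_simps(1) env_relations_closed)
  then have sub: "r \<in> env_relations L \<Longrightarrow> r \<in> env_ideal L" for r by (rule subsetD)
  show "rel_add x y \<in> env_ideal L" "rel_smult c x \<in> env_ideal L" "rel_bracket x y \<in> env_ideal L"
    by (rule sub, unfold env_relations_eq Un_iff mem_Collect_eq, use assms in metis)+
qed

lemma env_gen_rels:
  assumes "x \<in> carrier L" "y \<in> carrier L"
  shows "env_gen L (x \<oplus> y) = env_gen L x \<oplus>\<^bsub>UL\<^esub> env_gen L y" "env_gen L (c \<odot> x) = c \<odot>\<^bsub>UL\<^esub> env_gen L x"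
    "env_gen L x \<otimes>\<^bsub>UL\<^esub> env_gen L y = env_gen L y \<otimes>\<^bsub>UL\<^esub> env_gen L x \<oplus>\<^bsub>UL\<^esub> env_gen L (bracket L x y)"
proof -
  note I = rels_in_ideal[OF assms]
  have g: "delta [x] \<in> words L" "delta [y] \<in> words L" "delta [x \<oplus> y] \<in> words L" "delta [c \<odot> x] \<in> words L"
    "delta [bracket L x y] \<in> words L" "delta [x, y] \<in> words L" "delta [y, x] \<in> words L"
    using assms bracket_closed by (auto intro!: delta_closed)
  have s: "(\<lambda>w. delta [x] w + delta [y] w) \<in> words L" "(\<lambda>w. c * delta [x] w) \<in> words L"
    "(\<lambda>w. delta [y, x] w + delta [bracket L x y] w) \<in> words L"
    by (intro free_space_closed g)+
  show "env_gen L (x \<oplus> y) = env_gen L x \<oplus>\<^bsub>UL\<^esub> env_gen L y"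
    using I(1) g s by (simp add: env_gen_kap kap_hom kap_eq_iff rel_add_def)
  show "env_gen L (c \<odot> x) = c \<odot>\<^bsub>UL\<^esub> env_gen L x"
    using I(2) g s by (simp add: env_gen_kap kap_smult kap_eq_iff rel_smult_def)
  show "env_gen L x \<otimes>\<^bsub>UL\<^esub> env_gen L y = env_gen L y \<otimes>\<^bsub>UL\<^esub> env_gen L x \<oplus>\<^bsub>UL\<^esub> env_gen L (bracket L x y)"
    using I(3) g s by (simp add: env_gen_kap kap_hom kap_eq_iff conv_delta rel_bracket_def diff_diff_eq)
qed

lemma env_gen_closed: "x \<in> carrier L \<Longrightarrow> env_gen L x \<in> carrier UL"
  by (simp add: env_gen_kap carrier_UL gen_closed)

lemma UL_smult:
  assumes "s \<in> carrier UL" "t \<in> carrier UL"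
  shows "c \<odot>\<^bsub>UL\<^esub> s \<in> carrier UL" "(c \<odot>\<^bsub>UL\<^esub> s) \<otimes>\<^bsub>UL\<^esub> t = c \<odot>\<^bsub>UL\<^esub> (s \<otimes>\<^bsub>UL\<^esub> t)"
    "s \<otimes>\<^bsub>UL\<^esub> (c \<odot>\<^bsub>UL\<^esub> t) = c \<odot>\<^bsub>UL\<^esub> (s \<otimes>\<^bsub>UL\<^esub> t)" "1 \<odot>\<^bsub>UL\<^esub> s = s" "0 \<odot>\<^bsub>UL\<^esub> s = \<zero>\<^bsub>UL\<^esub>"
    "(c + d) \<odot>\<^bsub>UL\<^esub> s = c \<odot>\<^bsub>UL\<^esub> s \<oplus>\<^bsub>UL\<^esub> d \<odot>\<^bsub>UL\<^esub> s" "(c * d) \<odot>\<^bsub>UL\<^esub> s = c \<odot>\<^bsub>UL\<^esub> (d \<odot>\<^bsub>UL\<^esub> s)"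
proof -
  interpret I: ideal "env_ideal L" TL by (rule ideal_env_ideal)
  obtain p q where pq: "p \<in> words L" "q \<in> words L" "s = kap p" "t = kap q" using assms by (auto simp: carrier_UL)
  have "\<zero>\<^bsub>UL\<^esub> = kap (\<lambda>_. 0)"
    using I.a_rcos_const[of "\<lambda>_. 0"] additive_subgroup.zero_closed[OF I.is_additive_subgroup] by (simp add: UL_fields FactRing_def kap_def free_algebra_simps)
  then show "c \<odot>\<^bsub>UL\<^esub> s \<in> carrier UL" "(c \<odot>\<^bsub>UL\<^esub> s) \<otimes>\<^bsub>UL\<^esub> t = c \<odot>\<^bsub>UL\<^esub> (s \<otimes>\<^bsub>UL\<^esub> t)"
    "s \<otimes>\<^bsub>UL\<^esub> (c \<odot>\<^bsub>UL\<^esub> t) = c \<odot>\<^bsub>UL\<^esub> (s \<otimes>\<^bsub>UL\<^esub> t)" "1 \<odot>\<^bsub>UL\<^esub> s = s" "0 \<odot>\<^bsub>UL\<^esub> s = \<zero>\<^bsub>UL\<^esub>"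
    "(c + d) \<odot>\<^bsub>UL\<^esub> s = c \<odot>\<^bsub>UL\<^esub> s \<oplus>\<^bsub>UL\<^esub> d \<odot>\<^bsub>UL\<^esub> s" "(c * d) \<odot>\<^bsub>UL\<^esub> s = c \<odot>\<^bsub>UL\<^esub> (d \<odot>\<^bsub>UL\<^esub> s)"
    using pq by (simp_all add: kap_smult kap_hom conv_closed conv_linear free_space_closed carrier_UL distrib_right mult.assoc)
qed


end

section \<open>The symmetric algebra inside the enveloping algebra\<close>

text \<open>Homomorphisms from a type-class ring, here polynomials, to a record ring, here the
  enveloping algebra.\<close>

definition type_ring_hom :: "('a::comm_ring_1 \<Rightarrow> 'r) \<Rightarrow> ('r, 'm) ring_scheme \<Rightarrow> bool" where
  "type_ring_hom \<phi> R \<longleftrightarrow> (\<forall>a. \<phi> a \<in> carrier R) \<and> \<phi> 0 = \<zero>\<^bsub>R\<^esub> \<and> \<phi> 1 = \<one>\<^bsub>R\<^esub> \<and>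
    (\<forall>a b. \<phi> (a + b) = \<phi> a \<oplus>\<^bsub>R\<^esub> \<phi> b) \<and> (\<forall>a b. \<phi> (a * b) = \<phi> a \<otimes>\<^bsub>R\<^esub> \<phi> b)"

definition poly_hom :: "('r, 'm) ring_scheme \<Rightarrow> ('a::comm_ring_1 \<Rightarrow> 'r) \<Rightarrow> 'r \<Rightarrow> 'a poly \<Rightarrow> 'r" where
  "poly_hom R \<phi> v p = fold_coeffs (\<lambda>a s. \<phi> a \<oplus>\<^bsub>R\<^esub> v \<otimes>\<^bsub>R\<^esub> s) p \<zero>\<^bsub>R\<^esub>"

text \<open>Horner evaluation in a noncommutative ring is multiplicative because \<open>v\<close>
  commutes with the image of the coefficients. The last claim passes commutation on to the next
  variable, so that the construction can be iterated.\<close>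

lemma poly_hom:
  fixes \<phi> :: "'a::comm_ring_1 \<Rightarrow> 'r"
  assumes R: "ring R" and \<phi>: "type_ring_hom \<phi> R" and v: "v \<in> carrier R" and comm: "\<And>a. v \<otimes>\<^bsub>R\<^esub> \<phi> a = \<phi> a \<otimes>\<^bsub>R\<^esub> v"
  shows "type_ring_hom (poly_hom R \<phi> v) R" "poly_hom R \<phi> v [:a:] = \<phi> a" "poly_hom R \<phi> v [:0, 1:] = v"
    "z \<in> carrier R \<Longrightarrow> z \<otimes>\<^bsub>R\<^esub> v = v \<otimes>\<^bsub>R\<^esub> z \<Longrightarrow> (\<And>a. z \<otimes>\<^bsub>R\<^esub> \<phi> a = \<phi> a \<otimes>\<^bsub>R\<^esub> z) \<Longrightarrow>
      z \<otimes>\<^bsub>R\<^esub> poly_hom R \<phi> v p = poly_hom R \<phi> v p \<otimes>\<^bsub>R\<^esub> z"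
proof -
  interpret ring R by (rule R)
  let ?h = "poly_hom R \<phi> v"
  have \<phi>': "\<phi> a \<in> carrier R" "\<phi> 0 = \<zero>\<^bsub>R\<^esub>" "\<phi> 1 = \<one>\<^bsub>R\<^esub>" "\<phi> (a + b) = \<phi> a \<oplus>\<^bsub>R\<^esub> \<phi> b" "\<phi> (a * b) = \<phi> a \<otimes>\<^bsub>R\<^esub> \<phi> b" for a b
    using \<phi> by (auto simp: type_ring_hom_def)
  have zero: "?h 0 = \<zero>\<^bsub>R\<^esub>" by (simp add: poly_hom_def)
  have h_pCons: "?h (pCons a p) = \<phi> a \<oplus>\<^bsub>R\<^esub> v \<otimes>\<^bsub>R\<^esub> ?h p" for a p
    by (cases "a = 0 \<and> p = 0") (auto simp: poly_hom_def fold_coeffs_def cCons_def \<phi>' v)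
  have closed: "?h p \<in> carrier R" for p
    by (induction p) (simp_all add: zero h_pCons \<phi>' v)
  have add: "?h (p + q) = ?h p \<oplus>\<^bsub>R\<^esub> ?h q" for p q
  proof (induction p arbitrary: q)
    case 0 then show ?case by (simp add: zero closed)
  next
    case (pCons a p)
    obtain b r where q: "q = pCons b r" by (cases q)
    show ?case unfolding q by (simp add: h_pCons pCons.IH \<phi>' v closed r_distr a_ac)
  qed
  have scale: "?h (smult a q) = \<phi> a \<otimes>\<^bsub>R\<^esub> ?h q" for a q
  proof (induction q)
    case 0 then show ?case by (simp add: zero \<phi>')
  next
    case (pCons b q)
    have "v \<otimes>\<^bsub>R\<^esub> (\<phi> a \<otimes>\<^bsub>R\<^esub> ?h q) = \<phi> a \<otimes>\<^bsub>R\<^esub> (v \<otimes>\<^bsub>R\<^esub> ?h q)"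
      using comm[of a] by (metis \<phi>'(1) v closed m_assoc)
    then show ?case by (simp add: h_pCons pCons.IH \<phi>' v closed r_distr)
  qed
  have mult: "?h (p * q) = ?h p \<otimes>\<^bsub>R\<^esub> ?h q" for p q
  proof (induction p)
    case 0 then show ?case by (simp add: zero closed)
  next
    case (pCons a p)
    show ?case by (simp add: add scale h_pCons pCons.IH zero \<phi>' v closed l_distr m_assoc)
  qed
  show 1: "?h [:a:] = \<phi> a" for a by (simp add: h_pCons zero v \<phi>')
  show "?h [:0, 1:] = v" by (simp add: h_pCons zero v \<phi>')
  show "type_ring_hom ?h R" unfolding type_ring_hom_def
    using 1[of 1] by (simp add: closed zero add mult one_pCons[symmetric] \<phi>')
  assume z: "z \<in> carrier R" "z \<otimes>\<^bsub>R\<^esub> v = v \<otimes>\<^bsub>R\<^esub> z" "\<And>a. z \<otimes>\<^bsub>R\<^esub> \<phi> a = \<phi> a \<otimes>\<^bsub>R\<^esub> z"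
  show "z \<otimes>\<^bsub>R\<^esub> ?h p = ?h p \<otimes>\<^bsub>R\<^esub> z"
  proof (induction p)
    case 0 then show ?case by (simp add: zero z)
  next
    case (pCons a p)
    have "z \<otimes>\<^bsub>R\<^esub> (v \<otimes>\<^bsub>R\<^esub> ?h p) = v \<otimes>\<^bsub>R\<^esub> ?h p \<otimes>\<^bsub>R\<^esub> z"
      by (metis z(1,2) v closed m_assoc pCons.IH)
    then show ?case by (simp add: h_pCons z \<phi>' v closed r_distr l_distr)
  qed
qed

interpretation L3: lie_algebra L3 by (rule lie_algebra_L3)
interpretation U3: ring "enveloping_algebra L3" by (rule L3.ring_UL)
interpretation sl2: lie_algebra sl2 by (rule lie_algebra_sl2)

abbreviation "U3 \<equiv> enveloping_algebra L3"
abbreviation rgen :: "nat \<Rightarrow> U_L3" where "rgen k \<equiv> env_gen L3 (rad_vec k)"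

lemma rad_vec_closed: "k \<le> 3 \<Longrightarrow> rad_vec k \<in> carrier L3"
  by (auto simp: L3_ops rad_vec_def delta_def trace_def sum_2)

lemma rgen_closed: "k \<le> 3 \<Longrightarrow> rgen k \<in> carrier U3"
  by (intro L3.env_gen_closed rad_vec_closed)

lemma rgen_commute:
  assumes "j \<le> 3" "k \<le> 3" shows "rgen j \<otimes>\<^bsub>U3\<^esub> rgen k = rgen k \<otimes>\<^bsub>U3\<^esub> rgen j"
proof -
  have r: "rad_vec j \<in> carrier L3" "rad_vec k \<in> carrier L3" using assms rad_vec_closed by auto
  have "bracket L3 (rad_vec j) (rad_vec k) = 0 \<odot>\<^bsub>L3\<^esub> rad_vec j"
    using bracket_rad_vec(8)[OF assms] L3.smult_l_null[OF r(1)] by simp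
  then have "env_gen L3 (bracket L3 (rad_vec j) (rad_vec k)) = \<zero>\<^bsub>U3\<^esub>"
    using L3.env_gen_rels(2)[OF r(1) r(1), of 0] L3.UL_smult(5)[OF rgen_closed rgen_closed, of j j] assms by simp
  then show ?thesis using L3.env_gen_rels(3)[OF r] rgen_closed assms by simp
qed

definition scal :: "complex \<Rightarrow> U_L3" where "scal c = c \<odot>\<^bsub>U3\<^esub> \<one>\<^bsub>U3\<^esub>"

lemma scal_mult:
  assumes "s \<in> carrier U3" shows "scal c \<otimes>\<^bsub>U3\<^esub> s = c \<odot>\<^bsub>U3\<^esub> s" "s \<otimes>\<^bsub>U3\<^esub> scal c = c \<odot>\<^bsub>U3\<^esub> s"
  using assms by (simp_all add: scal_def L3.UL_smult)

lemma scal_closed: "scal c \<in> carrier U3"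
  unfolding scal_def by (rule L3.UL_smult(1)[OF U3.one_closed U3.one_closed])

lemma type_ring_hom_scal: "type_ring_hom scal U3"
  unfolding type_ring_hom_def using scal_mult(1)[OF scal_closed] scal_closed
  by (auto simp: scal_def L3.UL_smult[OF U3.one_closed U3.one_closed])

text \<open>The radical is abelian, so the variables w, z, y, x can be adjoined one after another to
  map the symmetric algebra into U(L3).\<close>

definition sig0 where "sig0 = poly_hom U3 scal (rgen 0)"
definition sig1 where "sig1 = poly_hom U3 sig0 (rgen 1)"
definition sig2 where "sig2 = poly_hom U3 sig1 (rgen 2)"

definition sig :: "quartic_ring \<Rightarrow> U_L3" where "sig = poly_hom U3 sig2 (rgen 3)"

lemma sig_hom: "type_ring_hom sig U3"
  and sig_gens: "sig px = rgen 3" "sig py = rgen 2" "sig pz = rgen 1" "sig pw = rgen 0" "sig (cst c) = c \<odot>\<^bsub>U3\<^esub> \<one>\<^bsub>U3\<^esub>"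
proof -
  have c0: "rgen k \<otimes>\<^bsub>U3\<^esub> scal a = scal a \<otimes>\<^bsub>U3\<^esub> rgen k" if "k \<le> 3" for k a
    using rgen_closed[OF that] by (simp add: scal_mult)
  note h0 = poly_hom[OF L3.ring_UL type_ring_hom_scal rgen_closed[of 0] c0[of 0], folded sig0_def, simplified]
  have c1: "rgen k \<otimes>\<^bsub>U3\<^esub> sig0 a = sig0 a \<otimes>\<^bsub>U3\<^esub> rgen k" if "k \<le> 3" for k a
    using h0(4)[OF rgen_closed[OF that] rgen_commute[OF that, of 0] c0[OF that]] by simp
  note h1 = poly_hom[OF L3.ring_UL h0(1) rgen_closed[of 1] c1[of 1], folded sig1_def, simplified]
  have c2: "rgen k \<otimes>\<^bsub>U3\<^esub> sig1 a = sig1 a \<otimes>\<^bsub>U3\<^esub> rgen k" if "k \<le> 3" for k a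
    using h1(4)[OF rgen_closed[OF that] rgen_commute[OF that, of 1, simplified] c1[OF that]] by simp
  note h2 = poly_hom[OF L3.ring_UL h1(1) rgen_closed[of 2] c2[of 2], folded sig2_def, simplified]
  have c3: "rgen k \<otimes>\<^bsub>U3\<^esub> sig2 a = sig2 a \<otimes>\<^bsub>U3\<^esub> rgen k" if "k \<le> 3" for k a
    using h2(4)[OF rgen_closed[OF that] rgen_commute[OF that, of 2, simplified] c2[OF that]] by simp
  note h3 = poly_hom[OF L3.ring_UL h2(1) rgen_closed[of 3] c3[of 3], folded sig_def, simplified]
  show "type_ring_hom sig U3" by (rule h3(1))
  show "sig px = rgen 3" "sig py = rgen 2" "sig pz = rgen 1" "sig pw = rgen 0" "sig (cst c) = c \<odot>\<^bsub>U3\<^esub> \<one>\<^bsub>U3\<^esub>"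
    by (simp_all add: px_def py_def pz_def pw_def cst_def h0 h1 h2 h3 scal_def)
qed

lemma sig_simps:
  "sig p \<in> carrier U3" "sig 0 = \<zero>\<^bsub>U3\<^esub>" "sig 1 = \<one>\<^bsub>U3\<^esub>" "sig (p + q) = sig p \<oplus>\<^bsub>U3\<^esub> sig q"
  "sig (p * q) = sig p \<otimes>\<^bsub>U3\<^esub> sig q" "sig (cst c * p) = c \<odot>\<^bsub>U3\<^esub> sig p"
  using sig_hom L3.UL_smult[of "\<one>\<^bsub>U3\<^esub>" "sig p"] sig_gens(5)[of c] by (auto simp: type_ring_hom_def)

lemma sig_minus: "sig (p - q) = sig p \<ominus>\<^bsub>U3\<^esub> sig q"
proof -
  have "sig (- q) = \<ominus>\<^bsub>U3\<^esub> sig q"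
    using sig_simps(4)[of "- q" q] by (intro U3.minus_equality[symmetric]) (simp_all add: sig_simps)
  then show ?thesis using sig_simps(4)[of p "- q"] by (simp add: a_minus_def)
qed

lemma sig_power: "sig (p ^ n) = sig p [^]\<^bsub>U3\<^esub> n"
  by (induction n) (simp_all add: sig_simps power_Suc2 del: power_Suc)

lemma sig_numeral: "sig (numeral k * p) = numeral k \<odot>\<^bsub>U3\<^esub> sig p"
  using sig_simps(6)[of "numeral k" p] by (simp add: cst_simps)

lemma sig_disc: "sig (disc - cst chi) = cubic_discriminant \<ominus>\<^bsub>U3\<^esub> (chi \<odot>\<^bsub>U3\<^esub> \<one>\<^bsub>U3\<^esub>)"
proof -
  \<comment> \<open>Numerical factors are moved to the front and products grouped as in
    \<open>cubic_discriminant\<close>, so that the homomorphism laws produce it literally.\<close>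
  have d: "disc = pz ^ 2 * py ^ 2 - 27 * (pw ^ 2 * px ^ 2) - 4 * (pz ^ 3 * px) - 4 * (pw * py ^ 3) + 18 * (pw * pz * py * px)"
    by (simp add: disc_def mult.assoc)
  have "sig disc = cubic_discriminant"
    unfolding d cubic_discriminant_def Let_def sig_minus sig_simps(4) sig_numeral
    unfolding sig_simps(5) sig_power sig_gens ..
  then show ?thesis by (simp add: sig_minus sig_gens)
qed

lemma env_gen_radical:
  assumes "u \<in> carrier (simple_sl2 3)" shows "env_gen L3 (0, u) = sig (lin_form u)"
proof -
  have r: "rad_vec k \<in> carrier L3" if "k \<le> 3" for k using rad_vec_closed that by blast
  have "(0, u) = u 0 \<odot>\<^bsub>L3\<^esub> rad_vec 0 \<oplus>\<^bsub>L3\<^esub> (u 1 \<odot>\<^bsub>L3\<^esub> rad_vec 1 \<oplus>\<^bsub>L3\<^esub>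
      (u 2 \<odot>\<^bsub>L3\<^esub> rad_vec 2 \<oplus>\<^bsub>L3\<^esub> u 3 \<odot>\<^bsub>L3\<^esub> rad_vec 3))"
  proof -
    have k: "u k = u 0 * delta 0 k + (u 1 * delta 1 k + (u 2 * delta 2 k + u 3 * delta 3 k))" for k
    proof (cases "k \<le> 3")
      case True
      then have "k = 0 \<or> k = 1 \<or> k = 2 \<or> k = 3" by auto
      then show ?thesis by (auto simp: delta_def)
    next
      case False
      then show ?thesis using assms by (auto simp: simple_sl2_simps delta_def)
    qed
    show ?thesis
    proof (rule prod_eqI)
      show "snd (0 :: mat2, u) = snd (u 0 \<odot>\<^bsub>L3\<^esub> rad_vec 0 \<oplus>\<^bsub>L3\<^esub> (u 1 \<odot>\<^bsub>L3\<^esub> rad_vec 1 \<oplus>\<^bsub>L3\<^esub>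
          (u 2 \<odot>\<^bsub>L3\<^esub> rad_vec 2 \<oplus>\<^bsub>L3\<^esub> u 3 \<odot>\<^bsub>L3\<^esub> rad_vec 3)))"
        by (rule ext) (simp only: L3_ops rad_vec_def fst_conv snd_conv, rule k)
    qed (simp add: L3_ops rad_vec_def vec_eq_iff)
  qed
  moreover have "env_gen L3 (c \<odot>\<^bsub>L3\<^esub> rad_vec k) = c \<odot>\<^bsub>U3\<^esub> rgen k" if "k \<le> 3" for c k
    by (rule L3.env_gen_rels(2)[OF r[OF that] r[OF that]])
  moreover have "c \<odot>\<^bsub>L3\<^esub> rad_vec k \<in> carrier L3" if "k \<le> 3" for c k using L3.smult_closed[of c] r that by simp
  ultimately have "env_gen L3 (0, u) = u 0 \<odot>\<^bsub>U3\<^esub> rgen 0 \<oplus>\<^bsub>U3\<^esub> (u 1 \<odot>\<^bsub>U3\<^esub> rgen 1 \<oplus>\<^bsub>U3\<^esub>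
      (u 2 \<odot>\<^bsub>U3\<^esub> rgen 2 \<oplus>\<^bsub>U3\<^esub> u 3 \<odot>\<^bsub>U3\<^esub> rgen 3))"
    by (simp add: L3.env_gen_rels(1))
  moreover have "lin_form u = cst (u 0) * pw + (cst (u 1) * pz + (cst (u 2) * py + cst (u 3) * px))"
    by (simp add: lin_form_def algebra_simps)
  ultimately show ?thesis by (simp add: sig_simps(4,6) sig_gens)
qed

section \<open>The action of the enveloping algebra on the symmetric algebra\<close>

definition word_act :: "L3_elem list \<Rightarrow> quartic_ring \<Rightarrow> quartic_ring" where
  "word_act w q = foldr quartic_act w q"

lemma word_act_simps:
  "word_act [] q = q" "word_act (x # w) q = quartic_act x (word_act w q)"
  "word_act (v @ w) q = word_act v (word_act w q)"
  "word_act w (p + q) = word_act w p + word_act w q" "word_act w (cst c * p) = cst c * word_act w p" "word_act w 0 = 0"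
  by (induction w) (simp_all add: word_act_def quartic_act_simps)

definition tact :: "(L3_elem list \<Rightarrow> complex) \<Rightarrow> quartic_ring \<Rightarrow> quartic_ring" where
  "tact p q = lin_ext (\<lambda>w. word_act w q) p"

lemma tact_simps:
  "p \<in> words L3 \<Longrightarrow> p' \<in> words L3 \<Longrightarrow> tact (\<lambda>w. p w + p' w) q = tact p q + tact p' q"
  "tact (\<lambda>w. c * p w) q = cst c * tact p q" "tact (delta w) q = word_act w q" "tact (\<lambda>_. 0) q = 0"
  "tact p (q + q') = tact p q + tact p q'" "tact p (cst c * q) = cst c * tact p q" "tact p 0 = 0"
  unfolding tact_def lin_ext_delta lin_ext_zero lin_ext_scale
  by (simp_all add: lin_ext_add) (simp_all add: lin_ext_def word_act_simps distrib_left sum.distrib sum_distrib_left mult.left_commute)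

lemma tact_diff:
  assumes "p \<in> words L3" "p' \<in> words L3" shows "tact (\<lambda>w. p w - p' w) q = tact p q - tact p' q"
  using tact_simps(1)[OF assms(1) free_space_closed(2)[OF assms(2), of "- 1"], of q] tact_simps(2)[of "- 1" p' q]
  by (simp add: cst_simps)

lemma tact_conv:
  "p \<in> words L3 \<Longrightarrow> p' \<in> words L3 \<Longrightarrow> tact (conv p p') q = tact p (tact p' q)"
proof (induction p rule: free_space_induct)
  case (step c u p)
  have "conv (delta u) p' \<in> words L3 \<and> tact (conv (delta u) p') q = word_act u (tact p' q)" using step.prems
  proof (induction p' rule: free_space_induct)
    case (step d v p')
    have "delta (u @ v) \<in> words L3" using \<open>u \<in> _\<close> \<open>v \<in> _\<close> by (intro delta_closed) auto
    then show ?case using step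
      by (simp add: conv_linear conv_delta free_space_closed tact_simps word_act_simps delta_closed)
  qed (simp add: conv_linear tact_simps word_act_simps free_space_closed)
  then show ?case using step
    by (simp add: conv_linear conv_closed tact_simps free_space_closed delta_closed)
qed (simp add: conv_linear tact_simps)

text \<open>The operators \<open>quartic_act\<close> are linear in the Lie algebra element and
  respect brackets, so the defining relations act by zero and the action descends to U(L3).\<close>

lemma tact_env_ideal: "p \<in> env_ideal L3 \<Longrightarrow> tact p q = 0"
proof -
  have "env_ideal L3 \<subseteq> {p \<in> words L3. \<forall>q. tact p q = 0}"
  proof (rule L3.env_ideal_subset)
    fix x y c assume xy: "x \<in> carrier L3" "y \<in> carrier L3"
    have g: "delta [x] \<in> words L3" "delta [y] \<in> words L3" "delta [x \<oplus>\<^bsub>L3\<^esub> y] \<in> words L3"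
      "delta [bracket L3 x y] \<in> words L3" "delta [x, y] \<in> words L3" "delta [y, x] \<in> words L3"
      using xy L3.a_closed[OF xy] L3.bracket_closed[OF xy] by (auto intro!: delta_closed)
    show "L3.rel_add x y \<in> {p \<in> words L3. \<forall>q. tact p q = 0}" "L3.rel_bracket x y \<in> {p \<in> words L3. \<forall>q. tact p q = 0}"
      using L3.rels_in_ideal[OF xy] L3.env_ideal_closed g
      by (auto simp: L3.rel_add_def L3.rel_bracket_def tact_diff tact_simps word_act_simps free_space_closed
          quartic_act_simps quartic_act_bracket[OF xy] free_space_minus_closed)
  next
    fix x and c :: complex assume x: "x \<in> carrier L3"
    have g: "delta [x] \<in> words L3" "delta [c \<odot>\<^bsub>L3\<^esub> x] \<in> words L3"
      using x L3.smult_closed[of c x] by (auto intro!: delta_closed)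
    show "L3.rel_smult c x \<in> {p \<in> words L3. \<forall>q. tact p q = 0}"
      using L3.rels_in_ideal(2)[OF x x] L3.env_ideal_closed g
      by (auto simp: L3.rel_smult_def tact_diff tact_simps word_act_simps free_space_closed quartic_act_simps)
  qed (auto simp: free_space_closed tact_simps conv_closed tact_conv)
  then show "p \<in> env_ideal L3 \<Longrightarrow> tact p q = 0" by blast
qed

definition uact :: "U_L3 \<Rightarrow> quartic_ring \<Rightarrow> quartic_ring" where
  "uact s = tact (SOME p. p \<in> s)"

lemma uact_kap: "p \<in> words L3 \<Longrightarrow> uact (L3.kap p) q = tact p q"
proof -
  assume p: "p \<in> words L3"
  define p' where "p' = (SOME p'. p' \<in> L3.kap p)"
  have "p' \<in> L3.kap p" unfolding p'_def by (rule someI[of _ p]) (rule L3.kap_self[OF p])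
  from L3.kap_mem[OF p this] have p': "p' \<in> words L3" "L3.kap p' = L3.kap p" by auto
  then have "tact p' q - tact p q = 0"
    using tact_env_ideal[of "\<lambda>w. p' w - p w" q] p by (simp add: L3.kap_eq_iff tact_diff)
  then show ?thesis by (simp add: uact_def p'_def)
qed

lemma uact_simps:
  assumes "s \<in> carrier U3" "t \<in> carrier U3"
  shows "uact (s \<oplus>\<^bsub>U3\<^esub> t) q = uact s q + uact t q" "uact (c \<odot>\<^bsub>U3\<^esub> s) q = cst c * uact s q"
    "uact (s \<otimes>\<^bsub>U3\<^esub> t) q = uact s (uact t q)" "uact s (cst c * q) = cst c * uact s q"
  using assms by (auto simp: L3.carrier_UL L3.kap_hom L3.kap_smult uact_kap tact_simps tact_conv free_space_closed conv_closed)

lemma uact_one: "uact \<one>\<^bsub>U3\<^esub> q = q"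
  using uact_kap[of "delta []" q] by (simp add: L3.kap_one delta_closed tact_simps word_act_simps)

lemma uact_gen: "x \<in> carrier L3 \<Longrightarrow> uact (env_gen L3 x) q = quartic_act x q"
  using uact_kap[of "delta [x]" q] by (simp add: L3.env_gen_kap delta_closed tact_simps word_act_simps)

text \<open>Evaluation on the polynomial 1 is a left inverse of \<open>sig\<close>; the injectivity
  of \<open>pi0\<close> rests on it.\<close>

lemma uact_sig: "uact (sig p) 1 = p"
proof (induction p rule: quartic_induct)
  case (cst c)
  then show ?case by (simp add: sig_gens uact_simps(2)[OF U3.one_closed U3.one_closed] uact_one)
qed (simp_all add: sig_simps uact_simps sig_gens rgen_closed uact_gen rad_vec_closed quartic_act_rad_vec quartic_act_rad_vec(2)[simplified])

section \<open>The inclusion of sl2 and the trivial module\<close>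

lemma push_conv:
  assumes "p \<in> carrier (free_space (lists X))" "q \<in> carrier (free_space (lists X))"
  shows "push_forward (map f) (conv p q) = conv (push_forward (map f) p) (push_forward (map f) q)"
proof -
  note ps = push_forward_simps(1)[where X = "lists X"] push_forward_simps(2-)
  show ?thesis using assms
  proof (induction p rule: free_space_induct)
    case (step c u p)
    have "push_forward (map f) (conv (delta u) q) = conv (delta (map f u)) (push_forward (map f) q)" using step.prems
    proof (induction q rule: free_space_induct)
      case (step d v q)
      have "delta (u @ v) \<in> carrier (free_space (lists X))" using \<open>u \<in> _\<close> \<open>v \<in> _\<close> by (intro delta_closed) auto
      then show ?case using step conv_closed[OF delta_closed[OF \<open>u \<in> _\<close>], of q]
        by (simp add: conv_linear conv_delta ps free_space_closed delta_closed)
    qed (simp add: conv_linear ps)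
    then show ?case using step conv_closed[OF delta_closed[OF \<open>u \<in> _\<close>], of q] conv_closed[of p X q]
      by (simp add: conv_linear ps free_space_closed delta_closed)
  qed (simp add: conv_linear ps)
qed

lemma sl2_incl_hom:
  "sl2_incl (X \<oplus>\<^bsub>sl2\<^esub> Y) = sl2_incl X \<oplus>\<^bsub>L3\<^esub> sl2_incl Y" "sl2_incl (c \<odot>\<^bsub>sl2\<^esub> X) = c \<odot>\<^bsub>L3\<^esub> sl2_incl X"
  "sl2_incl (bracket sl2 X Y) = bracket L3 (sl2_incl X) (sl2_incl Y)"
proof -
  have "(\<lambda>_. 0) \<in> carrier (simple_sl2 3)" by (simp add: simple_sl2_simps)
  then show "sl2_incl (bracket sl2 X Y) = bracket L3 (sl2_incl X) (sl2_incl Y)"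
    by (simp add: sl2_incl_def bracket_L3) (simp add: simple_sl2_def fun_eq_iff)
qed (simp_all add: sl2_incl_def L3_ops sl2_simps)

abbreviation push_sl2 :: "(mat2 list \<Rightarrow> complex) \<Rightarrow> L3_elem list \<Rightarrow> complex" where
  "push_sl2 \<equiv> push_forward (map sl2_incl)"

lemma push_sl2_closed: "p \<in> words sl2 \<Longrightarrow> push_sl2 p \<in> words L3"
  by (rule push_forward_closed) (use sl2_incl_closed in auto)

lemma push_sl2_diff:
  assumes "p \<in> words sl2" "q \<in> words sl2" shows "push_sl2 (\<lambda>w. p w - q w) = (\<lambda>w. push_sl2 p w - push_sl2 q w)"
  using push_forward_simps(1)[OF assms(1) free_space_closed(2)[OF assms(2), of "- 1"], of "map sl2_incl"]
    push_forward_simps(2)[of "map sl2_incl" "- 1" q] by simp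

text \<open>\<open>sl2_incl\<close> is linear and preserves brackets, so relations go to relations;
  \<open>env_map\<close> is thereby independent of representatives.\<close>

lemma push_sl2_ideal: "p \<in> env_ideal sl2 \<Longrightarrow> push_sl2 p \<in> env_ideal L3"
proof -
  interpret I: ideal "env_ideal L3" "free_algebra L3" by (rule L3.ideal_env_ideal)
  note ps = push_forward_simps(1)[where X = "lists (carrier sl2)"] push_forward_simps(2-)
  have "env_ideal sl2 \<subseteq> {p \<in> words sl2. push_sl2 p \<in> env_ideal L3}"
  proof (rule sl2.env_ideal_subset)
    fix X Y assume XY: "X \<in> carrier sl2" "Y \<in> carrier sl2"
    have g: "delta [X] \<in> words sl2" "delta [Y] \<in> words sl2" "delta [X \<oplus>\<^bsub>sl2\<^esub> Y] \<in> words sl2"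
      "delta [bracket sl2 X Y] \<in> words sl2" "delta [X, Y] \<in> words sl2" "delta [Y, X] \<in> words sl2"
      using XY sl2.a_closed[OF XY] sl2.bracket_closed[OF XY] by (auto intro!: delta_closed)
    have "push_sl2 (sl2.rel_add X Y) = L3.rel_add (sl2_incl X) (sl2_incl Y)"
      "push_sl2 (sl2.rel_bracket X Y) = L3.rel_bracket (sl2_incl X) (sl2_incl Y)"
      unfolding sl2.rel_add_def L3.rel_add_def sl2.rel_bracket_def L3.rel_bracket_def
      using g by (simp_all add: push_sl2_diff free_space_closed ps sl2_incl_hom free_space_minus_closed)
    then show "sl2.rel_add X Y \<in> {p \<in> words sl2. push_sl2 p \<in> env_ideal L3}"
      "sl2.rel_bracket X Y \<in> {p \<in> words sl2. push_sl2 p \<in> env_ideal L3}"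
      using L3.rels_in_ideal[OF sl2_incl_closed[OF XY(1)] sl2_incl_closed[OF XY(2)]]
        sl2.rels_in_ideal[OF XY] sl2.env_ideal_closed by auto
  next
    fix X and c :: complex assume X: "X \<in> carrier sl2"
    have g: "delta [X] \<in> words sl2" "delta [c \<odot>\<^bsub>sl2\<^esub> X] \<in> words sl2"
      using X sl2.smult_closed[of c X] by (auto intro!: delta_closed)
    have "push_sl2 (sl2.rel_smult c X) = L3.rel_smult c (sl2_incl X)"
      unfolding sl2.rel_smult_def L3.rel_smult_def
      using g by (simp_all add: push_sl2_diff free_space_closed ps sl2_incl_hom)
    then show "sl2.rel_smult c X \<in> {p \<in> words sl2. push_sl2 p \<in> env_ideal L3}"
      using L3.rels_in_ideal(2)[OF sl2_incl_closed[OF X] sl2_incl_closed[OF X]] sl2.rels_in_ideal(2)[OF X X]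
        sl2.env_ideal_closed by auto
  next
    show "(\<lambda>_. 0) \<in> {p \<in> words sl2. push_sl2 p \<in> env_ideal L3}"
      using additive_subgroup.zero_closed[OF I.is_additive_subgroup] by (simp add: ps free_space_closed free_algebra_simps)
  next
    fix p q assume "p \<in> {p \<in> words sl2. push_sl2 p \<in> env_ideal L3}" "q \<in> {p \<in> words sl2. push_sl2 p \<in> env_ideal L3}"
    then show "(\<lambda>w. p w + q w) \<in> {p \<in> words sl2. push_sl2 p \<in> env_ideal L3}"
      using additive_subgroup.a_closed[OF I.is_additive_subgroup, of "push_sl2 p" "push_sl2 q"] by (simp add: ps free_space_closed free_algebra_simps)
  next
    fix p q assume "p \<in> {p \<in> words sl2. push_sl2 p \<in> env_ideal L3}" "q \<in> words sl2"
    then show "conv q p \<in> {p \<in> words sl2. push_sl2 p \<in> env_ideal L3}" "conv p q \<in> {p \<in> words sl2. push_sl2 p \<in> env_ideal L3}"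
      using I.I_l_closed[of "push_sl2 p" "push_sl2 q"] I.I_r_closed[of "push_sl2 p" "push_sl2 q"] push_sl2_closed[of q]
      by (simp_all add: push_conv[where X = "carrier sl2"] conv_closed free_algebra_simps)
  qed auto
  then show "p \<in> env_ideal sl2 \<Longrightarrow> push_sl2 p \<in> env_ideal L3" by blast
qed

lemma env_map_kap:
  assumes p: "p \<in> words sl2" shows "env_map L3 sl2_incl (sl2.kap p) = L3.kap (push_sl2 p)"
proof -
  have "L3.kap (push_sl2 p') = L3.kap (push_sl2 p)" if "p' \<in> sl2.kap p" for p'
  proof -
    have p': "p' \<in> words sl2" using sl2.kap_mem[OF p that] by blast
    have "(\<lambda>w. p' w - p w) \<in> env_ideal sl2"
      using sl2.kap_mem[OF p that] sl2.kap_eq_iff[OF p' p] by blast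
    with p' show ?thesis using push_sl2_ideal[of "\<lambda>w. p' w - p w"] p
      by (simp add: push_sl2_diff L3.kap_eq_iff push_sl2_closed)
  qed
  then have "(\<Union>p'\<in>sl2.kap p. L3.kap (push_sl2 p')) = (\<Union>p'\<in>sl2.kap p. L3.kap (push_sl2 p))"
    by (rule SUP_cong[OF refl])
  also have "\<dots> = L3.kap (push_sl2 p)" using sl2.kap_self[OF p] by blast
  finally show ?thesis by (simp only: env_map_def L3.kap_def)
qed

text \<open>The relations involve only nonempty words, and the empty-word coefficient is
  multiplicative. That coefficient is thus the augmentation of U(sl2).\<close>

lemma augmentation_ideal: "p \<in> env_ideal sl2 \<Longrightarrow> p [] = 0"
proof -
  have "env_ideal sl2 \<subseteq> {p \<in> words sl2. p [] = 0}"
  proof (rule sl2.env_ideal_subset)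
    fix X Y assume XY: "X \<in> carrier sl2" "Y \<in> carrier sl2"
    show "sl2.rel_add X Y \<in> {p \<in> words sl2. p [] = 0}" "sl2.rel_bracket X Y \<in> {p \<in> words sl2. p [] = 0}"
      using sl2.rels_in_ideal[OF XY] sl2.env_ideal_closed
      by (auto simp: sl2.rel_add_def sl2.rel_bracket_def delta_def)
  next
    fix X and c :: complex assume X: "X \<in> carrier sl2"
    show "sl2.rel_smult c X \<in> {p \<in> words sl2. p [] = 0}"
      using sl2.rels_in_ideal(2)[OF X X] sl2.env_ideal_closed by (auto simp: sl2.rel_smult_def delta_def)
  qed (auto simp: free_space_closed conv_closed, auto simp: conv_def)
  then show "p \<in> env_ideal sl2 \<Longrightarrow> p [] = 0" by blast
qed

text \<open>Nonempty words act by zero on L(0), which leaves the coefficient of the empty word. It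
  agrees on all representatives, so the set to which \<open>the_elem\<close> is applied is a
  singleton.\<close>

lemma trivial_module_act:
  assumes p: "p \<in> words sl2" and u: "u \<in> carrier (simple_sl2 0)"
  shows "act (env_module (simple_sl2 0)) (sl2.kap p) u = (\<lambda>k. p [] * u k)"
proof -
  interpret M: Module.module complex_ring "simple_sl2 0" by (rule module_simple_sl2)
  have fold: "foldr (act (simple_sl2 0)) w u = (if w = [] then u else (\<lambda>_. 0))" for w
    by (induction w) (auto simp: simple_sl2_def)
  have sum: "(\<Oplus>\<^bsub>simple_sl2 0\<^esub>w\<in>{w. q w \<noteq> 0}. q w \<odot>\<^bsub>simple_sl2 0\<^esub> foldr (act (simple_sl2 0)) w u) = (\<lambda>k. q [] * u k)"
    if q: "q \<in> words sl2" for q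
  proof -
    have fin: "finite {w. q w \<noteq> 0}" using q by (simp add: free_space_simps)
    have qu: "(\<lambda>k. q [] * u k) \<in> carrier (simple_sl2 0)" using u by (simp add: simple_sl2_simps)
    have "(\<Oplus>\<^bsub>simple_sl2 0\<^esub>w\<in>{w. q w \<noteq> 0}. q w \<odot>\<^bsub>simple_sl2 0\<^esub> foldr (act (simple_sl2 0)) w u) =
        (\<Oplus>\<^bsub>simple_sl2 0\<^esub>w\<in>{w. q w \<noteq> 0}. if [] = w then (\<lambda>k. q [] * u k) else \<zero>\<^bsub>simple_sl2 0\<^esub>)"
      by (rule M.finsum_cong') (use qu in \<open>auto simp: fold simple_sl2_simps fun_eq_iff\<close>)
    also have "\<dots> = (\<lambda>k. q [] * u k)"
    proof (cases "q [] = 0")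
      case True
      then have "(\<Oplus>\<^bsub>simple_sl2 0\<^esub>w\<in>{w. q w \<noteq> 0}. if [] = w then (\<lambda>k. q [] * u k) else \<zero>\<^bsub>simple_sl2 0\<^esub>) =
          (\<Oplus>\<^bsub>simple_sl2 0\<^esub>w\<in>{w. q w \<noteq> 0}. \<zero>\<^bsub>simple_sl2 0\<^esub>)"
        by (intro M.finsum_cong') (auto simp: simple_sl2_simps)
      then show ?thesis using True M.finsum_zero[of "{w. q w \<noteq> 0}"] by (simp add: simple_sl2_simps)
    next
      case False
      then show ?thesis using M.finsum_singleton[of "[]" "{w. q w \<noteq> 0}" "\<lambda>_. (\<lambda>k. q [] * u k)"] fin qu by simp
    qed
    finally show ?thesis .
  qed
  have mem: "q \<in> words sl2" "q [] = p []" if "q \<in> sl2.kap p" for q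
  proof -
    have q: "q \<in> words sl2" using sl2.kap_mem[OF p that] by blast
    have "(\<lambda>w. q w - p w) \<in> env_ideal sl2"
      using sl2.kap_mem[OF p that] sl2.kap_eq_iff[OF q p] by blast
    from augmentation_ideal[OF this] q show "q \<in> words sl2" "q [] = p []" by simp_all
  qed
  have val: "(\<Oplus>\<^bsub>simple_sl2 0\<^esub>w\<in>{w. q w \<noteq> 0}. q w \<odot>\<^bsub>simple_sl2 0\<^esub> foldr (act (simple_sl2 0)) w u) = (\<lambda>k. p [] * u k)"
    if "q \<in> sl2.kap p" for q
    using sum[OF mem(1)[OF that]] unfolding mem(2)[OF that] .
  have "(\<lambda>q. \<Oplus>\<^bsub>simple_sl2 0\<^esub>w\<in>{w. q w \<noteq> 0}. q w \<odot>\<^bsub>simple_sl2 0\<^esub> foldr (act (simple_sl2 0)) w u) ` sl2.kap p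
      = (\<lambda>q. (\<lambda>k. p [] * u k)) ` sl2.kap p"
    by (rule image_cong[OF refl val])
  also have "\<dots> = {\<lambda>k. p [] * u k}" using sl2.kap_self[OF p] by blast
  finally have "(\<lambda>q. \<Oplus>\<^bsub>simple_sl2 0\<^esub>w\<in>{w. q w \<noteq> 0}. q w \<odot>\<^bsub>simple_sl2 0\<^esub> foldr (act (simple_sl2 0)) w u) ` sl2.kap p
      = {\<lambda>k. p [] * u k}" .
  then show ?thesis by (simp add: env_module_def)
qed

section \<open>The induced module\<close>

abbreviation triv :: "((mat2 list \<Rightarrow> complex) set, nat \<Rightarrow> complex) rep" where
  "triv \<equiv> env_module (simple_sl2 0)"

abbreviation tensors :: "(complex, U_L3 \<times> (nat \<Rightarrow> complex) \<Rightarrow> complex) module" where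
  "tensors \<equiv> free_space (carrier U3 \<times> carrier triv)"

abbreviation trels :: "(U_L3 \<times> (nat \<Rightarrow> complex) \<Rightarrow> complex) set" where
  "trels \<equiv> tensor_relations (enveloping_algebra sl2) U3 (env_map L3 sl2_incl) triv"

definition tens_rep :: "(U_L3, U_L3 \<times> (nat \<Rightarrow> complex) \<Rightarrow> complex) rep" where
  "tens_rep = module.extend tensors (rep.fields (\<lambda>s. push_forward (\<lambda>(t, u). (s \<otimes>\<^bsub>U3\<^esub> t, u))))"

definition tens_kernel :: "(U_L3 \<times> (nat \<Rightarrow> complex) \<Rightarrow> complex) set" where
  "tens_kernel = \<Inter>{H. submodule H complex_ring tensors \<and> trels \<subseteq> H}"

lemma Q0_eq: "Q 0 = quotient_module tens_rep tens_kernel"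
  by (simp add: Q_def extension_of_scalars_def tens_rep_def tens_kernel_def Let_def)

lemma tens_rep_simps:
  "carrier tens_rep = carrier tensors" "zero tens_rep = zero tensors" "add tens_rep = add tensors"
  "module.smult tens_rep = module.smult tensors"
  "act tens_rep s = push_forward (\<lambda>(t, u). (s \<otimes>\<^bsub>U3\<^esub> t, u))"
  by (simp_all add: tens_rep_def module.defs rep.defs)

lemma triv_simps:
  "carrier triv = {u. \<forall>k>0. u k = 0}" "add triv = (\<lambda>u v k. u k + v k)" "module.smult triv = (\<lambda>c u k. c * u k)"
  by (simp_all add: env_module_def simple_sl2_simps)

text \<open>Explicit forms of the tensor relations. In \<open>trel_bal\<close> a representative p
  stands for an element of U(sl2), which acts on L(0) by \<open>p []\<close>.\<close>

definition trel_addl where "trel_addl s t u = (\<lambda>x. delta (s \<oplus>\<^bsub>U3\<^esub> t, u) x - (delta (s, u) x + delta (t, u) x :: complex))"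
definition trel_addr where "trel_addr s u v = (\<lambda>x. delta (s, \<lambda>k. u k + v k) x - (delta (s :: U_L3, u :: nat \<Rightarrow> complex) x + delta (s, v) x :: complex))"
definition trel_scl where "trel_scl c s u = (\<lambda>x. delta (c \<odot>\<^bsub>U3\<^esub> s, u) x - (c * delta (s, u) x :: complex))"
definition trel_scr where "trel_scr c s u = (\<lambda>x. delta (s, \<lambda>k. c * u k) x - (c * delta (s :: U_L3, u :: nat \<Rightarrow> complex) x :: complex))"
definition trel_bal where
  "trel_bal p s u = (\<lambda>x. delta (s \<otimes>\<^bsub>U3\<^esub> L3.kap (push_sl2 p), u) x - (delta (s, \<lambda>k. p [] * u k) x :: complex))"

lemmas trel_defs = trel_addl_def trel_addr_def trel_scl_def trel_scr_def trel_bal_def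

lemma module_tensors: "Module.module complex_ring tensors"
  by (rule module_free_space) simp_all

lemma minus_tensors: "p \<in> carrier tensors \<Longrightarrow> q \<in> carrier tensors \<Longrightarrow> p \<ominus>\<^bsub>tensors\<^esub> q = (\<lambda>x. p x - q x)"
  by (rule free_space_minus) simp_all

lemma bal_closed: "p \<in> words sl2 \<Longrightarrow> L3.kap (push_sl2 p) \<in> carrier U3"
  by (simp add: L3.carrier_UL push_sl2_closed)

lemma trels_eq:
  "trels = {trel_addl s t u | s t u. s \<in> carrier U3 \<and> t \<in> carrier U3 \<and> u \<in> carrier triv} \<union>
    {trel_addr s u v | s u v. s \<in> carrier U3 \<and> u \<in> carrier triv \<and> v \<in> carrier triv} \<union>
    {trel_scl c s u | c s u. s \<in> carrier U3 \<and> u \<in> carrier triv} \<union>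
    {trel_scr c s u | c s u. s \<in> carrier U3 \<and> u \<in> carrier triv} \<union>
    {trel_bal p s u | p s u. p \<in> words sl2 \<and> s \<in> carrier U3 \<and> u \<in> carrier triv}"
proof -
  have d: "delta (s, u) \<in> carrier tensors" if "s \<in> carrier U3" "u \<in> carrier triv" for s u
    using that by (intro delta_closed) simp
  have add: "(\<lambda>k. u k + v k) \<in> carrier triv" "(\<lambda>k. c * u k) \<in> carrier triv"
    if "u \<in> carrier triv" "v \<in> carrier triv" for u v c using that by (simp_all add: triv_simps)
  have 1: "delta (s \<oplus>\<^bsub>U3\<^esub> t, u) \<ominus>\<^bsub>tensors\<^esub> (delta (s, u) \<oplus>\<^bsub>tensors\<^esub> delta (t, u)) = trel_addl s t u"
    if "s \<in> carrier U3" "t \<in> carrier U3" "u \<in> carrier triv" for s t u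
    using that by (subst minus_tensors) (simp_all only: free_space_simps(3) trel_defs d free_space_closed U3.a_closed)
  have 2: "delta (s, u \<oplus>\<^bsub>triv\<^esub> v) \<ominus>\<^bsub>tensors\<^esub> (delta (s, u) \<oplus>\<^bsub>tensors\<^esub> delta (s, v)) = trel_addr s u v"
    if "s \<in> carrier U3" "u \<in> carrier triv" "v \<in> carrier triv" for s u v
    using that add[OF that(2,3)] by (subst minus_tensors) (simp_all only: triv_simps(2) free_space_simps(3) trel_defs d free_space_closed)
  have 3: "delta (c \<odot>\<^bsub>U3\<^esub> s, u) \<ominus>\<^bsub>tensors\<^esub> (c \<odot>\<^bsub>tensors\<^esub> delta (s, u)) = trel_scl c s u"
    if "s \<in> carrier U3" "u \<in> carrier triv" for c s u
    using that L3.UL_smult(1)[OF that(1,1)] by (subst minus_tensors) (simp_all only: free_space_simps(4) trel_defs d free_space_closed)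
  have 4: "delta (s, c \<odot>\<^bsub>triv\<^esub> u) \<ominus>\<^bsub>tensors\<^esub> (c \<odot>\<^bsub>tensors\<^esub> delta (s, u)) = trel_scr c s u"
    if "s \<in> carrier U3" "u \<in> carrier triv" for c s u
    using that add[OF that(2,2)] by (subst minus_tensors) (simp_all only: triv_simps(3) free_space_simps(4) trel_defs d free_space_closed)
  have 5: "delta (s \<otimes>\<^bsub>U3\<^esub> env_map L3 sl2_incl (sl2.kap p), u) \<ominus>\<^bsub>tensors\<^esub> delta (s, act triv (sl2.kap p) u) = trel_bal p s u"
    if "p \<in> words sl2" "s \<in> carrier U3" "u \<in> carrier triv" for p s u
  proof -
    have "u \<in> carrier (simple_sl2 0)" using that(3) by (simp add: triv_simps simple_sl2_simps)
    then show ?thesis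
      using that add(2)[OF that(3,3), of "p []"] bal_closed[OF that(1)]
      by (simp add: env_map_kap trivial_module_act minus_tensors d trel_defs)
  qed
  have bal: "{delta (s \<otimes>\<^bsub>U3\<^esub> env_map L3 sl2_incl a, u) \<ominus>\<^bsub>tensors\<^esub> delta (s, act triv a u) | a s u.
      a \<in> carrier (enveloping_algebra sl2) \<and> s \<in> carrier U3 \<and> u \<in> carrier triv} =
    {trel_bal p s u | p s u. p \<in> words sl2 \<and> s \<in> carrier U3 \<and> u \<in> carrier triv}"
    unfolding sl2.carrier_UL
  proof (intro equalityI subsetI; elim CollectE exE conjE imageE)
    fix x a s u p assume "a = sl2.kap p" "p \<in> words sl2" "s \<in> carrier U3" "u \<in> carrier triv"
      "x = delta (s \<otimes>\<^bsub>U3\<^esub> env_map L3 sl2_incl a, u) \<ominus>\<^bsub>tensors\<^esub> delta (s, act triv a u)"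
    then show "x \<in> {trel_bal p s u | p s u. p \<in> words sl2 \<and> s \<in> carrier U3 \<and> u \<in> carrier triv}"
      by (intro CollectI exI[of _ p] exI[of _ s] exI[of _ u]) (simp add: 5)
  next
    fix x p s u assume "x = trel_bal p s u" "p \<in> words sl2" "s \<in> carrier U3" "u \<in> carrier triv"
    then show "x \<in> {delta (s \<otimes>\<^bsub>U3\<^esub> env_map L3 sl2_incl a, u) \<ominus>\<^bsub>tensors\<^esub> delta (s, act triv a u) | a s u.
      a \<in> sl2.kap ` words sl2 \<and> s \<in> carrier U3 \<and> u \<in> carrier triv}"
      by (intro CollectI exI[of _ "sl2.kap p"] exI[of _ s] exI[of _ u]) (simp add: 5)
  qed
  show ?thesis unfolding tensor_relations_def Let_def bal
    by (intro arg_cong2[where f = "(\<union>)"] Collect_cong refl) (metis 1, metis 2, metis 3, metis 4)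
qed

lemma trelI:
  assumes "s \<in> carrier U3" "t \<in> carrier U3" "u \<in> carrier triv" "v \<in> carrier triv" "p \<in> words sl2"
  shows "trel_addl s t u \<in> trels" "trel_addr s u v \<in> trels" "trel_scl c s u \<in> trels" "trel_scr c s u \<in> trels"
    "trel_bal p s u \<in> trels"
  unfolding trels_eq Un_iff mem_Collect_eq using assms by metis+

lemma trels_cases:
  assumes "\<And>s t u. s \<in> carrier U3 \<Longrightarrow> t \<in> carrier U3 \<Longrightarrow> u \<in> carrier triv \<Longrightarrow> trel_addl s t u \<in> K"
    "\<And>s u v. s \<in> carrier U3 \<Longrightarrow> u \<in> carrier triv \<Longrightarrow> v \<in> carrier triv \<Longrightarrow> trel_addr s u v \<in> K"
    "\<And>c s u. s \<in> carrier U3 \<Longrightarrow> u \<in> carrier triv \<Longrightarrow> trel_scl c s u \<in> K"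
    "\<And>c s u. s \<in> carrier U3 \<Longrightarrow> u \<in> carrier triv \<Longrightarrow> trel_scr c s u \<in> K"
    "\<And>p s u. p \<in> words sl2 \<Longrightarrow> s \<in> carrier U3 \<Longrightarrow> u \<in> carrier triv \<Longrightarrow> trel_bal p s u \<in> K"
  shows "trels \<subseteq> K"
  unfolding trels_eq by (intro Un_least subsetI; elim CollectE exE conjE; hypsubst; intro assms; assumption)

lemma trels_closed: "trels \<subseteq> carrier tensors"
proof -
  have triv: "(\<lambda>k. u k + v k) \<in> carrier triv" "(\<lambda>k. c * u k) \<in> carrier triv"
    if "u \<in> carrier triv" "v \<in> carrier triv" for u v c using that by (simp_all add: triv_simps)
  show ?thesis
    by (rule trels_cases; unfold trel_defs; intro free_space_minus_closed free_space_closed delta_closed SigmaI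
        U3.a_closed U3.m_closed bal_closed L3.UL_smult(1) triv; assumption)
qed

lemma submodule_tens_kernel: "submodule tens_kernel complex_ring tensors"
proof -
  interpret F: Module.module complex_ring tensors by (rule module_tensors)
  have sub: "submodule (carrier tensors) complex_ring tensors" by (rule F.carrier_is_submodule)
  show ?thesis unfolding tens_kernel_def
  proof (rule F.submoduleI)
    show "\<Inter>{H. submodule H complex_ring tensors \<and> trels \<subseteq> H} \<subseteq> carrier tensors"
      using sub trels_closed by blast
  qed (auto dest: F.submoduleE(3,5) subgroup.one_closed[OF submodule.axioms(1)] intro: submodule.smult_closed)
qed

lemma trels_subset_kernel: "trels \<subseteq> tens_kernel"
  by (auto simp: tens_kernel_def)

lemma tens_kernel_subset:
  assumes K: "K \<subseteq> carrier tensors" "(\<lambda>_. 0) \<in> K" "\<And>p q. p \<in> K \<Longrightarrow> q \<in> K \<Longrightarrow> (\<lambda>x. p x + q x) \<in> K"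
    "\<And>c p. p \<in> K \<Longrightarrow> (\<lambda>x. c * p x) \<in> K" and "trels \<subseteq> K"
  shows "tens_kernel \<subseteq> K"
proof -
  interpret F: Module.module complex_ring tensors by (rule module_tensors)
  have "submodule K complex_ring tensors"
  proof (rule F.submoduleI)
    fix p assume p: "p \<in> K"
    then have "\<ominus>\<^bsub>tensors\<^esub> p = (\<lambda>x. - 1 * p x)"
      using K(1) K(4)[OF p, of "- 1"] by (intro F.minus_equality) (auto simp: free_space_simps(2,3))
    then show "\<ominus>\<^bsub>tensors\<^esub> p \<in> K" using K(4)[OF p] by metis
  qed (use K in \<open>auto simp: free_space_simps(2-)\<close>)
  then show ?thesis using assms(5) by (auto simp: tens_kernel_def)
qed

lemma vs_quotient_tens: "vs_quotient tens_rep tens_kernel"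
proof (intro vs_quotient.intro vs_coset.intro vs_coset_axioms.intro)
  show "Module.module complex_ring tens_rep"
    by (rule module_free_space) (simp_all add: tens_rep_simps)
  show "submodule tens_kernel complex_ring tens_rep"
    using submodule_tens_kernel
    by (simp add: submodule_def submodule_axioms_def subgroup_def tens_rep_simps m_inv_def)
qed

interpretation TQ: vs_quotient tens_rep tens_kernel by (rule vs_quotient_tens)

section \<open>Tensors with the vacuum vector\<close>

definition vac :: "nat \<Rightarrow> complex" where "vac = delta 0"

lemma vac_closed: "vac \<in> carrier triv" by (simp add: vac_def triv_simps delta_def)

lemma delta_tens_closed: "s \<in> carrier U3 \<Longrightarrow> u \<in> carrier triv \<Longrightarrow> delta (s, u) \<in> carrier tensors"
  by (intro delta_closed) simp

definition tcls :: "(U_L3 \<times> (nat \<Rightarrow> complex) \<Rightarrow> complex) \<Rightarrow> Q_elem" where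
  "tcls p = tens_kernel +>\<^bsub>tens_rep\<^esub> p"

definition tens :: "U_L3 \<Rightarrow> Q_elem" where "tens s = tcls (delta (s, vac))"

lemma tcls_eq: "p \<in> carrier tensors \<Longrightarrow> q \<in> carrier tensors \<Longrightarrow> tcls p = tcls q \<longleftrightarrow> (\<lambda>x. p x - q x) \<in> tens_kernel"
  using TQ.coset_eq_iff[of p q] free_space_minus[of tens_rep _ p q]
  by (simp add: tcls_def tens_rep_simps)

lemma tcls_simps:
  "p \<in> carrier tensors \<Longrightarrow> q \<in> carrier tensors \<Longrightarrow> tcls p \<oplus>\<^bsub>Q 0\<^esub> tcls q = tcls (\<lambda>x. p x + q x)"
  "p \<in> carrier tensors \<Longrightarrow> c \<odot>\<^bsub>Q 0\<^esub> tcls p = tcls (\<lambda>x. c * p x)"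
  "carrier (Q 0) = tcls ` carrier tensors" "\<zero>\<^bsub>Q 0\<^esub> = tcls (\<lambda>_. 0)"
  using TQ.add_quotient[of p q] TQ.smult_quotient[of p c] TQ.carrier_quotient TQ.zero_quotient TQ.coset_zero
  by (simp_all add: Q0_eq tcls_def tens_rep_simps free_space_simps(2-))

text \<open>Left multiplication by \<open>s\<close> turns each tensor relation into one of the same
  kind, which makes the action on the quotient well defined.\<close>

lemma push_tens_kernel:
  assumes s: "s \<in> carrier U3" and p: "p \<in> tens_kernel"
  shows "push_forward (\<lambda>(t, u). (s \<otimes>\<^bsub>U3\<^esub> t, u)) p \<in> tens_kernel"
proof -
  let ?f = "\<lambda>(t, u). (s \<otimes>\<^bsub>U3\<^esub> t, u)"
  note ps = push_forward_simps(1)[where X = "carrier U3 \<times> carrier triv"] push_forward_simps(2-)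
  have pd: "push_forward ?f (\<lambda>x. p x - q x) = (\<lambda>x. push_forward ?f p x - push_forward ?f q x)"
    if "p \<in> carrier tensors" "q \<in> carrier tensors" for p q
    using ps(1)[OF that(1) free_space_closed(2)[OF that(2), of "- 1"], of ?f] ps(2)[of ?f "- 1" q] by simp
  have triv: "(\<lambda>k. u k + v k) \<in> carrier triv" "(\<lambda>k. c * u k) \<in> carrier triv"
    if "u \<in> carrier triv" "v \<in> carrier triv" for u v c using that by (simp_all add: triv_simps)
  interpret F: Module.module complex_ring tensors by (rule module_tensors)
  note K = F.submoduleE[OF submodule_tens_kernel] subgroup.one_closed[OF submodule.axioms(1)[OF submodule_tens_kernel]]
  note cl = free_space_closed delta_tens_closed triv U3.a_closed U3.m_closed bal_closed L3.UL_smult(1)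
  have mem: "trels \<subseteq> {p \<in> carrier tensors. push_forward ?f p \<in> tens_kernel}"
  proof (rule trels_cases)
    fix t r u assume h: "t \<in> carrier U3" "r \<in> carrier U3" "u \<in> carrier triv"
    have "push_forward ?f (trel_addl t r u) = trel_addl (s \<otimes>\<^bsub>U3\<^esub> t) (s \<otimes>\<^bsub>U3\<^esub> r) u"
      unfolding trel_addl_def using h s by (simp add: pd ps cl U3.r_distr)
    then show "trel_addl t r u \<in> {p \<in> carrier tensors. push_forward ?f p \<in> tens_kernel}"
      using trelI(1)[of "s \<otimes>\<^bsub>U3\<^esub> t" "s \<otimes>\<^bsub>U3\<^esub> r" u u "\<lambda>_. 0"] trelI(1)[of t r u u "\<lambda>_. 0"] h s
        trels_subset_kernel trels_closed by (auto simp: free_space_closed)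
  next
    fix t u v assume h: "t \<in> carrier U3" "u \<in> carrier triv" "v \<in> carrier triv"
    have "push_forward ?f (trel_addr t u v) = trel_addr (s \<otimes>\<^bsub>U3\<^esub> t) u v"
      unfolding trel_addr_def using h s by (simp add: pd ps cl)
    then show "trel_addr t u v \<in> {p \<in> carrier tensors. push_forward ?f p \<in> tens_kernel}"
      using trelI(2)[of "s \<otimes>\<^bsub>U3\<^esub> t" t u v "\<lambda>_. 0"] trelI(2)[of t t u v "\<lambda>_. 0"] h s
        trels_subset_kernel trels_closed by (auto simp: free_space_closed)
  next
    fix c t u assume h: "t \<in> carrier U3" "u \<in> carrier triv"
    have "push_forward ?f (trel_scl c t u) = trel_scl c (s \<otimes>\<^bsub>U3\<^esub> t) u"
      unfolding trel_scl_def using h s L3.UL_smult(1)[OF h(1,1)] L3.UL_smult(3)[OF s h(1)] by (simp add: pd ps cl)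
    then show "trel_scl c t u \<in> {p \<in> carrier tensors. push_forward ?f p \<in> tens_kernel}"
      using trelI(3)[of "s \<otimes>\<^bsub>U3\<^esub> t" t u u "\<lambda>_. 0"] trelI(3)[of t t u u "\<lambda>_. 0"] h s
        trels_subset_kernel trels_closed by (auto simp: free_space_closed)
  next
    fix c t u assume h: "t \<in> carrier U3" "u \<in> carrier triv"
    have "push_forward ?f (trel_scr c t u) = trel_scr c (s \<otimes>\<^bsub>U3\<^esub> t) u"
      unfolding trel_scr_def using h s by (simp add: pd ps cl)
    then show "trel_scr c t u \<in> {p \<in> carrier tensors. push_forward ?f p \<in> tens_kernel}"
      using trelI(4)[of "s \<otimes>\<^bsub>U3\<^esub> t" t u u "\<lambda>_. 0"] trelI(4)[of t t u u "\<lambda>_. 0"] h s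
        trels_subset_kernel trels_closed by (auto simp: free_space_closed)
  next
    fix p t u assume h: "p \<in> words sl2" "t \<in> carrier U3" "u \<in> carrier triv"
    have "push_forward ?f (trel_bal p t u) = trel_bal p (s \<otimes>\<^bsub>U3\<^esub> t) u"
      unfolding trel_bal_def using h s by (simp add: pd ps cl U3.m_assoc)
    then show "trel_bal p t u \<in> {p \<in> carrier tensors. push_forward ?f p \<in> tens_kernel}"
      using trelI(5)[of "s \<otimes>\<^bsub>U3\<^esub> t" t u u p] trelI(5)[of t t u u p] h s
        trels_subset_kernel trels_closed by auto
  qed
  have "tens_kernel \<subseteq> {p \<in> carrier tensors. push_forward ?f p \<in> tens_kernel}"
  proof (rule tens_kernel_subset[OF _ _ _ _ mem])
    show "(\<lambda>_. 0) \<in> {p \<in> carrier tensors. push_forward ?f p \<in> tens_kernel}"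
      using K(7) by (simp add: ps free_space_closed free_space_simps(2))
  next
    fix p q assume "p \<in> {p \<in> carrier tensors. push_forward ?f p \<in> tens_kernel}" "q \<in> {p \<in> carrier tensors. push_forward ?f p \<in> tens_kernel}"
    then show "(\<lambda>x. p x + q x) \<in> {p \<in> carrier tensors. push_forward ?f p \<in> tens_kernel}"
      using K(5)[of "push_forward ?f p" "push_forward ?f q"] by (simp add: ps free_space_closed free_space_simps(3))
  next
    fix c p assume "p \<in> {p \<in> carrier tensors. push_forward ?f p \<in> tens_kernel}"
    then show "(\<lambda>x. c * p x) \<in> {p \<in> carrier tensors. push_forward ?f p \<in> tens_kernel}"
      using K(4)[of c "push_forward ?f p"] by (simp add: ps free_space_closed free_space_simps(4))
  qed auto
  then show ?thesis using p by blast
qed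

lemma tcls_act:
  assumes s: "s \<in> carrier U3" and p: "p \<in> carrier tensors"
  shows "act (Q 0) s (tcls p) = tcls (push_forward (\<lambda>(t, u). (s \<otimes>\<^bsub>U3\<^esub> t, u)) p)"
proof -
  have "act (quotient_module tens_rep tens_kernel) s (tens_kernel +>\<^bsub>tens_rep\<^esub> p) = tens_kernel +>\<^bsub>tens_rep\<^esub> act tens_rep s p"
  proof (rule TQ.act_quotient)
    show "act tens_rep s u \<in> carrier tens_rep" if "u \<in> carrier tens_rep" for u
      using that s unfolding tens_rep_simps by (intro push_forward_closed) auto
    show "act tens_rep s (u \<oplus>\<^bsub>tens_rep\<^esub> v) = act tens_rep s u \<oplus>\<^bsub>tens_rep\<^esub> act tens_rep s v"
      if "u \<in> carrier tens_rep" "v \<in> carrier tens_rep" for u v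
      using that push_forward_simps(1)[where X = "carrier U3 \<times> carrier triv"]
      by (simp add: tens_rep_simps free_space_simps(3))
    show "act tens_rep s u \<in> tens_kernel" if "u \<in> tens_kernel" for u
      unfolding tens_rep_simps by (rule push_tens_kernel[OF s that])
  qed (use p in \<open>simp add: tens_rep_simps\<close>)
  then show ?thesis by (simp add: Q0_eq tcls_def tens_rep_simps)
qed

lemma tens_simps:
  assumes "s \<in> carrier U3" "t \<in> carrier U3"
  shows "tens s \<oplus>\<^bsub>Q 0\<^esub> tens t = tens (s \<oplus>\<^bsub>U3\<^esub> t)" "c \<odot>\<^bsub>Q 0\<^esub> tens s = tens (c \<odot>\<^bsub>U3\<^esub> s)"
    "act (Q 0) s (tens t) = tens (s \<otimes>\<^bsub>U3\<^esub> t)" "u \<in> carrier triv \<Longrightarrow> tcls (delta (s, u)) = tens (u 0 \<odot>\<^bsub>U3\<^esub> s)"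
proof -
  note cl = free_space_closed delta_tens_closed vac_closed U3.a_closed L3.UL_smult(1)
  have K: "r \<in> trels \<Longrightarrow> r \<in> tens_kernel" for r using trels_subset_kernel by blast
  have sc: "c \<odot>\<^bsub>Q 0\<^esub> tens s = tens (c \<odot>\<^bsub>U3\<^esub> s)" for c
  proof -
    have "tcls (delta (c \<odot>\<^bsub>U3\<^esub> s, vac)) = tcls (\<lambda>x. c * delta (s, vac) x)"
      using K[OF trelI(3)[OF assms(1,1) vac_closed vac_closed free_space_closed(3)], of c] assms L3.UL_smult(1)[OF assms(1,1), of c]
      by (subst tcls_eq) (simp_all add: cl trel_scl_def)
    then show ?thesis using assms by (simp add: tens_def tcls_simps cl)
  qed
  show "c \<odot>\<^bsub>Q 0\<^esub> tens s = tens (c \<odot>\<^bsub>U3\<^esub> s)" by (rule sc)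
  have "tcls (delta (s \<oplus>\<^bsub>U3\<^esub> t, vac)) = tcls (\<lambda>x. delta (s, vac) x + delta (t, vac) x)"
    using K[OF trelI(1)[OF assms vac_closed vac_closed free_space_closed(3)]] assms
    by (subst tcls_eq) (simp_all add: cl trel_addl_def)
  then show "tens s \<oplus>\<^bsub>Q 0\<^esub> tens t = tens (s \<oplus>\<^bsub>U3\<^esub> t)" using assms by (simp add: tens_def tcls_simps cl)
  show "act (Q 0) s (tens t) = tens (s \<otimes>\<^bsub>U3\<^esub> t)"
    using assms by (simp add: tens_def tcls_act cl push_forward_simps)
  assume u: "u \<in> carrier triv"
  have u0: "u = (\<lambda>k. u 0 * vac k)" using u by (auto simp: triv_simps vac_def delta_def fun_eq_iff)
  have "tcls (delta (s, \<lambda>k. u 0 * vac k)) = tcls (\<lambda>x. u 0 * delta (s, vac) x)"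
    using K[OF trelI(4)[OF assms(1,1) vac_closed vac_closed free_space_closed(3)], of "u 0"] assms u u0
    by (subst tcls_eq) (simp_all add: cl trel_scr_def)
  then show "tcls (delta (s, u)) = tens (u 0 \<odot>\<^bsub>U3\<^esub> s)"
    using sc[of "u 0"] assms u0 by (simp add: tens_def tcls_simps cl)
qed

lemma tens_zero: "tens \<zero>\<^bsub>U3\<^esub> = \<zero>\<^bsub>Q 0\<^esub>"
proof -
  have "tens \<zero>\<^bsub>U3\<^esub> = 0 \<odot>\<^bsub>Q 0\<^esub> tens \<one>\<^bsub>U3\<^esub>"
    using tens_simps(2)[of "\<one>\<^bsub>U3\<^esub>" "\<one>\<^bsub>U3\<^esub>" 0] L3.UL_smult(5)[of "\<one>\<^bsub>U3\<^esub>" "\<one>\<^bsub>U3\<^esub>"] by simp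
  also have "\<dots> = \<zero>\<^bsub>Q 0\<^esub>" by (simp add: tens_def tcls_simps delta_tens_closed vac_closed)
  finally show ?thesis .
qed

text \<open>L(0) is spanned by \<open>vac\<close>, so every pure tensor, and then every sum of them,
  collapses to a single tensor with \<open>vac\<close>.\<close>

lemma carrier_Q0: "carrier (Q 0) = tens ` carrier U3"
proof -
  have "tcls p \<in> tens ` carrier U3" if "p \<in> carrier tensors" for p
    using that
  proof (induction p rule: free_space_induct)
    case zero
    then show ?case using tens_zero U3.zero_closed by (auto simp: tcls_simps intro!: image_eqI[of _ _ "\<zero>\<^bsub>U3\<^esub>"])
  next
    case (step c x q)
    obtain s u where x: "x = (s, u)" "s \<in> carrier U3" "u \<in> carrier triv" using step.hyps by auto
    from step.IH obtain t where t: "t \<in> carrier U3" "tcls q = tens t" by blast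
    have us: "u 0 \<odot>\<^bsub>U3\<^esub> s \<in> carrier U3" "c \<odot>\<^bsub>U3\<^esub> (u 0 \<odot>\<^bsub>U3\<^esub> s) \<in> carrier U3"
      using L3.UL_smult(1) x(2) by blast+
    have "tcls (\<lambda>y. c * delta x y + q y) = c \<odot>\<^bsub>Q 0\<^esub> tcls (delta x) \<oplus>\<^bsub>Q 0\<^esub> tcls q"
      using step.hyps by (simp add: tcls_simps free_space_closed delta_closed)
    also have "\<dots> = tens (c \<odot>\<^bsub>U3\<^esub> (u 0 \<odot>\<^bsub>U3\<^esub> s) \<oplus>\<^bsub>U3\<^esub> t)"
      using x t us by (simp add: tens_simps)
    finally show ?case using us t U3.a_closed by blast
  qed
  moreover have "tens s \<in> carrier (Q 0)" if "s \<in> carrier U3" for s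
    using that by (simp add: tens_def tcls_simps delta_tens_closed vac_closed)
  ultimately show ?thesis by (auto simp: tcls_simps(3))
qed

text \<open>Balancing moves X across the tensor sign to L(0), and the word [X] has empty-word
  coefficient 0.\<close>

lemma tens_sl2:
  assumes "s \<in> carrier U3" "X \<in> carrier sl2"
  shows "tens (s \<otimes>\<^bsub>U3\<^esub> env_gen L3 (sl2_incl X)) = \<zero>\<^bsub>Q 0\<^esub>"
proof -
  have X: "delta [X] \<in> words sl2" using assms(2) by (intro delta_closed) simp
  have k: "L3.kap (push_sl2 (delta [X])) = env_gen L3 (sl2_incl X)"
    by (simp add: push_forward_simps L3.env_gen_kap)
  have nil: "delta [X] [] = 0" by (simp add: delta_def)
  have g: "env_gen L3 (sl2_incl X) \<in> carrier U3" using assms by (intro L3.env_gen_closed sl2_incl_closed)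
  have z: "(\<lambda>k. 0) \<in> carrier triv" by (simp add: triv_simps)
  have "trel_bal (delta [X]) s vac \<in> tens_kernel"
    using trelI(5)[OF assms(1,1) vac_closed vac_closed X] trels_subset_kernel by blast
  then have "tens (s \<otimes>\<^bsub>U3\<^esub> env_gen L3 (sl2_incl X)) = tcls (delta (s, \<lambda>k. 0))"
    unfolding tens_def using assms g z
    by (subst tcls_eq) (simp_all add: delta_tens_closed vac_closed trel_bal_def k nil)
  also have "\<dots> = tens (0 \<odot>\<^bsub>U3\<^esub> s)" using tens_simps(4)[OF assms(1,1) z] by simp
  finally show ?thesis using L3.UL_smult(5)[OF assms(1,1)] by (simp add: tens_zero)
qed

section \<open>Identification of Q(0) with the symmetric algebra\<close>

definition pi0 :: "quartic_ring \<Rightarrow> Q_elem" where "pi0 p = tens (sig p)"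

lemma pi0_simps:
  "pi0 p \<oplus>\<^bsub>Q 0\<^esub> pi0 q = pi0 (p + q)" "c \<odot>\<^bsub>Q 0\<^esub> pi0 p = pi0 (cst c * p)"
  "act (Q 0) (sig p) (pi0 q) = pi0 (p * q)" "\<zero>\<^bsub>Q 0\<^esub> = pi0 0"
proof -
  show "c \<odot>\<^bsub>Q 0\<^esub> pi0 p = pi0 (cst c * p)"
    unfolding pi0_def sig_simps(6) by (rule tens_simps(2)) (rule sig_simps(1))+
qed (simp_all add: pi0_def tens_simps sig_simps tens_zero)

text \<open>Move X to the right through the variables with X v = v X + [X, v]. The commutators
  assemble to the derivation \<open>mat_op X\<close>, and at the end X meets the vacuum and
  vanishes.\<close>

lemma pi0_sl2:
  assumes X: "X \<in> carrier sl2"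
  shows "tens (env_gen L3 (sl2_incl X) \<otimes>\<^bsub>U3\<^esub> sig p) = pi0 (mat_op X p)"
proof -
  let ?x = "env_gen L3 (sl2_incl X)"
  have x: "?x \<in> carrier U3" using X by (intro L3.env_gen_closed sl2_incl_closed)
  have step: "tens (?x \<otimes>\<^bsub>U3\<^esub> sig (v * p)) = pi0 (mat_op X (v * p))"
    if k: "k \<le> 3" "sig v = rgen k" "lin_form (act (simple_sl2 3) X (delta k)) = mat_op X v"
      and IH: "tens (?x \<otimes>\<^bsub>U3\<^esub> sig p) = pi0 (mat_op X p)" for k v p
  proof -
    have d: "(delta k :: nat \<Rightarrow> complex) \<in> carrier (simple_sl2 3)" "(\<lambda>_. 0) \<in> carrier (simple_sl2 3)"
      using k(1) by (auto simp: simple_sl2_simps delta_def)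
    have "bracket L3 (sl2_incl X) (rad_vec k) = (0, act (simple_sl2 3) X (delta k))"
      unfolding sl2_incl_def rad_vec_def bracket_L3[OF d(2,1)]
      by (simp add: sl2_simps) (simp add: simple_sl2_def fun_eq_iff)
    then have br: "env_gen L3 (bracket L3 (sl2_incl X) (rad_vec k)) = sig (mat_op X v)"
      using env_gen_radical[OF act_simple_sl2_closed[of 3 X "delta k"]] k(3) by simp
    have "?x \<otimes>\<^bsub>U3\<^esub> sig (v * p) = (?x \<otimes>\<^bsub>U3\<^esub> rgen k) \<otimes>\<^bsub>U3\<^esub> sig p"
      using x rgen_closed[OF k(1)] by (simp add: sig_simps k(2) U3.m_assoc)
    also have "?x \<otimes>\<^bsub>U3\<^esub> rgen k = rgen k \<otimes>\<^bsub>U3\<^esub> ?x \<oplus>\<^bsub>U3\<^esub> sig (mat_op X v)"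
      using L3.env_gen_rels(3)[OF sl2_incl_closed[OF X] rad_vec_closed[OF k(1)]] br by simp
    also have "(rgen k \<otimes>\<^bsub>U3\<^esub> ?x \<oplus>\<^bsub>U3\<^esub> sig (mat_op X v)) \<otimes>\<^bsub>U3\<^esub> sig p = sig v \<otimes>\<^bsub>U3\<^esub> (?x \<otimes>\<^bsub>U3\<^esub> sig p) \<oplus>\<^bsub>U3\<^esub> sig (mat_op X v * p)"
      using x rgen_closed[OF k(1)] by (simp add: sig_simps k(2) U3.m_assoc U3.l_distr)
    finally have "tens (?x \<otimes>\<^bsub>U3\<^esub> sig (v * p)) = act (Q 0) (sig v) (tens (?x \<otimes>\<^bsub>U3\<^esub> sig p)) \<oplus>\<^bsub>Q 0\<^esub> pi0 (mat_op X v * p)"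
      using x by (simp add: tens_simps sig_simps pi0_def)
    also have "\<dots> = pi0 (v * mat_op X p + mat_op X v * p)" unfolding IH by (simp add: pi0_simps)
    also have "v * mat_op X p + mat_op X v * p = mat_op X (v * p)"
      by (simp add: mat_op_def E_simps F_simps H_simps algebra_simps)
    finally show ?thesis .
  qed
  have lf: "lin_form (act (simple_sl2 3) X (delta 0)) = mat_op X pw" "lin_form (act (simple_sl2 3) X (delta 1)) = mat_op X pz"
    "lin_form (act (simple_sl2 3) X (delta 2)) = mat_op X py" "lin_form (act (simple_sl2 3) X (delta 3)) = mat_op X px"
    by (simp_all add: lin_form_def mat_op_def simple_sl2_def delta_def cst_simps algebra_simps)
  show ?thesis
  proof (induction p rule: quartic_induct)
    case (cst c)
    have "?x \<otimes>\<^bsub>U3\<^esub> sig (cst c) = c \<odot>\<^bsub>U3\<^esub> (\<one>\<^bsub>U3\<^esub> \<otimes>\<^bsub>U3\<^esub> ?x)"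
      using x scal_mult(2)[OF x, of c] by (simp add: sig_gens scal_def)
    then have "tens (?x \<otimes>\<^bsub>U3\<^esub> sig (cst c)) = c \<odot>\<^bsub>Q 0\<^esub> tens (\<one>\<^bsub>U3\<^esub> \<otimes>\<^bsub>U3\<^esub> ?x)"
      using x by (simp add: tens_simps(2)[OF x x])
    also have "\<dots> = pi0 0" unfolding tens_sl2[OF U3.one_closed X] by (simp add: pi0_simps)
    finally show ?case by (simp add: mat_op_def)
  next
    case (add p q)
    then show ?case using x
      by (simp add: sig_simps U3.r_distr tens_simps(1)[symmetric] pi0_simps mat_op_simps)
  next
    case (x p) then show ?case by (intro step[of 3]) (simp_all add: sig_gens lf)
  next
    case (y p) then show ?case by (intro step[of 2]) (simp_all add: sig_gens lf)
  next
    case (z p) then show ?case by (intro step[of 1]) (simp_all add: sig_gens lf lf(2)[simplified])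
  next
    case (w p) then show ?case by (intro step[of 0]) (simp_all add: sig_gens lf)
  qed
qed

lemma pi0_act:
  assumes "x \<in> carrier L3"
  shows "act (Q 0) (env_gen L3 x) (pi0 p) = pi0 (quartic_act x p)"
proof -
  obtain X u where x: "x = (X, u)" "X \<in> carrier sl2" "u \<in> carrier (simple_sl2 3)"
    using assms by (cases x) (auto simp: L3_ops sl2_simps simple_sl2_simps)
  have u: "(0, u) \<in> carrier L3" using x(3) by (simp add: L3_ops simple_sl2_simps trace_def)
  have cl: "env_gen L3 (sl2_incl X) \<in> carrier U3" "env_gen L3 x \<in> carrier U3"
    using x assms by (auto intro!: L3.env_gen_closed sl2_incl_closed)
  have "x = sl2_incl X \<oplus>\<^bsub>L3\<^esub> (0, u)" by (simp add: x L3_ops sl2_incl_def)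
  then have "env_gen L3 x = env_gen L3 (sl2_incl X) \<oplus>\<^bsub>U3\<^esub> sig (lin_form u)"
    using L3.env_gen_rels(1)[OF sl2_incl_closed[OF x(2)] u] env_gen_radical[OF x(3)] by simp
  then have "env_gen L3 x \<otimes>\<^bsub>U3\<^esub> sig p = env_gen L3 (sl2_incl X) \<otimes>\<^bsub>U3\<^esub> sig p \<oplus>\<^bsub>U3\<^esub> sig (lin_form u * p)"
    using cl by (simp add: U3.l_distr sig_simps)
  then have "act (Q 0) (env_gen L3 x) (pi0 p) = tens (env_gen L3 (sl2_incl X) \<otimes>\<^bsub>U3\<^esub> sig p) \<oplus>\<^bsub>Q 0\<^esub> pi0 (lin_form u * p)"
    using cl by (simp add: pi0_def tens_simps sig_simps)
  also have "\<dots> = pi0 (mat_op X p + lin_form u * p)" by (simp add: pi0_sl2[OF x(2)] pi0_simps)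
  finally show ?thesis by (simp add: quartic_act_def x)
qed

text \<open>The range contains the vacuum tensor and is stable under all generators by
  \<open>pi0_act\<close>, so induction on words reaches everything.\<close>

lemma pi0_surj: "carrier (Q 0) = range pi0"
proof
  have words: "tens (L3.kap p) \<in> range pi0" if "p \<in> words L3" for p
    using that
  proof (induction p rule: free_space_induct)
    case zero
    have "\<zero>\<^bsub>U3\<^esub> = L3.kap (\<lambda>_. 0)"
      using L3.UL_smult(5)[OF U3.one_closed U3.one_closed] L3.kap_smult[of "delta []" 0]
      by (simp add: L3.kap_one delta_closed)
    then show ?case using tens_zero pi0_simps(4) by (metis rangeI)
  next
    case (step c w q)
    have "tens (L3.kap (delta w)) \<in> range pi0" using step.hyps(1)
    proof (induction w)
      case Nil
      then show ?case by (simp add: L3.kap_one[symmetric] sig_simps(3)[symmetric] pi0_def[symmetric])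
    next
      case (Cons x w)
      then have x: "x \<in> carrier L3" "w \<in> lists (carrier L3)" by auto
      then have w: "delta w \<in> words L3" by (intro delta_closed)
      have "L3.kap (delta (x # w)) = env_gen L3 x \<otimes>\<^bsub>U3\<^esub> L3.kap (delta w)"
        using w L3.gen_closed[OF x(1)] by (simp add: L3.env_gen_kap L3.kap_hom conv_delta)
      moreover have "L3.kap (delta w) \<in> carrier U3" using w by (simp add: L3.carrier_UL)
      ultimately have "tens (L3.kap (delta (x # w))) = act (Q 0) (env_gen L3 x) (tens (L3.kap (delta w)))"
        using x by (simp add: tens_simps L3.env_gen_closed)
      moreover obtain p where "tens (L3.kap (delta w)) = pi0 p" using Cons.IH by blast
      ultimately show ?case by (simp add: pi0_act[OF x(1)])
    qed
    then obtain p where p: "tens (L3.kap (delta w)) = pi0 p" by blast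
    obtain r where r: "tens (L3.kap q) = pi0 r" using step.IH by blast
    have cl: "delta w \<in> words L3" "L3.kap (delta w) \<in> carrier U3" "L3.kap q \<in> carrier U3"
      using step.hyps by (auto simp: L3.carrier_UL intro!: imageI delta_closed)
    have "L3.kap (\<lambda>y. c * delta w y + q y) = c \<odot>\<^bsub>U3\<^esub> L3.kap (delta w) \<oplus>\<^bsub>U3\<^esub> L3.kap q"
      using cl step.hyps by (simp add: L3.kap_smult L3.kap_hom free_space_closed)
    then have "tens (L3.kap (\<lambda>y. c * delta w y + q y)) = pi0 (cst c * p + r)"
      using cl L3.UL_smult(1)[OF cl(2,2)] by (simp add: tens_simps[symmetric] p r pi0_simps)
    then show ?case by simp
  qed
  then show "carrier (Q 0) \<subseteq> range pi0" by (auto simp: carrier_Q0 L3.carrier_UL)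
  show "range pi0 \<subseteq> carrier (Q 0)" by (auto simp: carrier_Q0 pi0_def sig_simps)
qed

text \<open>
  The symmetric algebra is itself a module over the enveloping algebra in which \<open>1\<close> is invariant,
  and \<open>s \<otimes> u \<mapsto> u\<^sub>0 (s \<cdot> 1)\<close> descends to the induced module. So no polynomial is lost in it.
\<close>

lemma pi0_inj: "pi0 p = pi0 q \<Longrightarrow> p = q"
proof -
  define lam where "lam = lin_ext (\<lambda>(s, u :: nat \<Rightarrow> complex). cst (u 0) * uact s 1)"
  have lam: "lam (\<lambda>x. p x + q x) = lam p + lam q" if "p \<in> carrier tensors" "q \<in> carrier tensors" for p q
    unfolding lam_def by (rule lin_ext_add[OF that])
  have lams: "lam (\<lambda>x. c * p x) = cst c * lam p" "lam (delta (s, u)) = cst (u 0) * uact s 1" "lam (\<lambda>_. 0) = 0" for c p s u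
    by (simp_all add: lam_def lin_ext_scale lin_ext_delta lin_ext_zero)
  have lamd: "lam (\<lambda>x. p x - q x) = lam p - lam q" if "p \<in> carrier tensors" "q \<in> carrier tensors" for p q
    using lam[OF that(1) free_space_closed(2)[OF that(2), of "- 1"]] lams(1)[of "- 1" q] by (simp add: cst_simps)
  have triv: "(\<lambda>k. u k + v k) \<in> carrier triv" "(\<lambda>k. c * u k) \<in> carrier triv"
    if "u \<in> carrier triv" "v \<in> carrier triv" for u v c using that by (simp_all add: triv_simps)
  note cl = free_space_closed delta_tens_closed triv U3.a_closed U3.m_closed bal_closed L3.UL_smult(1)
  \<comment> \<open>The polynomial 1 is invariant, so words in sl2 act on it by their empty-word
    coefficient. This is what the balancing relation demands.\<close>
  have aug: "tact (push_sl2 p) 1 = cst (p [])" if "p \<in> words sl2" for p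
    using that
  proof (induction p rule: free_space_induct)
    case (step c w p)
    have "word_act (map sl2_incl w) 1 = (if w = [] then 1 else 0)"
    proof (induction w)
      case (Cons X w)
      then show ?case
        by (auto simp: word_act_simps quartic_act_simps quartic_act_sl2_incl mat_op_def E_simps F_simps H_simps)
    qed (simp add: word_act_simps)
    moreover have "push_sl2 (\<lambda>y. c * delta w y + p y) = (\<lambda>y. c * delta (map sl2_incl w) y + push_sl2 p y)"
      using push_forward_simps(1)[OF free_space_closed(2)[OF delta_closed[OF step.hyps(1)], of c] step.hyps(2), of "map sl2_incl"]
      by (simp add: push_forward_simps)
    moreover have "delta (map sl2_incl w) \<in> words L3" using step.hyps(1) sl2_incl_closed by (intro delta_closed) auto
    ultimately show ?case using step.hyps push_sl2_closed[OF step.hyps(2)] step.IH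
      by (simp add: tact_simps free_space_closed cst_simps delta_def[of w])
  qed (simp add: push_forward_simps tact_simps cst_simps)
  have ker: "trels \<subseteq> {p \<in> carrier tensors. lam p = 0}"
  proof (rule trels_cases)
    fix s t u assume h: "s \<in> carrier U3" "t \<in> carrier U3" "u \<in> carrier triv"
    then have "lam (trel_addl s t u) = 0"
      unfolding trel_defs by (simp add: cl lamd lam lams uact_simps distrib_left)
    then show "trel_addl s t u \<in> {p \<in> carrier tensors. lam p = 0}"
      using trelI(1)[of s t u u "\<lambda>_. 0"] trels_closed h free_space_closed(3) by auto
  next
    fix s u v assume h: "s \<in> carrier U3" "u \<in> carrier triv" "v \<in> carrier triv"
    then have "lam (trel_addr s u v) = 0"
      unfolding trel_defs by (simp add: cl lamd lam lams cst_simps distrib_right)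
    then show "trel_addr s u v \<in> {p \<in> carrier tensors. lam p = 0}"
      using trelI(2)[of s s u v "\<lambda>_. 0"] trels_closed h free_space_closed(3) by auto
  next
    fix c s u assume h: "s \<in> carrier U3" "u \<in> carrier triv"
    then have "lam (trel_scl c s u) = 0"
      unfolding trel_defs using L3.UL_smult(1)[OF h(1,1), of c] uact_simps(2)[OF h(1,1)]
      by (simp add: cl lamd lams mult.left_commute)
    then show "trel_scl c s u \<in> {p \<in> carrier tensors. lam p = 0}"
      using trelI(3)[of s s u u "\<lambda>_. 0"] trels_closed h free_space_closed(3) by auto
  next
    fix c s u assume h: "s \<in> carrier U3" "u \<in> carrier triv"
    then have "lam (trel_scr c s u) = 0"
      unfolding trel_defs by (simp add: cl lamd lams cst_simps mult.assoc)
    then show "trel_scr c s u \<in> {p \<in> carrier tensors. lam p = 0}"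
      using trelI(4)[of s s u u "\<lambda>_. 0"] trels_closed h free_space_closed(3) by auto
  next
    fix p s u assume h: "p \<in> words sl2" "s \<in> carrier U3" "u \<in> carrier triv"
    have "uact (s \<otimes>\<^bsub>U3\<^esub> L3.kap (push_sl2 p)) 1 = cst (p []) * uact s 1"
      using uact_simps(3)[OF h(2) bal_closed[OF h(1)]] uact_simps(4)[OF h(2,2), of "p []" 1]
      by (simp add: uact_kap push_sl2_closed h aug)
    then have "lam (trel_bal p s u) = 0"
      unfolding trel_defs using h by (simp add: cl lamd lams cst_simps mult_ac)
    then show "trel_bal p s u \<in> {p \<in> carrier tensors. lam p = 0}"
      using trelI(5)[of s s u u p] trels_closed h by auto
  qed
  have K: "tens_kernel \<subseteq> {p \<in> carrier tensors. lam p = 0}"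
    by (rule tens_kernel_subset[OF _ _ _ _ ker]) (auto simp: free_space_closed lam lams)
  assume "pi0 p = pi0 q"
  then have "(\<lambda>x. delta (sig p, vac) x - delta (sig q, vac) x) \<in> tens_kernel"
    by (simp add: pi0_def tens_def tcls_eq delta_tens_closed vac_closed sig_simps)
  then have "lam (\<lambda>x. delta (sig p, vac) x - delta (sig q, vac) x) = 0" using K by blast
  moreover have "vac 0 = 1" by (simp add: vac_def delta_def)
  ultimately show "p = q"
    by (simp add: lamd lams delta_tens_closed vac_closed sig_simps uact_sig cst_simps)
qed

section \<open>The modules Q(0, chi) and V(0, chi)\<close>

lemma quartic_rep_Q0: "quartic_rep pi0 (pullback_module (env_gen L3) (Q 0))"
proof (intro quartic_rep.intro quartic_image.intro quartic_rep_axioms.intro)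
  show "sub_space UNIV" by (simp add: sub_space_def)
qed (simp_all add: pi0_surj pi0_simps pi0_act)

lemma quartic_rep_Q_chi:
  obtains \<pi> where "quartic_rep \<pi> (Q_chi 0 chi)" "disc_ideal chi \<subseteq> quartic_rep.ker \<pi> (Q_chi 0 chi)"
    "1 \<notin> quartic_rep.ker \<pi> (Q_chi 0 chi)"
proof -
  let ?M = "pullback_module (env_gen L3) (Q 0)"
  interpret R: quartic_rep pi0 ?M by (rule quartic_rep_Q0)
  let ?N = "pi0 ` disc_ideal chi"
  have N: "lie_submodule L3 ?M ?N" by (rule R.lie_submodule_image[OF inv_ideal_disc_ideal])
  have eq: "Q_chi 0 chi = quotient_module ?M ?N"
  proof -
    have "{act (Q 0) (cubic_discriminant \<ominus>\<^bsub>U3\<^esub> (chi \<odot>\<^bsub>U3\<^esub> \<one>\<^bsub>U3\<^esub>)) q | q. q \<in> carrier (Q 0)} = ?N"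
      unfolding pi0_surj sig_disc[symmetric] disc_ideal_def image_image pi0_simps(3)[symmetric] by blast
    then show ?thesis by (simp add: Q_chi_def Let_def)
  qed
  note q = R.quartic_rep_quotient[OF N, folded eq]
  interpret S: quartic_rep "\<lambda>p. ?N +>\<^bsub>?M\<^esub> pi0 p" "Q_chi 0 chi" by (rule q(1))
  have "S.ker = pi0 -` ?N" unfolding S.ker_def using q(2) by auto
  \<comment> \<open>Injectivity of \<open>pi0\<close> makes the kernel exactly the ideal of C -
    \<open>chi\<close>, hence proper.\<close>
  then have "S.ker = disc_ideal chi" using pi0_inj by auto
  with q(1) disc_ideal_proper that show thesis by blast
qed

text \<open>\<open>V0\<close> is defined by a description operator, so existence and uniqueness of
  the kernel are proved along with the two claims about the quotient.\<close>

theorem corollary66: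
  fixes chi :: complex
  shows "(\<exists>!N. simple_quotient_kernel L3 (Q_chi 0 chi) N) \<and>
    harish_chandra_module sl2 sl2_incl L3 (V0 chi) \<and>
    (chi \<noteq> 0 \<longrightarrow> \<not> finite_dimensional (V0 chi))"
proof -
  obtain \<pi> where \<pi>: "quartic_rep \<pi> (Q_chi 0 chi)" "disc_ideal chi \<subseteq> quartic_rep.ker \<pi> (Q_chi 0 chi)"
    "1 \<notin> quartic_rep.ker \<pi> (Q_chi 0 chi)" by (rule quartic_rep_Q_chi)
  interpret R: quartic_rep \<pi> "Q_chi 0 chi" by (rule \<pi>(1))
  let ?N = "\<pi> ` max_ideal chi"
  note kernel_iff = R.simple_quotient_kernel_iff[OF \<pi>(2,3)]
  have N: "lie_submodule L3 (Q_chi 0 chi) ?N" by (rule R.lie_submodule_image[OF inv_ideal_max_ideal])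
  have V0: "V0 chi = quotient_module (Q_chi 0 chi) ?N" by (simp add: V0_def kernel_iff)
  note rep = R.quartic_rep_quotient[OF N, folded V0]
  interpret S: quartic_rep "\<lambda>p. ?N +>\<^bsub>Q_chi 0 chi\<^esub> \<pi> p" "V0 chi" by (rule rep(1))
  have "R.ker \<subseteq> max_ideal chi" using \<pi>(2,3) by (intro max_ideal_greatest R.inv_ideal_ker)
  then have "S.ker = max_ideal chi"
    unfolding S.ker_def rep(2) using R.preimage_image[OF inv_ideal_sub[OF inv_ideal_max_ideal]] by auto
  then have ker: "disc_ideal chi \<subseteq> S.ker" "1 \<notin> S.ker"
    using disc_ideal_subset_max one_notin_max_ideal by auto
  show ?thesis
  proof (intro conjI impI)
    show "\<exists>!N. simple_quotient_kernel L3 (Q_chi 0 chi) N" by (simp add: kernel_iff)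
    show "harish_chandra_module sl2 sl2_incl L3 (V0 chi)" by (rule harish_chandra_image[OF rep(1) ker(1)])
    show "\<not> finite_dimensional (V0 chi)" if "chi \<noteq> 0" by (rule S.infinite_dimensional[OF ker that])
  qed
qed

end
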